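(* Let $0<\alpha<1$, $\nu<1-\alpha$, $1<p\le2$, $q=p/(p-1)$. Let $sf^*(s)\in L_p(\nu-i\infty,\nu+i\infty)$, where $f^*(s)$ is the Mellin transform of a function $f\in L_1((1,\infty);t^\alpha dt)$ (i.e. $f$ is integrable over $(1,\infty)$ with respect to the measure $t^\alpha dt$). Suppose in addition that the transform $$F_\alpha(\tau)=\int_0^\infty\left|K_{(i\tau+\alpha)/2}(x)\right|^2f(x)\,dx,\qquad\tau\in\mathbb{R},$$ satisfies $\tau e^{\pi|\tau|}F_\alpha(\tau)\in L_1(\mathbb{R})$, and that $f^*(1-\alpha)=0$. Then for all $x>0$ $$f(x)=\frac1\pi\int_{-\infty}^\infty\left[\frac{(x/2)^{i\tau-1}}{\Gamma\left(\frac{i\tau-\alpha}{2}\right)\Gamma\left(\frac{\alpha+i\tau}{2}\right)}\;{}_2F_3\!\left(\frac{i\tau}{2},\frac{1+i\tau}{2};\,1+i\tau,\frac{i\tau-\alpha}{2},\frac{\alpha+i\tau}{2};\,x^2\right)-\frac{2\cosh(\pi\tau/2)}{x\,\Gamma(\alpha/2)\Gamma(-\alpha/2)}\right]F_\alpha(\tau)\,d\tau,$$ where the integral converges absolutely.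
   Context: $K_\mu(z)$ is the Macdonald function (modified Bessel function of the second kind), $\Gamma$ is Euler's gamma function, and ${}_2F_3(a_1,a_2;b_1,b_2,b_3;z)$ is the generalized hypergeometric function. The Mellin transform of $f$ is $f^*(s)=\int_0^\infty f(x)x^{s-1}dx$, and the inverse is $f(x)=\frac{1}{2\pi i}\int_{\nu-i\infty}^{\nu+i\infty}f^*(s)x^{-s}ds$; on the line $\mathrm{Re}\,s=\nu$ these are understood in the mean-convergence sense of Mellin transform theory for $L_p$, so that $f^*\in L_p(\nu-i\infty,\nu+i\infty)$ corresponds to $f$ with $\int_0^\infty x^{\nu q-1}|f(x)|^q dx<\infty$, and $f$ is identified with the function given by the inversion formula. *)

theory Defs
  imports "HOL-Analysis.Analysis"
begin

(* Standard integral representation; valid as a definition for complex order and Re z > 0. *)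
definition Macdonald_K :: "complex \<Rightarrow> complex \<Rightarrow> complex" where
  "Macdonald_K \<mu> z =
     (LINT u:{0..}|lborel. exp (- z * cosh (complex_of_real u)) * cosh (\<mu> * complex_of_real u))"

definition hyp2F3 ::
  "complex \<Rightarrow> complex \<Rightarrow> complex \<Rightarrow> complex \<Rightarrow> complex \<Rightarrow> complex \<Rightarrow> complex" where
  "hyp2F3 a1 a2 b1 b2 b3 z = eval_fps (fps_hypergeo [a1, a2] [b1, b2, b3] 1) z"

definition mellin :: "(real \<Rightarrow> complex) \<Rightarrow> complex \<Rightarrow> complex" where
  "mellin f s = (LINT x:{0<..}|lborel. f x * complex_of_real x powr (s - 1))"

definition mellin_trunc :: "real \<Rightarrow> (real \<Rightarrow> complex) \<Rightarrow> complex \<Rightarrow> complex" where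
  "mellin_trunc R f s = (LINT x:{1/R..R}|lborel. f x * complex_of_real x powr (s - 1))"

(* Inverse Mellin integrals along Re s = \<nu>, parametrised by s = \<nu> + i t;
   the factor i of ds = i dt cancels against 1 / (2 pi i). *)
definition mellin_inverse :: "real \<Rightarrow> (complex \<Rightarrow> complex) \<Rightarrow> real \<Rightarrow> complex" where
  "mellin_inverse \<nu> g x =
     1 / (2 * of_real pi) * (LINT t|lborel. g (Complex \<nu> t) * complex_of_real x powr (- Complex \<nu> t))"

definition mellin_inverse_trunc ::
  "real \<Rightarrow> real \<Rightarrow> (complex \<Rightarrow> complex) \<Rightarrow> real \<Rightarrow> complex" where
  "mellin_inverse_trunc R \<nu> g x =
     1 / (2 * of_real pi) *
       (LINT t:{-R..R}|lborel. g (Complex \<nu> t) * complex_of_real x powr (- Complex \<nu> t))"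

definition Lp_line :: "real \<Rightarrow> real \<Rightarrow> (complex \<Rightarrow> complex) \<Rightarrow> bool" where
  "Lp_line p \<nu> g \<longleftrightarrow>
     (\<lambda>t. g (Complex \<nu> t)) \<in> borel_measurable lborel \<and>
     integrable lborel (\<lambda>t. norm (g (Complex \<nu> t)) powr p)"

definition Lq_weighted :: "real \<Rightarrow> real \<Rightarrow> (real \<Rightarrow> complex) \<Rightarrow> bool" where
  "Lq_weighted q \<nu> f \<longleftrightarrow>
     set_borel_measurable lborel {0<..} f \<and>
     set_integrable lborel {0<..} (\<lambda>x. x powr (\<nu> * q - 1) * norm (f x) powr q)"

(* g is the Mellin transform of f on the line Re s = \<nu>: both the direct and the inverse
   integrals converge in mean (in the norms of Lp_line p \<nu> and Lq_weighted q \<nu>).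
   Only the values of g on that line matter. *)
definition mellin_transform_Lp ::
  "real \<Rightarrow> real \<Rightarrow> real \<Rightarrow> (real \<Rightarrow> complex) \<Rightarrow> (complex \<Rightarrow> complex) \<Rightarrow> bool" where
  "mellin_transform_Lp p q \<nu> f g \<longleftrightarrow>
     Lq_weighted q \<nu> f \<and> Lp_line p \<nu> g \<and>
     ((\<lambda>R. \<integral>\<^sup>+ t. ennreal (norm (mellin_trunc R f (Complex \<nu> t) - g (Complex \<nu> t)) powr p) \<partial>lborel)
        \<longlongrightarrow> 0) at_top \<and>
     ((\<lambda>R. \<integral>\<^sup>+ x\<in>{0<..}.
             ennreal (x powr (\<nu> * q - 1) * norm (mellin_inverse_trunc R \<nu> g x - f x) powr q) \<partial>lborel)
        \<longlongrightarrow> 0) at_top"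

definition F_transform :: "real \<Rightarrow> (real \<Rightarrow> complex) \<Rightarrow> real \<Rightarrow> complex" where
  "F_transform \<alpha> f \<tau> =
     (LINT x:{0<..}|lborel.
        of_real ((norm (Macdonald_K ((\<i> * of_real \<tau> + of_real \<alpha>) / 2) (of_real x)))\<^sup>2) * f x)"

definition inversion_kernel :: "real \<Rightarrow> real \<Rightarrow> real \<Rightarrow> complex" where
  "inversion_kernel \<alpha> x \<tau> =
     complex_of_real (x / 2) powr (\<i> * of_real \<tau> - 1)
       / (Gamma ((\<i> * of_real \<tau> - of_real \<alpha>) / 2) * Gamma ((of_real \<alpha> + \<i> * of_real \<tau>) / 2))
       * hyp2F3 (\<i> * of_real \<tau> / 2) ((1 + \<i> * of_real \<tau>) / 2)
           (1 + \<i> * of_real \<tau>) ((\<i> * of_real \<tau> - of_real \<alpha>) / 2) ((of_real \<alpha> + \<i> * of_real \<tau>) / 2)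
           (of_real (x\<^sup>2))
     - of_real (2 * cosh (pi * \<tau> / 2) / (x * Gamma (\<alpha> / 2) * Gamma (- \<alpha> / 2)))"

end

theory Submission
  imports Defs "HOL-Probability.Probability" "HOL-Complex_Analysis.Complex_Analysis" "HOL-Real_Asymp.Real_Asymp"
begin

text \<open>The transform factors through two Laplace transforms, and each of them is inverted on a series of
powers.

On a logarithmic scale, with \<open>\<phi>(c) = f(e^c)\<close>, the product of the two conjugate Macdonald functions is
a Fourier integral of a single one of real order,
\<open>|K_{(i\<tau>+\<alpha>)/2}(x)|^2 = \<integral> e^{i\<tau>b} K_\<alpha>(2x cosh b) db\<close>
(\<open>norm_Macdonald_K_squared\<close>). Hence \<open>F_\<alpha>\<close> is the Fourier transform of \<open>b \<mapsto> G(2 cosh b)\<close>, where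
\<open>G(y) = \<integral> K_\<alpha>(xy) f(x) dx\<close>, and Fourier inversion expresses \<open>G(2 cosh t)\<close> through
\<open>\<integral> F_\<alpha>(\<tau>) e^{-i\<tau>t} d\<tau>\<close> (\<open>transform_eq_fourier\<close>).

Two consequences are drawn from this formula. First, since \<open>F_\<alpha>\<close> decays exponentially, both sides
continue analytically to the strip \<open>|Im t| < \<pi>/2\<close>. At \<open>t = i\<theta>\<close> with \<open>\<theta> \<rightarrow> \<plusminus>\<pi>/2\<close> the argument
\<open>y = 2 cos \<theta>\<close> tends to 0. The singular part \<open>y^{-\<alpha>}\<close> of \<open>K_\<alpha>(xy)\<close> is multiplied by
\<open>f*(1-\<alpha>) = 0\<close>, so \<open>G(y) = O(y^\<alpha>)\<close>, and \<open>\<integral> F_\<alpha>(\<tau>) cosh(\<pi>\<tau>/2) d\<tau> = 0\<close> (\<open>cosh_moment_zero\<close>). The second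
summand of the kernel therefore contributes nothing to the integral.

Second, for \<open>y = 2 cosh t > 2\<close> there is the expansion
\<open>e^{-i\<tau>t} = \<Sum>_n c_n(i\<tau>) y^{-i\<tau>-2n}\<close> (\<open>catalan_series_cosh\<close>), and the function
\<open>K_\<alpha>(xy) = 1/2 (y/x)^\<alpha> \<integral>_0^\<infinity> exp(-y^2 w/2 - x^2/(2w)) w^{\<alpha>-1} dw\<close> shows that
\<open>y^{-\<alpha>} G(y)\<close> is a Laplace transform in \<open>y^2\<close> of a function built from
\<open>\<Phi>(r) = \<integral> e^{-r x^2} x^{-\<alpha>} f(x) dx\<close>. Each power \<open>y^{-2s}\<close> is the Laplace transform of a power of \<open>w\<close>
divided by \<open>\<Gamma>(s)\<close>, so uniqueness of Laplace transforms yields \<open>\<Phi>\<close> as a series of powers of \<open>r\<close>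
(\<open>stage1_eq_series1\<close>, \<open>Phi_eq\<close>). As \<open>\<Phi>\<close> is again a Laplace transform, in the variable \<open>x^2\<close>, the same argument
produces \<open>f\<close> with a second Gamma function in the denominators (\<open>stage2_eq_series2\<close>). The resulting
series is the hypergeometric series of the kernel (\<open>kernel_series\<close>).

In the second step the leading exponent has real part \<open>-\<alpha>/2 < 0\<close>, for which the Gamma integral
diverges at the origin. The argument is therefore applied to \<open>\<Phi>(r) - \<Phi>(r+1)\<close>, whose additional factor
\<open>1 - e^{-x^2}\<close> restores convergence (\<open>Gamma_difference_integral\<close>).

All interchanges are justified by absolute convergence: the coefficients satisfy
\<open>|c_n(i\<tau>)| \<le> 2^{|\<tau>|} 5^n\<close>, the reciprocal Gamma factors grow at most like \<open>e^{\<pi>|\<tau>|/2}\<close> up to a linear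
factor, and \<open>ln 2 + \<pi>/2 < \<pi>\<close>. What
enters of \<open>f\<close> is its continuity, the integrability of \<open>x^{-\<alpha>} f\<close> and \<open>x^\<alpha> f\<close>, and the vanishing moment. Continuity and
integrability near the origin follow from the Mellin hypotheses, because \<open>f*\<close> is integrable on the line and so
\<open>f(x) = O(x^{-\<nu>})\<close> (\<open>Lp_line_integrable\<close>, \<open>mellin_inverse_exp\<close>).\<close>

section \<open>Exponential substitution and Gamma integrals\<close>

text \<open>Stating the substitution \<open>x = e^a\<close> as an identity of measures gives it for every integrable function
at once. On a set it follows from the substitution rule on \<open>[-n, n]\<close> by monotone convergence.\<close>

lemma distr_exp_lborel:
  "distr (density lborel (\<lambda>a. ennreal (exp a))) borel exp = density lborel (indicator {0<..})"
proof (rule measure_eqI)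
  fix A :: "real set" assume "A \<in> sets (distr (density lborel (\<lambda>a. ennreal (exp a))) borel exp)"
  hence A[measurable]: "A \<in> sets borel" by simp
  have inc1: "incseq (\<lambda>n x. ennreal (indicator A x) * indicator {exp (- real n)..exp (real n)} x)"
    by (auto simp: incseq_def le_fun_def split: split_indicator) (erule order_trans[rotated] order_trans; simp)+
  have inc2: "incseq (\<lambda>n x. ennreal (indicator A (exp x) * exp x) * indicator {- real n..real n} x)"
    by (auto simp: incseq_def le_fun_def split: split_indicator)
  have s1: "(SUP n. ennreal (indicator A x) * indicator {exp (- real n)..exp (real n)} x)
      = ennreal (indicator A x) * indicator {0<..} x" for x :: real
  proof (cases "0 < x")
    case True
    obtain N :: nat where N: "\<bar>ln x\<bar> \<le> real N" using real_arch_simple by blast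
    have "(\<lambda>n. ennreal (indicator A x) * indicator {exp (- real n)..exp (real n)} x) \<longlonglongrightarrow>
      ennreal (indicator A x)"
    proof (rule tendsto_eventually, rule eventually_sequentiallyI[of N])
      fix n assume n: "N \<le> n"
      have "exp (- real n) \<le> exp (ln x)" "exp (ln x) \<le> exp (real n)" using N n by auto
      then show "ennreal (indicator A x) * indicator {exp (- real n)..exp (real n)} x = ennreal (indicator A x)"
        using True by auto
    qed
    from LIMSEQ_unique[OF this LIMSEQ_SUP] inc1 True show ?thesis
      by (auto simp: incseq_def le_fun_def)
  next
    case False
    have "\<not> (exp (- real n) \<le> x)" for n using False exp_gt_zero[of "- real n"] by linarith
    then show ?thesis using False by simp
  qed
  have s2: "(SUP n. ennreal (indicator A (exp x) * exp x) * indicator {- real n..real n} x)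
      = ennreal (indicator A (exp x) * exp x)" for x :: real
  proof -
    obtain N :: nat where N: "\<bar>x\<bar> \<le> real N" using real_arch_simple by blast
    have "(\<lambda>n. ennreal (indicator A (exp x) * exp x) * indicator {- real n..real n} x) \<longlonglongrightarrow>
      ennreal (indicator A (exp x) * exp x)"
    proof (rule tendsto_eventually, rule eventually_sequentiallyI[of N])
      fix n assume n: "N \<le> n"
      have "- real n \<le> x" "x \<le> real n" using N n by linarith+
      then show "ennreal (indicator A (exp x) * exp x) * indicator {- real n..real n} x = ennreal (indicator A (exp x) * exp x)"
        by auto
    qed
    from LIMSEQ_unique[OF this LIMSEQ_SUP] inc2 show ?thesis
      by (auto simp: incseq_def le_fun_def)
  qed
  have "emeasure (distr (density lborel (\<lambda>a. ennreal (exp a))) borel exp) A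
     = (\<integral>\<^sup>+x. ennreal (indicator A (exp x) * exp x) \<partial>lborel)"
    by (simp add: nn_integral_density ennreal_mult' ennreal_indicator mult.commute nn_integral_distr
        flip: nn_integral_indicator)
  also have "\<dots> = (SUP n. \<integral>\<^sup>+x. ennreal (indicator A (exp x) * exp x) * indicator {- real n..real n} x \<partial>lborel)"
    by (subst nn_integral_monotone_convergence_SUP[symmetric, OF inc2]) (auto simp: s2)
  also have "\<dots> = (SUP n. \<integral>\<^sup>+x. ennreal (indicator A x) * indicator {exp (- real n)..exp (real n)} x \<partial>lborel)"
  proof (rule SUP_cong[OF refl])
    fix n :: nat
    have "(\<integral>\<^sup>+x. ennreal (indicator A x * indicator {exp (- real n)..exp (real n)} x) \<partial>lborel) =
             (\<integral>\<^sup>+x. ennreal (indicator A (exp x) * exp x * indicator {- real n..real n} x) \<partial>lborel)"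
      by (rule nn_integral_substitution[where g=exp and g'=exp])
         (auto intro!: derivative_eq_intros continuous_intros simp: set_borel_measurable_def)
    then show "(\<integral>\<^sup>+x. ennreal (indicator A (exp x) * exp x) * indicator {- real n..real n} x \<partial>lborel) =
      (\<integral>\<^sup>+x. ennreal (indicator A x) * indicator {exp (- real n)..exp (real n)} x \<partial>lborel)"
      by (simp add: ennreal_mult' ennreal_indicator)
  qed
  also have "\<dots> = (\<integral>\<^sup>+x. ennreal (indicator A x) * indicator {0<..} x \<partial>lborel)"
    by (subst nn_integral_monotone_convergence_SUP[symmetric, OF inc1]) (auto simp: s1)
  also have "\<dots> = emeasure (density lborel (indicator {0<..})) A"
    by (auto simp: emeasure_density ennreal_indicator mult.commute intro!: nn_integral_cong)
  finally show "emeasure (distr (density lborel (\<lambda>a. ennreal (exp a))) borel exp) A = emeasure (density lborel (indicator {0<..})) A" .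
qed auto

lemma set_integrable_exp_substitution:
  fixes f :: "real \<Rightarrow> complex"
  assumes "set_borel_measurable borel {0<..} f"
  shows "set_integrable lborel {0<..} f \<longleftrightarrow> integrable lborel (\<lambda>a. of_real (exp a) * f (exp a))"
    and "(LINT x:{0<..}|lborel. f x) = (LINT a|lborel. of_real (exp a) * f (exp a))"
proof -
  define g where "g = (\<lambda>x. indicator {0<..} x *\<^sub>R f x)"
  have g[measurable]: "g \<in> borel_measurable borel" using assms by (simp add: set_borel_measurable_def g_def)
  have gg: "g (exp a) = f (exp a)" for a by (simp add: g_def)
  have gi: "indicator {0<..} x *\<^sub>R g x = indicator {0<..} x *\<^sub>R f x" for x by (simp add: g_def indicator_def)
  have di: "density lborel (indicator {0::real<..}) = density lborel (\<lambda>x. ennreal (indicator {0<..} x))"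
    by (simp add: ennreal_indicator)
  have "integrable lborel (\<lambda>a. exp a *\<^sub>R g (exp a)) \<longleftrightarrow> integrable (density lborel (\<lambda>a. ennreal (exp a))) (\<lambda>a. g (exp a))"
    by (subst integrable_density) auto
  also have "\<dots> \<longleftrightarrow> integrable (distr (density lborel (\<lambda>a. ennreal (exp a))) borel exp) g"
    by (subst integrable_distr_eq) auto
  also have "\<dots> \<longleftrightarrow> integrable (density lborel (\<lambda>x. ennreal (indicator {0<..} x))) g"
    by (simp only: distr_exp_lborel di)
  also have "\<dots> \<longleftrightarrow> set_integrable lborel {0<..} f"
    by (subst integrable_density) (auto simp: gi set_integrable_def)
  finally show "set_integrable lborel {0<..} f \<longleftrightarrow> integrable lborel (\<lambda>a. of_real (exp a) * f (exp a))"
    by (simp add: gg scaleR_conv_of_real)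
  have "(LINT a|lborel. exp a *\<^sub>R g (exp a)) = (LINT a|density lborel (\<lambda>a. ennreal (exp a)). g (exp a))"
    by (subst integral_density) auto
  also have "\<dots> = (LINT x|distr (density lborel (\<lambda>a. ennreal (exp a))) borel exp. g x)"
    by (subst integral_distr) auto
  also have "\<dots> = (LINT x|density lborel (\<lambda>x. ennreal (indicator {0<..} x)). g x)"
    by (simp only: distr_exp_lborel di)
  also have "\<dots> = (LINT x:{0<..}|lborel. f x)"
    by (subst integral_density) (auto simp: gi set_lebesgue_integral_def)
  finally show "(LINT x:{0<..}|lborel. f x) = (LINT a|lborel. of_real (exp a) * f (exp a))"
    by (simp add: gg scaleR_conv_of_real)
qed

text \<open>Euler's integral in the variable \<open>a = ln t\<close>. On the logarithmic scale a power becomes an exponential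
and rescaling the argument becomes a translation, which is why the whole development uses this form.\<close>

lemma Gamma_integral_exp_1:
  fixes s :: complex assumes s: "Re s > 0"
  shows "integrable lborel (\<lambda>a. exp (s * of_real a) * of_real (exp (- exp a)))"
    and "(LINT a|lborel. exp (s * of_real a) * of_real (exp (- exp a))) = Gamma s"
proof -
  let ?f = "\<lambda>t. complex_of_real t powr (s - 1) / of_real (exp t)"
  have m: "set_borel_measurable borel {0<..} ?f"
    unfolding set_borel_measurable_def
    by (intro borel_measurable_continuous_on_indicator continuous_intros) auto
  have ai: "?f absolutely_integrable_on {0<..}" by (rule absolutely_integrable_Gamma_integral'[OF s])
  have si: "set_integrable lborel {0<..} ?f"
    using ai m unfolding set_integrable_def set_borel_measurable_def
    using integrable_completion[of "\<lambda>x. indicator {0<..} x *\<^sub>R ?f x" lborel] by simp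
  have "?f (exp a) * of_real (exp a) = exp (s * of_real a) * of_real (exp (- exp a))" for a
    by (simp add: powr_def exp_diff algebra_simps exp_minus exp_of_real flip: exp_of_real)
       (simp add: exp_minus field_simps Ln_of_real flip: exp_add exp_of_real)
  then have e: "(\<lambda>a. of_real (exp a) * ?f (exp a)) = (\<lambda>a. exp (s * of_real a) * of_real (exp (- exp a)))"
    by (simp add: mult.commute)
  show "integrable lborel (\<lambda>a. exp (s * of_real a) * of_real (exp (- exp a)))"
    using si set_integrable_exp_substitution(1)[OF m] e by simp
  have "(LINT x:{0<..}|lborel. ?f x) = (LINT x:{0<..}|lebesgue. ?f x)"
    using m unfolding set_lebesgue_integral_def set_borel_measurable_def by (subst integral_completion) auto
  also have "\<dots> = integral {0<..} ?f"
    using set_lebesgue_integral_eq_integral(2)[OF ai] .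
  also have "\<dots> = Gamma s" using Gamma_integral_complex'[OF s] by (rule integral_unique)
  finally show "(LINT a|lborel. exp (s * of_real a) * of_real (exp (- exp a))) = Gamma s"
    using set_integrable_exp_substitution(2)[OF m] e by simp
qed

text \<open>A translation by \<open>ln p\<close> turns the case \<open>p = 1\<close> into the general one; the right-hand side is
\<open>\<Gamma>(s) p^{-s}\<close>.\<close>

lemma Gamma_integral_exp:
  fixes s :: complex assumes s: "Re s > 0" and p: "p > 0"
  shows "integrable lborel (\<lambda>a. exp (s * of_real a) * of_real (exp (- p * exp a)))"
    and "(LINT a|lborel. exp (s * of_real a) * of_real (exp (- p * exp a))) = Gamma s * exp (- s * of_real (ln p))"
proof -
  have e: "exp (s * of_real (ln p + 1 * a)) * of_real (exp (- exp (ln p + 1 * a))) =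
    exp (s * of_real (ln p)) * (exp (s * of_real a) * of_real (exp (- p * exp a)))" for a
    using p by (simp add: exp_add ring_distribs)
  have "integrable lborel (\<lambda>a. exp (s * of_real (ln p)) * (exp (s * of_real a) * of_real (exp (- p * exp a))))"
    using Gamma_integral_exp_1(1)[OF s]
    by (subst (asm) lborel_integrable_real_affine_iff[symmetric, of 1 _ "ln p"]) (simp, simp only: e)
  from integrable_mult_right[OF this, of "exp (- s * of_real (ln p))"]
  show "integrable lborel (\<lambda>a. exp (s * of_real a) * of_real (exp (- p * exp a)))"
    by (simp add: exp_minus mult.assoc[symmetric])
  have "Gamma s = exp (s * of_real (ln p)) * (LINT a|lborel. exp (s * of_real a) * of_real (exp (- p * exp a)))"
    using Gamma_integral_exp_1(2)[OF s]
    by (subst (asm) lborel_integral_real_affine[of 1 _ "ln p"]) (simp_all only: e, simp_all)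
  then show "(LINT a|lborel. exp (s * of_real a) * of_real (exp (- p * exp a))) = Gamma s * exp (- s * of_real (ln p))"
    by (simp add: exp_minus field_simps)
qed

lemma Gamma_integral_exp_real:
  fixes x p :: real assumes x: "x > 0" and p: "p > 0"
  shows "integrable lborel (\<lambda>a. exp (x * a) * exp (- p * exp a))"
    and "(LINT a|lborel. exp (x * a) * exp (- p * exp a)) = Gamma x * exp (- x * ln p)"
proof -
  have e: "exp (of_real x * of_real a) * of_real (exp (- p * exp a)) = complex_of_real (exp (x * a) * exp (- p * exp a))" for a
    by (simp flip: exp_of_real)
  have i: "integrable lborel (\<lambda>a. complex_of_real (exp (x * a) * exp (- p * exp a)))"
    using Gamma_integral_exp(1)[of "of_real x" p] x p unfolding e by simp
  then show "integrable lborel (\<lambda>a. exp (x * a) * exp (- p * exp a))"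
    using complex_of_real_integrable_eq by blast
  have "(LINT a|lborel. complex_of_real (exp (x * a) * exp (- p * exp a))) = complex_of_real (Gamma x * exp (- x * ln p))"
    using Gamma_integral_exp(2)[of "of_real x" p] x p unfolding e
    by (simp add: Gamma_complex_of_real flip: exp_of_real)
  then show "(LINT a|lborel. exp (x * a) * exp (- p * exp a)) = Gamma x * exp (- x * ln p)"
    by (simp only: integral_complex_of_real of_real_eq_iff)
qed

section \<open>Integrals depending on a parameter\<close>

lemma isCont_integral_dominated:
  fixes h :: "'b::metric_space \<Rightarrow> 'a \<Rightarrow> complex"
  assumes meas: "\<And>t. h t \<in> borel_measurable M"
    and cont: "\<And>x. isCont (\<lambda>t. h t x) t0"
    and r: "0 < r" and dom: "\<And>t x. dist t t0 < r \<Longrightarrow> norm (h t x) \<le> w x" and w: "integrable M w"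
  shows "isCont (\<lambda>t. \<integral>x. h t x \<partial>M) t0"
  unfolding continuous_at_sequentially o_def
proof (intro allI impI)
  fix u :: "nat \<Rightarrow> 'b" assume u: "u \<longlonglongrightarrow> t0"
  then obtain N where N: "\<And>n. N \<le> n \<Longrightarrow> dist (u n) t0 < r"
    using r unfolding lim_sequentially by blast
  have "(\<lambda>n. \<integral>x. h (u (n + N)) x \<partial>M) \<longlonglongrightarrow> (\<integral>x. h t0 x \<partial>M)"
  proof (rule integral_dominated_convergence[where w=w])
    show "AE x in M. (\<lambda>n. h (u (n + N)) x) \<longlonglongrightarrow> h t0 x"
      using cont LIMSEQ_ignore_initial_segment[OF u, of N]
      by (intro AE_I2) (auto simp: continuous_at_sequentially o_def)
  qed (use meas w dom N in auto)
  then show "(\<lambda>n. \<integral>x. h (u n) x \<partial>M) \<longlonglongrightarrow> (\<integral>x. h t0 x \<partial>M)"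
    by (rule LIMSEQ_offset)
qed

text \<open>Cauchy's inequality turns a local bound on the integrand into a local bound on its derivative, hence into
a Lipschitz bound on the difference quotients. Dominated convergence then applies along every
sequence.\<close>

lemma holomorphic_on_integral:
  fixes h :: "complex \<Rightarrow> 'a \<Rightarrow> complex"
  assumes hol: "\<And>x. (\<lambda>z. h z x) holomorphic_on U"
    and meas: "\<And>z. z \<in> U \<Longrightarrow> h z \<in> borel_measurable M"
    and dom: "\<And>z. z \<in> U \<Longrightarrow> \<exists>r>0. \<exists>w. ball z r \<subseteq> U \<and> integrable M w \<and> (\<forall>z'\<in>ball z r. \<forall>x. norm (h z' x) \<le> w x)"
  shows "(\<lambda>z. \<integral>x. h z x \<partial>M) holomorphic_on U"
proof (unfold holomorphic_on_def, rule ballI, rule field_differentiable_at_within)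
  fix z assume z: "z \<in> U"
  obtain r w where r: "r > 0" and sub: "ball z r \<subseteq> U" and w: "integrable M w"
    and bd0: "\<forall>z'\<in>ball z r. \<forall>x. norm (h z' x) \<le> w x" using dom[OF z] by (elim exE conjE) (rule that)
  have bd: "norm (h z' x) \<le> w x" if "z' \<in> ball z r" for z' x using bspec[OF bd0 that] by simp
  have int: "integrable M (h z')" if z': "z' \<in> ball z r" for z'
  proof (rule Bochner_Integration.integrable_bound[OF w])
    show "h z' \<in> borel_measurable M" using z' sub meas by blast
    have "norm (h z' x) \<le> norm (w x)" for x using bd[OF z', of x] by (simp add: abs_if)
    then show "AE x in M. norm (h z' x) \<le> norm (w x)" by simp
  qed
  have holx: "(\<lambda>z. h z x) holomorphic_on ball z r" for x by (rule holomorphic_on_subset[OF hol sub])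
  (* The circle of radius r/4 around a point of the half-size ball stays inside the full ball. *)
  have dbd: "norm (deriv (\<lambda>z. h z x) z') \<le> 4 / r * w x" if "z' \<in> ball z (r/2)" for z' x
  proof -
    have cb: "cball z' (r/4) \<subseteq> ball z r"
    proof
      fix y assume "y \<in> cball z' (r/4)"
      then have "dist z y < r/2 + r/4" using that dist_triangle[of z y z'] by auto
      then show "y \<in> ball z r" using r by simp
    qed
    have "norm ((deriv ^^ 1) (\<lambda>z. h z x) z') \<le> fact 1 * w x / (r/4) ^ 1"
    proof (rule Cauchy_inequality)
      show "(\<lambda>z. h z x) holomorphic_on ball z' (r/4)" by (rule holomorphic_on_subset[OF holx subset_trans[OF ball_subset_cball cb]])
      show "continuous_on (cball z' (r/4)) (\<lambda>z. h z x)"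
        by (rule continuous_on_subset[OF holomorphic_on_imp_continuous_on[OF holx] cb])
      show "norm (h y x) \<le> w x" if "norm (z' - y) = r/4" for y
      proof -
        have "y \<in> cball z' (r/4)" using that by (simp add: dist_norm)
        then show ?thesis using bd subsetD[OF cb] by simp
      qed
    qed (use r in auto)
    then show ?thesis by (simp add: field_simps)
  qed
  have lip: "norm (h z' x - h z x) \<le> 4 / r * w x * norm (z' - z)" if "z' \<in> ball z (r/2)" for z' x
  proof (rule field_differentiable_bound[where S="ball z (r/2)"])
    show "((\<lambda>z. h z x) has_field_derivative deriv (\<lambda>z. h z x) y) (at y within ball z (r/2))" if "y \<in> ball z (r/2)" for y
      by (rule has_field_derivative_at_within, rule holomorphic_derivI[OF holx open_ball]) (use that r in simp)
    show "norm (deriv (\<lambda>z. h z x) y) \<le> 4 / r * w x" if "y \<in> ball z (r/2)" for y by (rule dbd[OF that])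
  qed (use that r in simp_all)
  show "(\<lambda>z. \<integral>x. h z x \<partial>M) field_differentiable at z"
    unfolding field_differentiable_def has_field_derivative_iff
  proof (rule exI, unfold tendsto_at_iff_sequentially, intro allI impI)
    fix u :: "nat \<Rightarrow> complex" assume u1: "\<forall>i. u i \<in> UNIV - {z}" and u2: "u \<longlonglongrightarrow> z"
    obtain N where N: "\<And>n. N \<le> n \<Longrightarrow> dist (u n) z < r/2"
      using u2[unfolded lim_sequentially, rule_format, of "r/2"] r by auto
    define v where "v = (\<lambda>n. u (n + N))"
    have v1: "v n \<noteq> z" "v n \<in> ball z (r/2)" for n using u1 N[of "n + N"] by (auto simp: v_def dist_commute)
    have v3: "v n \<in> ball z r" for n using v1[of n] r by auto
    have v2: "v \<longlonglongrightarrow> z" unfolding v_def by (rule LIMSEQ_ignore_initial_segment[OF u2])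
    have zz: "z \<in> ball z r" using r by simp
    have ptw: "(\<lambda>n. (h (v n) x - h z x) / (v n - z)) \<longlonglongrightarrow> deriv (\<lambda>z. h z x) z" for x
    proof -
      have "((\<lambda>z. h z x) has_field_derivative deriv (\<lambda>z. h z x) z) (at z)"
        by (rule holomorphic_derivI[OF holx open_ball zz])
      then have "((\<lambda>y. (h y x - h z x) / (y - z)) \<circ> v) \<longlonglongrightarrow> deriv (\<lambda>z. h z x) z"
        unfolding has_field_derivative_iff tendsto_at_iff_sequentially using v1(1) v2 by blast
      then show ?thesis by (simp only: o_def)
    qed
    have mq: "(\<lambda>x. (h (v n) x - h z x) / (v n - z)) \<in> borel_measurable M" for n
    proof -
      have "v n \<in> U" "z \<in> U" using v3[of n] sub z by auto
      from meas[OF this(1)] meas[OF this(2)] show ?thesis by (intro borel_measurable_divide borel_measurable_diff) auto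
    qed
    have "(\<lambda>n. \<integral>x. (h (v n) x - h z x) / (v n - z) \<partial>M) \<longlonglongrightarrow> (\<integral>x. deriv (\<lambda>z. h z x) z \<partial>M)"
    proof (rule integral_dominated_convergence[where w="\<lambda>x. 4 / r * w x"])
      show "(\<lambda>x. deriv (\<lambda>z. h z x) z) \<in> borel_measurable M"
        by (rule borel_measurable_LIMSEQ_metric[OF mq ptw])
      show "AE x in M. norm ((h (v n) x - h z x) / (v n - z)) \<le> 4 / r * w x" for n
        using lip[OF v1(2)[of n]] v1(1)[of n] by (intro AE_I2) (simp add: norm_divide divide_le_eq)
      show "(\<lambda>x. (h (v n) x - h z x) / (v n - z)) \<in> borel_measurable M" for n by (rule mq)
      show "integrable M (\<lambda>x. 4 / r * w x)" using w by simp
      show "AE x in M. (\<lambda>n. (h (v n) x - h z x) / (v n - z)) \<longlonglongrightarrow> deriv (\<lambda>z. h z x) z"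
        by (rule AE_I2) (rule ptw)
    qed
    moreover have "(\<integral>x. (h (v n) x - h z x) / (v n - z) \<partial>M) = ((\<integral>x. h (v n) x \<partial>M) - (\<integral>x. h z x \<partial>M)) / (v n - z)" for n
      using int[OF v3[of n]] int[OF zz] by simp
    ultimately have "(\<lambda>n. ((\<integral>x. h (v n) x \<partial>M) - (\<integral>x. h z x \<partial>M)) / (v n - z)) \<longlonglongrightarrow> (\<integral>x. deriv (\<lambda>z. h z x) z \<partial>M)"
      by (simp only:)
    then have "(\<lambda>n. ((\<lambda>y. ((\<integral>x. h y x \<partial>M) - (\<integral>x. h z x \<partial>M)) / (y - z)) \<circ> u) (n + N)) \<longlonglongrightarrow> (\<integral>x. deriv (\<lambda>z. h z x) z \<partial>M)"
      by (simp add: v_def o_def)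
    then show "((\<lambda>y. ((\<integral>x. h y x \<partial>M) - (\<integral>x. h z x \<partial>M)) / (y - z)) \<circ> u) \<longlonglongrightarrow> (\<integral>x. deriv (\<lambda>z. h z x) z \<partial>M)"
      by (rule LIMSEQ_offset)
  qed
qed

section \<open>Uniqueness of Laplace transforms\<close>

text \<open>Lerch's argument. With \<open>m(a) = exp(-e^{ka})\<close>, vanishing at \<open>p0, p0 + 1, p0 + 2, ...\<close> says that all moments
\<open>\<integral> m^n h\<close> vanish, where \<open>h\<close> contains the factor for \<open>p0\<close>. By the Weierstrass theorem
\<open>\<integral> \<psi>(m) h = 0\<close> for every continuous \<open>\<psi>\<close> on \<open>[0, 1]\<close>. As \<open>m\<close> is strictly monotone, a hat function
\<open>\<psi>\<close> concentrated at \<open>m(a0)\<close> isolates the value of \<open>h\<close> at \<open>a0\<close>.\<close>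

lemma laplace_unique:
  fixes H :: "real \<Rightarrow> complex"
  assumes cont: "\<And>a. isCont H a" and k: "k > 0"
    and int: "integrable lborel (\<lambda>a. of_real (exp (- p0 * exp (k * a))) * H a)"
    and zero: "\<And>n::nat. (LINT a|lborel. of_real (exp (- (p0 + real n) * exp (k * a))) * H a) = 0"
  shows "H a0 = 0"
proof -
  define h where "h = (\<lambda>a. of_real (exp (- p0 * exp (k * a))) * H a)"
  define m where "m = (\<lambda>a::real. exp (- exp (k * a)))"
  have h: "integrable lborel h" using int by (simp add: h_def)
  have conth: "isCont h a" for a unfolding h_def by (intro continuous_intros cont)
  have m01: "m a \<in> {0..1}" for a by (simp add: m_def)
  have [measurable]: "m \<in> borel_measurable borel" unfolding m_def by measurable
  have [measurable]: "h \<in> borel_measurable borel" using h by auto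
  have bint: "integrable lborel (\<lambda>a. of_real (\<psi> (m a)) * h a)"
    if "\<And>x. x \<in> {0..1} \<Longrightarrow> \<bar>\<psi> x\<bar> \<le> C" "continuous_on UNIV \<psi>" for \<psi> :: "real \<Rightarrow> real" and C
  proof (rule Bochner_Integration.integrable_bound[of _ "\<lambda>a. C * norm (h a)"])
    have [measurable]: "\<psi> \<in> borel_measurable borel" using that(2) by (rule borel_measurable_continuous_onI)
    show "(\<lambda>a. of_real (\<psi> (m a)) * h a) \<in> borel_measurable lborel" by measurable
    have "norm (of_real (\<psi> (m a)) * h a) \<le> norm (C * norm (h a))" for a
    proof -
      have "\<bar>\<psi> (m a)\<bar> \<le> \<bar>C\<bar>" using that(1)[OF m01, of a] by linarith
      then show ?thesis by (simp add: norm_mult abs_mult mult_right_mono)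
    qed
    then show "AE a in lborel. norm (of_real (\<psi> (m a)) * h a) \<le> norm (C * norm (h a))" by simp
  qed (use h in auto)
  have mono: "(LINT a|lborel. of_real (m a ^ n) * h a) = 0" for n
  proof -
    have "of_real (m a ^ n) * h a = of_real (exp (- (p0 + real n) * exp (k * a))) * H a" for a
    proof -
      have "m a ^ n * exp (- p0 * exp (k * a)) = exp (- (p0 + real n) * exp (k * a))"
        by (simp add: m_def exp_of_nat_mult[symmetric] exp_add[symmetric] algebra_simps)
      then show ?thesis unfolding h_def by (simp only: of_real_mult[symmetric] mult.assoc[symmetric])
    qed
    then show ?thesis using zero by simp
  qed
  have monoi: "integrable lborel (\<lambda>a. of_real (m a ^ n) * h a)" for n
    by (rule bint[of "\<lambda>x. x ^ n" 1]) (auto simp: power_le_one intro!: continuous_intros)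
  have poly: "(LINT a|lborel. of_real (g (m a)) * h a) = 0" if pg: "real_polynomial_function g" for g
  proof -
    obtain c N where g: "g = (\<lambda>x. \<Sum>i\<le>N. c i * x ^ i)"
      using pg unfolding real_polynomial_function_iff_sum by blast
    have "(LINT a|lborel. of_real (g (m a)) * h a) = (LINT a|lborel. (\<Sum>i\<le>N. of_real (c i) * (of_real (m a ^ i) * h a)))"
      by (simp add: g sum_distrib_right mult.assoc)
    also have "\<dots> = (\<Sum>i\<le>N. of_real (c i) * (LINT a|lborel. of_real (m a ^ i) * h a))"
      using monoi by (subst Bochner_Integration.integral_sum) (auto intro!: integrable_mult_right)
    also have "\<dots> = 0" using mono by simp
    finally show ?thesis .
  qed
  have contz: "(LINT a|lborel. of_real (\<psi> (m a)) * h a) = 0" if c: "continuous_on UNIV \<psi>" for \<psi> :: "real \<Rightarrow> real"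
  proof -
    have c1: "continuous_on {0..1} \<psi>" by (rule continuous_on_subset[OF c]) simp
    obtain B where B: "\<And>x. x \<in> {0..1} \<Longrightarrow> \<bar>\<psi> x\<bar> \<le> B"
      using compact_imp_bounded[OF compact_continuous_image[OF c1 compact_Icc], unfolded bounded_iff]
      by (auto simp only: ball_simps real_norm_def)
    note psi = bint[OF B c]
    have "norm (LINT a|lborel. of_real (\<psi> (m a)) * h a) \<le> e" if e: "e > 0" for e
    proof -
      define L where "L = (LINT a|lborel. norm (h a))"
      have L: "L \<ge> 0" by (simp add: L_def)
      obtain g where g: "real_polynomial_function g" "\<And>x. x \<in> {0..1} \<Longrightarrow> \<bar>\<psi> x - g x\<bar> < e / (L + 1)"
      proof (rule Stone_Weierstrass_real_polynomial_function[OF compact_Icc c1, of "e / (L+1)"])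
        show "0 < e / (L+1)" using e L by simp
      qed blast
      have cg: "continuous_on UNIV g" using g(1)
        by (intro continuous_on_polymonial_function) (simp add: real_polynomial_function_eq)
      have gB: "\<bar>g x\<bar> \<le> B + e / (L + 1)" if "x \<in> {0..1}" for x using g(2)[OF that] B[OF that] by linarith
      note gi = bint[OF gB cg]
      have "(LINT a|lborel. of_real (\<psi> (m a)) * h a) = (LINT a|lborel. of_real (\<psi> (m a)) * h a) - (LINT a|lborel. of_real (g (m a)) * h a)"
        using poly[OF g(1)] by simp
      also have "\<dots> = (LINT a|lborel. of_real (\<psi> (m a) - g (m a)) * h a)"
        using psi gi by (simp add: ring_distribs of_real_diff left_diff_distrib)
      also have "norm \<dots> \<le> (LINT a|lborel. norm (of_real (\<psi> (m a) - g (m a)) * h a))" by (rule integral_norm_bound)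
      also have "\<dots> \<le> (LINT a|lborel. e / (L+1) * norm (h a))"
      proof (rule integral_mono)
        have "integrable lborel (\<lambda>a. of_real (\<psi> (m a) - g (m a)) * h a)"
          using Bochner_Integration.integrable_diff[OF psi gi] by (simp add: ring_distribs of_real_diff left_diff_distrib)
        then show "integrable lborel (\<lambda>a. norm (of_real (\<psi> (m a) - g (m a)) * h a))" by (rule integrable_norm)
        show "norm (of_real (\<psi> (m a) - g (m a)) * h a) \<le> e / (L + 1) * norm (h a)" for a
          using g(2)[OF m01, of a] by (simp only: norm_mult norm_of_real) (intro mult_right_mono, auto)
      qed (use h in auto)
      also have "\<dots> = e / (L+1) * L" by (simp add: L_def)
      also have "\<dots> \<le> e" using L e by (simp add: field_simps)
      finally show ?thesis .
    qed
    then have "norm (LINT a|lborel. of_real (\<psi> (m a)) * h a) \<le> 0"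
      by (rule field_le_epsilon) simp
    then show ?thesis by simp
  qed
  have "h a0 = 0"
  proof (rule ccontr)
    assume nz: "h a0 \<noteq> 0"
    define \<epsilon> where "\<epsilon> = norm (h a0)"
    have e: "\<epsilon> > 0" using nz by (simp add: \<epsilon>_def)
    obtain d where d: "d > 0" "\<And>a. \<bar>a - a0\<bar> < d \<Longrightarrow> norm (h a - h a0) < \<epsilon> / 2"
      using conth[of a0, unfolded continuous_at_eps_delta dist_norm real_norm_def, rule_format, of "\<epsilon> / 2"] e by auto
    have mdec: "m x < m y" if "y < x" for x y using that k by (simp add: m_def)
    define \<delta> where "\<delta> = min (m (a0 - d) - m a0) (m a0 - m (a0 + d))"
    have del: "\<delta> > 0" using mdec d by (simp add: \<delta>_def)
    have near: "\<bar>a - a0\<bar> < d" if "\<bar>m a - m a0\<bar> < \<delta>" for a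
    proof (rule ccontr)
      assume "\<not> \<bar>a - a0\<bar> < d"
      then have "a \<le> a0 - d \<or> a0 + d \<le> a" by linarith
      then have "m (a0 - d) \<le> m a \<or> m a \<le> m (a0 + d)"
        using mdec[of a "a0 - d"] mdec[of "a0 + d" a] by (auto simp: less_eq_real_def)
      then show False using that by (auto simp: \<delta>_def)
    qed
    (* The hat is supported where m is within \<delta> of its value at a0, hence within d of a0, where h varies by
       less than half of its norm at a0. *)
    define \<psi> where "\<psi> = (\<lambda>v::real. max 0 (\<delta> - \<bar>v - m a0\<bar>))"
    have cpsi: "continuous_on UNIV \<psi>" unfolding \<psi>_def by (intro continuous_intros)
    have psi0: "\<psi> v \<ge> 0" for v by (simp add: \<psi>_def)
    have supp: "\<bar>a - a0\<bar> < d" if "\<psi> (m a) \<noteq> 0" for a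
      using that near[of a] by (auto simp: \<psi>_def max_def split: if_splits)
    have contm: "isCont m a" for a unfolding m_def by (intro continuous_intros)
    obtain d2 where d2: "d2 > 0" "\<And>a. \<bar>a - a0\<bar> < d2 \<Longrightarrow> \<bar>m a - m a0\<bar> < \<delta> / 2"
      using contm[of a0, unfolded continuous_at_eps_delta dist_norm real_norm_def, rule_format, of "\<delta> / 2"] del by auto
    have pint: "integrable lborel (\<lambda>a. \<psi> (m a))"
    proof (rule Bochner_Integration.integrable_bound[of _ "\<lambda>a. \<delta> * indicator {a0 - d..a0 + d} a"])
      have [measurable]: "\<psi> \<in> borel_measurable borel" using cpsi by (rule borel_measurable_continuous_onI)
      show "(\<lambda>a. \<psi> (m a)) \<in> borel_measurable lborel" by measurable
      show "AE a in lborel. norm (\<psi> (m a)) \<le> norm (\<delta> * indicator {a0 - d..a0 + d} a)"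
      proof (intro AE_I2)
        fix a show "norm (\<psi> (m a)) \<le> norm (\<delta> * indicator {a0 - d..a0 + d} a)"
        proof (cases "\<psi> (m a) = 0")
          case False
          from supp[OF this] have "a \<in> {a0 - d..a0 + d}" by auto
          then show ?thesis using del by (simp add: \<psi>_def)
        qed simp
      qed
      show "integrable lborel (\<lambda>a. \<delta> * indicator {a0 - d..a0 + d} a)"
        by (intro integrable_mult_right integrable_real_indicator) (auto simp: emeasure_lborel_Icc_eq)
    qed
    have "(LINT a|lborel. \<psi> (m a)) > 0"
    proof -
      have "0 < (LINT a|lborel. \<delta> / 2 * indicator {a0..<a0 + d2} a)" using del d2 by simp
      also have "\<dots> \<le> (LINT a|lborel. \<psi> (m a))"
      proof (rule integral_mono)
        show "\<delta> / 2 * indicator {a0..<a0 + d2} a \<le> \<psi> (m a)" for a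
        proof (cases "a \<in> {a0..<a0 + d2}")
          case True
          then have "\<bar>m a - m a0\<bar> < \<delta> / 2" by (intro d2(2)) auto
          then have "\<delta> / 2 \<le> \<delta> - \<bar>m a - m a0\<bar>" by simp
          also have "\<dots> \<le> \<psi> (m a)" by (simp add: \<psi>_def)
          finally show ?thesis using True by simp
        qed (simp add: psi0)
        show "integrable lborel (\<lambda>a. \<delta> / 2 * indicator {a0..<a0 + d2} a)"
          by (intro integrable_mult_right integrable_real_indicator) (use d2(1) in auto)
      qed (rule pint)
      finally show ?thesis .
    qed
    have B: "\<bar>\<psi> v\<bar> \<le> \<delta>" for v using del by (simp add: \<psi>_def)
    have i1: "integrable lborel (\<lambda>a. of_real (\<psi> (m a)) * h a)" by (rule bint[OF B cpsi])
    have i2: "integrable lborel (\<lambda>a. of_real (\<psi> (m a)) * h a0)" using pint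
      by (intro integrable_mult_left) simp
    have "of_real (LINT a|lborel. \<psi> (m a)) * h a0 = (LINT a|lborel. of_real (\<psi> (m a)) * h a0) - (LINT a|lborel. of_real (\<psi> (m a)) * h a)"
      using contz[OF cpsi] by (simp add: integral_complex_of_real)
    also have "\<dots> = (LINT a|lborel. of_real (\<psi> (m a)) * (h a0 - h a))"
      using i1 i2 by (simp add: right_diff_distrib)
    finally have "norm (of_real (LINT a|lborel. \<psi> (m a)) * h a0) \<le> (LINT a|lborel. norm (of_real (\<psi> (m a)) * (h a0 - h a)))"
      by (metis integral_norm_bound)
    also have "\<dots> \<le> (LINT a|lborel. \<psi> (m a) * (\<epsilon> / 2))"
    proof (rule integral_mono)
      have "integrable lborel (\<lambda>a. of_real (\<psi> (m a)) * (h a0 - h a))"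
        using Bochner_Integration.integrable_diff[OF i2 i1] by (simp add: right_diff_distrib)
      then show "integrable lborel (\<lambda>a. norm (of_real (\<psi> (m a)) * (h a0 - h a)))" by (rule integrable_norm)
      show "norm (of_real (\<psi> (m a)) * (h a0 - h a)) \<le> \<psi> (m a) * (\<epsilon> / 2)" for a
      proof (cases "\<psi> (m a) = 0")
        case False
        from d(2)[OF supp[OF this]] have "norm (h a0 - h a) \<le> \<epsilon> / 2" by (simp add: norm_minus_commute)
        from mult_left_mono[OF this psi0[of "m a"]] show ?thesis using psi0[of "m a"] by (simp only: norm_mult norm_of_real abs_of_nonneg)
      qed simp
    qed (use pint in auto)
    also have "\<dots> = (LINT a|lborel. \<psi> (m a)) * \<epsilon> / 2" by simp
    finally show False using \<open>(LINT a|lborel. \<psi> (m a)) > 0\<close> e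
      by (simp add: norm_mult \<epsilon>_def[symmetric])
  qed
  then show ?thesis by (simp add: h_def)
qed

section \<open>Fourier inversion\<close>

lemma integral_exp_gaussian:
  fixes u :: real
  shows "integrable lborel (\<lambda>v. exp (\<i> * of_real (u * v)) * of_real (std_normal_density v))"
    and "(LINT v|lborel. exp (\<i> * of_real (u * v)) * of_real (std_normal_density v)) = of_real (exp (- u\<^sup>2 / 2))"
proof -
  have n: "norm (exp (\<i> * of_real (u * v)) * of_real (std_normal_density v)) = std_normal_density v" for v
    by (simp add: norm_mult)
  have m: "(\<lambda>v. exp (\<i> * of_real (u * v)) * of_real (std_normal_density v)) \<in> borel_measurable lborel"
    by measurable
  have "integrable lborel (\<lambda>v. std_normal_density v)"
    by (rule integrable_normal_density) simp
  then show "integrable lborel (\<lambda>v. exp (\<i> * of_real (u * v)) * of_real (std_normal_density v))"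
    by (rule Bochner_Integration.integrable_bound[OF _ m]) (unfold n, simp)
  have "of_real (exp (- u\<^sup>2 / 2)) = char std_normal_distribution u"
    by (simp add: char_std_normal_distribution)
  also have "\<dots> = (LINT v|lborel. std_normal_density v *\<^sub>R iexp (u * v))"
    unfolding char_def by (subst integral_density) auto
  finally show "(LINT v|lborel. exp (\<i> * of_real (u * v)) * of_real (std_normal_density v)) = of_real (exp (- u\<^sup>2 / 2))"
    by (simp add: scaleR_conv_of_real mult.commute)
qed

lemma integral_exp_gaussian_scaled:
  fixes u e :: real assumes e: "e > 0"
  shows "(LINT t|lborel. exp (\<i> * of_real (u * t)) * of_real (exp (- (e * t)\<^sup>2 / 2)))
      = of_real (2 * pi / e * std_normal_density (u / e))"
proof -
  have s: "std_normal_density v = exp (- v\<^sup>2 / 2) / sqrt (2 * pi)" for v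
    by (simp add: normal_density_def)
  have a: "exp (\<i> * of_real (u / e * (0 + e * t))) * of_real (std_normal_density (0 + e * t)) =
     of_real (1 / sqrt (2 * pi)) * (exp (\<i> * of_real (u * t)) * of_real (exp (- (e * t)\<^sup>2 / 2)))" for t
    using e by (simp add: s)
  have "of_real (exp (- (u / e)\<^sup>2 / 2)) = of_real e * (LINT t|lborel. of_real (1 / sqrt (2 * pi)) * (exp (\<i> * of_real (u * t)) * of_real (exp (- (e * t)\<^sup>2 / 2))))"
    using integral_exp_gaussian(2)[of "u / e"] e
    by (subst (asm) lborel_integral_real_affine[of e _ 0]) (simp, simp only: a scaleR_conv_of_real, simp)
  also have "\<dots> = of_real (e / sqrt (2 * pi)) * (LINT t|lborel. exp (\<i> * of_real (u * t)) * of_real (exp (- (e * t)\<^sup>2 / 2)))"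
    unfolding integral_mult_right_zero by simp
  finally have eq: "of_real (exp (- (u / e)\<^sup>2 / 2)) = of_real (e / sqrt (2 * pi)) * (LINT t|lborel. exp (\<i> * of_real (u * t)) * of_real (exp (- (e * t)\<^sup>2 / 2)))" .
  have "(LINT t|lborel. exp (\<i> * of_real (u * t)) * of_real (exp (- (e * t)\<^sup>2 / 2))) =
      complex_of_real (sqrt (2 * pi) / e * exp (- (u / e)\<^sup>2 / 2))"
    using e by (simp only: of_real_mult eq) (simp add: field_simps)
  also have "sqrt (2 * pi) / e * exp (- (u / e)\<^sup>2 / 2) = 2 * pi / e * std_normal_density (u / e)"
    using e by (simp add: s field_simps)
  finally show ?thesis .
qed

text \<open>Gaussian regularisation: inserting \<open>exp(-(t/(n+1))^2/2)\<close> makes the double integral absolutely convergent.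
After exchanging the integrals, the inner one is a Gaussian of width \<open>1/(n+1)\<close> centred at \<open>b\<close>, and the regularised
inversion integral is \<open>2\<pi>\<close> times an average of \<open>g\<close> near \<open>b\<close>. Continuity at \<open>b\<close> and boundedness give the
limit.\<close>

lemma fourier_inversion:
  fixes g F :: "real \<Rightarrow> complex"
  assumes g: "integrable lborel g" and bd: "\<And>x. norm (g x) \<le> B" and cont: "isCont g b"
    and F: "\<And>t. F t = (LINT x|lborel. exp (\<i> * of_real (t * x)) * g x)" and Fi: "integrable lborel F"
  shows "g b = 1 / (2 * of_real pi) * (LINT t|lborel. F t * exp (- \<i> * of_real (t * b)))"
proof -
  define I where "I = (\<lambda>n::nat. LINT t|lborel. F t * exp (- \<i> * of_real (t * b)) * of_real (exp (- (t / real (Suc n))\<^sup>2 / 2)))"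
  have [measurable]: "g \<in> borel_measurable borel" "F \<in> borel_measurable borel" using g Fi by auto
  have lim1: "I \<longlonglongrightarrow> (LINT t|lborel. F t * exp (- \<i> * of_real (t * b)))"
    unfolding I_def
  proof (rule integral_dominated_convergence[where w="\<lambda>t. norm (F t)"])
    show "AE t in lborel. (\<lambda>n. F t * exp (- \<i> * of_real (t * b)) * of_real (exp (- (t / real (Suc n))\<^sup>2 / 2)))
       \<longlonglongrightarrow> F t * exp (- \<i> * of_real (t * b))"
    proof (rule AE_I2)
      fix t
      have "(\<lambda>n. t * (1 / real (Suc n))) \<longlonglongrightarrow> t * 0"
        by (intro tendsto_mult tendsto_const LIMSEQ_Suc[OF lim_1_over_n])
      then have "(\<lambda>n. F t * exp (- \<i> * of_real (t * b)) * of_real (exp (- (t / real (Suc n))\<^sup>2 / 2)))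
       \<longlonglongrightarrow> F t * exp (- \<i> * of_real (t * b)) * of_real (exp (- 0\<^sup>2 / 2))"
        by (intro tendsto_intros) (simp_all)
      then show "(\<lambda>n. F t * exp (- \<i> * of_real (t * b)) * of_real (exp (- (t / real (Suc n))\<^sup>2 / 2)))
       \<longlonglongrightarrow> F t * exp (- \<i> * of_real (t * b))" by simp
    qed
    show "AE t in lborel. norm (F t * exp (- \<i> * of_real (t * b)) * of_real (exp (- (t / real (Suc n))\<^sup>2 / 2))) \<le> norm (F t)" for n
      by (rule AE_I2) (simp add: norm_mult mult_left_le)
  qed (use Fi in simp_all)
  have In: "I n = 2 * of_real pi * (LINT v|lborel. g (b + v / real (Suc n)) * of_real (std_normal_density v))" for n
  proof -
    define e where "e = 1 / real (Suc n)"
    have e: "e > 0" by (simp add: e_def)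
    define w where "w = (\<lambda>t x. exp (\<i> * of_real (t * (x - b))) * of_real (exp (- (e * t)\<^sup>2 / 2)) * g x)"
    have [measurable]: "(\<lambda>(t,x). w t x) \<in> borel_measurable (lborel \<Otimes>\<^sub>M lborel)"
      unfolding w_def by measurable
    have gs: "integrable lborel (\<lambda>t. exp (- (e * t)\<^sup>2 / 2))"
    proof -
      have "integrable lborel (\<lambda>v. sqrt (2 * pi) * std_normal_density v)"
        by (intro integrable_mult_right integrable_normal_density) simp
      then have "integrable lborel (\<lambda>v. sqrt (2 * pi) * std_normal_density (0 + e * v))"
        by (subst lborel_integrable_real_affine_iff) (use e in auto)
      then show ?thesis by (simp add: normal_density_def)
    qed
    have nw: "norm (w t x) = exp (- (e * t)\<^sup>2 / 2) * norm (g x)" for t x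
      by (simp add: w_def norm_mult)
    have wi: "integrable (lborel \<Otimes>\<^sub>M lborel) (\<lambda>(t,x). w t x)"
    proof (rule lborel_pair.Fubini_integrable)
      show "integrable lborel (\<lambda>t. LINT x|lborel. norm (case (t, x) of (t, x) \<Rightarrow> w t x))"
        using gs by (simp add: nw)
      have "integrable lborel (w t)" for t
        by (rule Bochner_Integration.integrable_bound[of _ "\<lambda>x. exp (- (e * t)\<^sup>2 / 2) * norm (g x)"])
           (use g in \<open>auto simp: nw\<close>)
      then show "AE t in lborel. integrable lborel (\<lambda>x. case (t, x) of (t, x) \<Rightarrow> w t x)" by simp
    qed simp
    have "I n = (LINT t|lborel. LINT x|lborel. w t x)"
      unfolding I_def
    proof (rule Bochner_Integration.integral_cong[OF refl])
      fix t
      have "w t x = exp (\<i> * of_real (t * x)) * g x * (exp (- \<i> * of_real (t * b)) * of_real (exp (- (t / real (Suc n))\<^sup>2 / 2)))" for x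
        by (simp add: w_def e_def ring_distribs exp_diff exp_minus field_simps)
      then have "(LINT x|lborel. w t x) = F t * (exp (- \<i> * of_real (t * b)) * of_real (exp (- (t / real (Suc n))\<^sup>2 / 2)))"
        by (simp only: integral_mult_left_zero F)
      then show "F t * exp (- \<i> * of_real (t * b)) * of_real (exp (- (t / real (Suc n))\<^sup>2 / 2)) = (LINT x|lborel. w t x)"
        by (simp only: mult.assoc)
    qed
    also have "\<dots> = (LINT x|lborel. LINT t|lborel. w t x)"
      by (rule lborel_pair.Fubini_integral[OF wi, symmetric])
    also have "\<dots> = (LINT x|lborel. of_real (2 * pi / e * std_normal_density ((x - b) / e)) * g x)"
    proof (rule Bochner_Integration.integral_cong[OF refl])
      fix x
      show "(LINT t|lborel. w t x) = of_real (2 * pi / e * std_normal_density ((x - b) / e)) * g x"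
        unfolding w_def integral_mult_left_zero
        using integral_exp_gaussian_scaled[OF e, of "x - b"] by (simp only: mult.commute[of _ "x - b"])
    qed
    also have "\<dots> = e *\<^sub>R (LINT v|lborel. of_real (2 * pi / e * std_normal_density (((b + e * v) - b) / e)) * g (b + e * v))"
      using e by (subst lborel_integral_real_affine[of e _ b]) auto
    also have "\<dots> = e *\<^sub>R (LINT v|lborel. of_real (2 * pi / e) * (g (b + v / real (Suc n)) * of_real (std_normal_density v)))"
      using e by (intro arg_cong[where f="(*\<^sub>R) e"] Bochner_Integration.integral_cong refl) (simp add: e_def)
    also have "\<dots> = 2 * of_real pi * (LINT v|lborel. g (b + v / real (Suc n)) * of_real (std_normal_density v))"
      unfolding integral_mult_right_zero using e by (simp add: scaleR_conv_of_real)
    finally show ?thesis .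
  qed
  have lim2: "(\<lambda>n. LINT v|lborel. g (b + v / real (Suc n)) * of_real (std_normal_density v)) \<longlonglongrightarrow> (LINT v|lborel. g b * of_real (std_normal_density v))"
  proof (rule integral_dominated_convergence[where w="\<lambda>v. B * std_normal_density v"])
    show "AE v in lborel. (\<lambda>n. g (b + v / real (Suc n)) * of_real (std_normal_density v)) \<longlonglongrightarrow> g b * of_real (std_normal_density v)"
    proof (rule AE_I2)
      fix v
      have "(\<lambda>n. b + v * (1 / real (Suc n))) \<longlonglongrightarrow> b + v * 0"
        by (intro tendsto_add tendsto_mult tendsto_const LIMSEQ_Suc[OF lim_1_over_n])
      then have "(\<lambda>n. b + v / real (Suc n)) \<longlonglongrightarrow> b" by simp
      from isCont_tendsto_compose[OF cont this]
      show "(\<lambda>n. g (b + v / real (Suc n)) * of_real (std_normal_density v)) \<longlonglongrightarrow> g b * of_real (std_normal_density v)"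
        by (intro tendsto_mult tendsto_const)
    qed
    show "AE v in lborel. norm (g (b + v / real (Suc n)) * of_real (std_normal_density v)) \<le> B * std_normal_density v" for n
      by (rule AE_I2) (simp add: norm_mult mult_right_mono bd)
    show "integrable lborel (\<lambda>v. B * std_normal_density v)"
      by (intro integrable_mult_right integrable_normal_density) simp
  qed simp_all
  have "(LINT v|lborel. g b * of_real (std_normal_density v)) = g b"
    using integral_std_normal_moment_even[of 0] by (simp add: integral_complex_of_real)
  with lim2 have "(\<lambda>n. 2 * of_real pi * (LINT v|lborel. g (b + v / real (Suc n)) * of_real (std_normal_density v))) \<longlonglongrightarrow> 2 * of_real pi * g b"
    by (intro tendsto_mult tendsto_const) simp
  with lim1 have "(LINT t|lborel. F t * exp (- \<i> * of_real (t * b))) = 2 * of_real pi * g b"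
    unfolding In by (rule LIMSEQ_unique)
  then show ?thesis by simp
qed

section \<open>The expansion of an exponential in powers of the hyperbolic cosine\<close>

text \<open>These are the coefficients of \<open>2F1(s/2, (s+1)/2; 1+s; 4v)\<close>, that is, of \<open>C(v)^s\<close> for the generating function
\<open>C\<close> of the Catalan numbers. With \<open>v = 1/(2 cosh t)^2\<close> one has \<open>C(v) = 2 cosh t e^{-t}\<close>.\<close>

definition catalan_coeff :: "complex \<Rightarrow> nat \<Rightarrow> complex" where
  "catalan_coeff s n = pochhammer (s / 2) n * pochhammer ((s + 1) / 2) n / (pochhammer (1 + s) n * fact n) * 4 ^ n"

lemma one_plus_of_nat_neq_0: "Re s \<ge> 0 \<Longrightarrow> 1 + s + of_nat n \<noteq> 0"
  by (auto simp: complex_eq_iff)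

lemma pochhammer_one_plus_neq_0: "Re s \<ge> 0 \<Longrightarrow> pochhammer (1 + s) n \<noteq> 0"
  using one_plus_of_nat_neq_0 by (auto simp: pochhammer_eq_0_iff eq_neg_iff_add_eq_0)

lemma catalan_coeff_0 [simp]: "catalan_coeff s 0 = 1" by (simp add: catalan_coeff_def)

lemma catalan_coeff_Suc:
  assumes "Re s \<ge> 0"
  shows "of_nat (Suc n) * (s + of_nat (Suc n)) * catalan_coeff s (Suc n) = (s + 2 * of_nat n) * (s + 2 * of_nat n + 1) * catalan_coeff s n"
proof -
  define P where "P = pochhammer (s / 2) n * pochhammer ((s + 1) / 2) n / (pochhammer (1 + s) n * fact n) * 4 ^ n"
  have nz: "1 + s + of_nat n \<noteq> 0" using one_plus_of_nat_neq_0[OF assms] .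
  have "catalan_coeff s (Suc n) = P * ((s / 2 + of_nat n) * ((s + 1) / 2 + of_nat n) * 4) / ((1 + s + of_nat n) * of_nat (Suc n))"
    unfolding catalan_coeff_def P_def pochhammer_Suc fact_Suc by (simp add: mult_ac del: of_nat_Suc)
  also have "(s / 2 + of_nat n) * ((s + 1) / 2 + of_nat n) * 4 = (s + 2 * of_nat n) * (s + 2 * of_nat n + 1)"
    by (simp add: field_simps)
  finally have e: "catalan_coeff s (Suc n) = P * ((s + 2 * of_nat n) * (s + 2 * of_nat n + 1)) / ((1 + s + of_nat n) * of_nat (Suc n))" .
  have sn: "s + of_nat (Suc n) = 1 + s + of_nat n" by simp
  have "b * a * (P * k / (a * b)) = k * P" if "a \<noteq> 0" "b \<noteq> 0" for a b k :: complex
    using that by simp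
  from this[OF nz of_nat_neq_0] show ?thesis
    unfolding e catalan_coeff_def[of s n] P_def[symmetric] sn by (simp only: mult.assoc)
qed

text \<open>The closed form is \<open>((1 + R)/2)^{-s}\<close> with \<open>R = sqrt(1 - 4v)\<close>. It is holomorphic in the disc of radius \<open>1/4\<close>, so
only its Taylor coefficients are needed. Together with \<open>\<rho> = \<psi>/R\<close> it satisfies a first-order linear system with
polynomial coefficients, and eliminating the coefficients of \<open>\<rho>\<close> leaves the two-term recurrence that
determines the hypergeometric coefficients.\<close>

lemma catalan_series:
  assumes s: "Re s \<ge> 0" and v: "norm v < 1 / 4"
  shows "(\<lambda>n. catalan_coeff s n * v ^ n) sums exp (- s * Ln ((1 + csqrt (1 - 4 * v)) / 2))"
proof -
  define R where "R = (\<lambda>v. csqrt (1 - 4 * v))"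
  define \<psi> where "\<psi> = (\<lambda>v. exp (- s * Ln ((1 + R v) / 2)))"
  define \<rho> where "\<rho> = (\<lambda>v. \<psi> v / R v)"
  define B where "B = ball (0::complex) (1/4)"
  have nz: "1 - 4 * v \<notin> \<real>\<^sub>\<le>\<^sub>0" if "v \<in> B" for v
  proof -
    have "norm v < 1/4" using that by (simp add: B_def)
    then have "Re v < 1/4" using complex_Re_le_cmod[of v] by linarith
    then show ?thesis by (auto simp: complex_nonpos_Reals_iff)
  qed
  have R2: "R v ^ 2 = 1 - 4 * v" for v by (simp add: R_def)
  have R0: "R v \<noteq> 0" if "v \<in> B" for v using nz[OF that] R2[of v] by auto
  have Rp: "Re (1 + R v) \<ge> 1" for v using csqrt_principal[of "1 - 4 * v"] by (auto simp: R_def)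
  have Rp0: "1 + R v \<noteq> 0" for v using Rp[of v] by (metis not_one_le_zero zero_complex.sel(1))
  have Rn: "(1 + R v) / 2 \<notin> \<real>\<^sub>\<le>\<^sub>0" for v using Rp[of v] by (auto simp: complex_nonpos_Reals_iff)
  have dR: "(R has_field_derivative - 2 / R v) (at v)" if "v \<in> B" for v
    unfolding R_def using nz[OF that] by (auto intro!: derivative_eq_intros simp: field_simps)
  have d\<psi>: "(\<psi> has_field_derivative 2 * s * \<psi> v / (R v * (1 + R v))) (at v)" if "v \<in> B" for v
    unfolding \<psi>_def using Rn[of v] R0[OF that] Rp0[of v] by (auto intro!: derivative_eq_intros dR[OF that] simp: field_simps)
  have d\<rho>: "(\<rho> has_field_derivative 2 * s * \<psi> v / (R v ^ 2 * (1 + R v)) + 2 * \<psi> v / R v ^ 3) (at v)" if "v \<in> B" for v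
  proof -
    have g: "(2 * s * p / (r * q) * r - p * (- 2 / r)) / (r * r) = 2 * s * p / (r ^ 2 * q) + 2 * p / r ^ 3"
      if "r \<noteq> 0" "q \<noteq> 0" for r q p :: complex
      using that by (simp add: field_simps power2_eq_square power3_eq_cube)
    show ?thesis
      using DERIV_divide[OF d\<psi>[OF that] dR[OF that] R0[OF that]] unfolding g[OF R0[OF that] Rp0[of v]] \<rho>_def .
  qed
  have oB: "open B" "0 \<in> B" by (auto simp: B_def)
  have h\<psi>: "\<psi> holomorphic_on B" using d\<psi> by (auto simp: holomorphic_on_open oB)
  have h\<rho>: "\<rho> holomorphic_on B" using d\<rho> by (auto simp: holomorphic_on_open oB)
  define P where "P = fps_expansion \<psi> 0"
  define Q where "Q = fps_expansion \<rho> 0"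
  have P: "\<psi> has_fps_expansion P" unfolding P_def by (rule has_fps_expansion_fps_expansion[OF oB h\<psi>])
  have Q: "\<rho> has_fps_expansion Q" unfolding Q_def by (rule has_fps_expansion_fps_expansion[OF oB h\<rho>])
  (* Since 4v = (1 - R)(1 + R), multiplying the derivatives by v removes the denominator 1 + R. *)
  have v4: "v = (1 - R v) * (1 + R v) / 4" for v
    using R2[of v] by (simp add: algebra_simps power2_eq_square)
  have e1: "2 * (v * deriv \<psi> v) = s * (\<rho> v - \<psi> v)" if "v \<in> B" for v
  proof -
    have g: "2 * ((1 - r) * q / 4 * (2 * s * p / (r * q))) = s * (p / r - p)" if "r \<noteq> 0" "q \<noteq> 0" for r q p :: complex
      using that by (simp add: field_simps)
    show ?thesis
      using g[OF R0[OF that] Rp0[of v], of "\<psi> v", folded v4] unfolding DERIV_imp_deriv[OF d\<psi>[OF that]] \<rho>_def .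
  qed
  have e2: "2 * (v * deriv \<rho> v) - 8 * (v * (v * deriv \<rho> v)) = s * \<psi> v - s * \<rho> v + (4 * s + 4) * (v * \<rho> v)" if "v \<in> B" for v
  proof -
    have g: "2 * (1 - 4 * ((1 - r) * (1 + r) / 4)) * ((1 - r) * q / 4) * (2 * s * p / (r ^ 2 * q) + 2 * p / r ^ 3)
       = (1 - r) * s * p + 4 * ((1 - r) * q / 4) * (p / r)" if "r \<noteq> 0" "q \<noteq> 0" for r q p :: complex
      using that by (simp add: field_simps power2_eq_square power3_eq_cube)
    have "2 * (v * deriv \<rho> v) - 8 * (v * (v * deriv \<rho> v)) = 2 * (1 - 4 * v) * v * deriv \<rho> v"
      by (simp add: algebra_simps)
    also have "\<dots> = (1 - R v) * s * \<psi> v + 4 * v * (\<psi> v / R v)"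
      using g[OF R0[OF that] Rp0[of v], of "\<psi> v", folded v4] unfolding DERIV_imp_deriv[OF d\<rho>[OF that]] .
    also have "(1 - R v) * s * \<psi> v = s * \<psi> v - s * (R v ^ 2) * (\<psi> v / R v)"
      using R0[OF that] by (simp add: field_simps power2_eq_square)
    finally show ?thesis unfolding R2 \<rho>_def by (simp add: algebra_simps)
  qed
  have evB: "eventually (\<lambda>v. v \<in> B) (nhds 0)" using oB by (rule eventually_nhds_in_open)
  have f1: "fps_const 2 * (fps_X * fps_deriv P) = fps_const s * (Q - P)"
  proof (rule fps_expansion_unique_complex)
    show "(\<lambda>v. 2 * (v * deriv \<psi> v)) has_fps_expansion fps_const 2 * (fps_X * fps_deriv P)"
      by (intro fps_expansion_intros P)
    have "(\<lambda>v. s * (\<rho> v - \<psi> v)) has_fps_expansion fps_const s * (Q - P)"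
      by (intro fps_expansion_intros P Q)
    moreover have "eventually (\<lambda>v. s * (\<rho> v - \<psi> v) = 2 * (v * deriv \<psi> v)) (nhds 0)"
      using evB by eventually_elim (simp only: e1)
    ultimately show "(\<lambda>v. 2 * (v * deriv \<psi> v)) has_fps_expansion fps_const s * (Q - P)"
      by (subst (asm) has_fps_expansion_cong[OF _ refl])
  qed
  have f2: "fps_const 2 * (fps_X * fps_deriv Q) - fps_const 8 * (fps_X * (fps_X * fps_deriv Q))
      = fps_const s * P - fps_const s * Q + fps_const (4 * s + 4) * (fps_X * Q)"
  proof (rule fps_expansion_unique_complex)
    show "(\<lambda>v. 2 * (v * deriv \<rho> v) - 8 * (v * (v * deriv \<rho> v))) has_fps_expansion
        fps_const 2 * (fps_X * fps_deriv Q) - fps_const 8 * (fps_X * (fps_X * fps_deriv Q))"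
      by (intro fps_expansion_intros Q)
    have "(\<lambda>v. s * \<psi> v - s * \<rho> v + (4 * s + 4) * (v * \<rho> v)) has_fps_expansion
        fps_const s * P - fps_const s * Q + fps_const (4 * s + 4) * (fps_X * Q)"
      by (intro has_fps_expansion_add has_fps_expansion_diff has_fps_expansion_cmult_left has_fps_expansion_mult has_fps_expansion_fps_X P Q)
    moreover have "eventually (\<lambda>v. s * \<psi> v - s * \<rho> v + (4 * s + 4) * (v * \<rho> v) = 2 * (v * deriv \<rho> v) - 8 * (v * (v * deriv \<rho> v))) (nhds 0)"
      using evB by eventually_elim (simp only: e2)
    ultimately show "(\<lambda>v. 2 * (v * deriv \<rho> v) - 8 * (v * (v * deriv \<rho> v))) has_fps_expansion
        fps_const s * P - fps_const s * Q + fps_const (4 * s + 4) * (fps_X * Q)"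
      by (subst (asm) has_fps_expansion_cong[OF _ refl])
  qed
  have r1: "s * fps_nth Q n = (2 * of_nat n + s) * fps_nth P n" for n
    using arg_cong[OF f1, of "\<lambda>f. fps_nth f n"]
    by (cases n) (auto simp add: algebra_simps)
  have r2: "(2 * of_nat (Suc n) + s) * fps_nth Q (Suc n) - s * fps_nth P (Suc n) = 4 * (2 * of_nat n + 1 + s) * fps_nth Q n" for n
    using arg_cong[OF f2, of "\<lambda>f. fps_nth f (Suc n)"]
    by (cases n) (simp_all add: algebra_simps)
  have p0: "fps_nth P 0 = 1"
    by (simp add: P_def fps_expansion_def \<psi>_def R_def)
  have pc: "fps_nth P n = catalan_coeff s n" for n
  proof (induction n)
    case (Suc n)
    (* The factor s allows the coefficients of Q to be replaced by those of P; this covers s = 0 as well. *)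
    have "s * ((2 * of_nat (Suc n) + s) * fps_nth Q (Suc n) - s * fps_nth P (Suc n)) = s * (4 * (2 * of_nat n + 1 + s) * fps_nth Q n)"
      by (simp only: r2)
    then have "(2 * of_nat (Suc n) + s) * (s * fps_nth Q (Suc n)) - s * s * fps_nth P (Suc n) = 4 * (2 * of_nat n + 1 + s) * (s * fps_nth Q n)"
      by (simp only: right_diff_distrib mult_ac)
    then have "4 * (of_nat (Suc n) * (s + of_nat (Suc n)) * fps_nth P (Suc n)) = 4 * ((s + 2 * of_nat n) * (s + 2 * of_nat n + 1) * fps_nth P n)"
      unfolding r1 by (simp add: algebra_simps del: of_nat_Suc)
    then have "of_nat (Suc n) * (s + of_nat (Suc n)) * fps_nth P (Suc n) = of_nat (Suc n) * (s + of_nat (Suc n)) * catalan_coeff s (Suc n)"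
      unfolding catalan_coeff_Suc[OF s] Suc.IH by simp
    moreover have "s + of_nat (Suc n) \<noteq> 0" using one_plus_of_nat_neq_0[OF s, of n] by (simp add: add_ac)
    ultimately show ?case by (simp del: of_nat_Suc)
  qed (simp add: p0)
  have "(\<lambda>n. (deriv ^^ n) \<psi> 0 / fact n * (v - 0) ^ n) sums \<psi> v"
    by (rule holomorphic_power_series[of _ _ "1/4"]) (use h\<psi> v in \<open>auto simp: B_def\<close>)
  moreover have "(deriv ^^ n) \<psi> 0 / fact n = catalan_coeff s n" for n
    unfolding pc[symmetric] P_def fps_expansion_def by simp
  ultimately have "(\<lambda>n. catalan_coeff s n * v ^ n) sums \<psi> v" by (simp only: diff_zero)
  then show ?thesis by (simp only: \<psi>_def R_def)
qed

text \<open>Here \<open>R = tanh t\<close>, so \<open>(1 + R)/2 = e^t/(2 cosh t)\<close>.\<close>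

lemma catalan_series_cosh:
  assumes s: "Re s \<ge> 0" and t: "t > 0"
  shows "(\<lambda>n. catalan_coeff s n * of_real ((1 / (2 * cosh t)\<^sup>2) ^ n)) sums exp (- s * of_real (t - ln (2 * cosh t)))"
proof -
  define v where "v = 1 / (2 * cosh t)\<^sup>2"
  have c1: "1 < cosh t" using t cosh_real_strict_mono[of 0 t] by simp
  have v: "norm (complex_of_real v) < 1/4"
  proof -
    have "1 < (cosh t)\<^sup>2" using c1 by (simp add: power2_eq_square less_1_mult)
    then have "\<bar>v\<bar> < 1/4" by (simp add: v_def power_mult_distrib)
    then show ?thesis by simp
  qed
  have "1 - 4 * v = (sinh t / cosh t)\<^sup>2" using c1 unfolding v_def
    by (simp add: field_simps power2_eq_square) (simp add: cosh_square_eq flip: power2_eq_square)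
  then have "1 - 4 * complex_of_real v = of_real ((sinh t / cosh t)\<^sup>2)"
    by (simp only: of_real_diff of_real_mult of_real_1 of_real_numeral flip: \<open>1 - 4 * v = _\<close>)
  then have "csqrt (1 - 4 * of_real v) = of_real (sqrt ((sinh t / cosh t)\<^sup>2))"
    by (simp only: of_real_sqrt zero_le_power2)
  also have "sqrt ((sinh t / cosh t)\<^sup>2) = sinh t / cosh t"
    using c1 t by (simp only: real_sqrt_abs) (simp add: divide_nonneg_pos)
  finally have "csqrt (1 - 4 * of_real v) = of_real (sinh t / cosh t)" .
  then have "(1 + csqrt (1 - 4 * of_real v)) / 2 = of_real ((1 + sinh t / cosh t) / 2)" by simp
  also have "(1 + sinh t / cosh t) / 2 = exp t / (2 * cosh t)"
    using c1 by (simp add: field_simps flip: cosh_plus_sinh)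
  finally have "Ln ((1 + csqrt (1 - 4 * of_real v)) / 2) = of_real (ln (exp t / (2 * cosh t)))"
    using c1 by (simp only: Ln_of_real divide_pos_pos exp_gt_zero cosh_real_pos mult_pos_pos zero_less_numeral)
  then have "Ln ((1 + csqrt (1 - 4 * of_real v)) / 2) = of_real (t - ln (2 * cosh t))"
    using c1 by (simp add: ln_div)
  with catalan_series[OF s v] show ?thesis by (simp add: v_def)
qed

lemma norm_pochhammer_le: "norm (pochhammer (z + of_nat m) n :: complex) \<le> pochhammer (norm z + of_nat m) n"
proof (induction n)
  case (Suc n)
  have "norm (z + of_nat m + of_nat n) \<le> norm z + of_nat m + of_nat n"
    by (metis norm_add_leD norm_of_nat norm_triangle_le norm_triangle_mono order_refl)
  with Suc show ?case unfolding pochhammer_Suc norm_mult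
    by (intro mult_mono) (auto simp: pochhammer_prod intro!: prod_nonneg)
qed simp

text \<open>In this form there is no denominator depending on \<open>s\<close>, so the triangle inequality compares imaginary \<open>s\<close> with
its absolute value.\<close>

lemma catalan_coeff_Suc_eq:
  assumes "Re s \<ge> 0"
  shows "catalan_coeff s (Suc n) = s * pochhammer (s + of_nat (n + 2)) n / fact (Suc n)"
proof -
  have "pochhammer s (2 * Suc n) = 4 ^ Suc n * pochhammer (s / 2) (Suc n) * pochhammer ((s + 1) / 2) (Suc n)"
    using pochhammer_double[of "s/2" "Suc n"] by (simp add: power_mult add_divide_distrib)
  moreover have "pochhammer s (2 * Suc n) = s * pochhammer (1 + s) (Suc n + n)"
    using pochhammer_rec[of s "Suc n + n"] by (simp add: add.commute mult_2)
  moreover have "pochhammer (1 + s) (Suc n + n) = pochhammer (1 + s) (Suc n) * pochhammer (s + of_nat (n + 2)) n"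
    by (subst pochhammer_product'[of "1+s" "Suc n" n]) (simp add: add_ac)
  ultimately show ?thesis using pochhammer_one_plus_neq_0[OF assms, of "Suc n"]
    unfolding catalan_coeff_def by (simp add: field_simps del: fact_Suc)
qed

text \<open>The coefficients for imaginary \<open>s = i\<tau>\<close> are dominated by those for the real number \<open>|\<tau>|\<close>, which are nonnegative.
A single term of the convergent series at \<open>v = 1/5\<close> is bounded by its sum \<open>((1 + R)/2)^{-|\<tau>|} \<le> 2^{|\<tau>|}\<close>. Any
\<open>v < 1/4\<close> would serve; only the base 2 matters for the growth in \<open>\<tau>\<close>.\<close>

lemma norm_catalan_coeff_le: "norm (catalan_coeff (\<i> * of_real \<tau>) n) \<le> exp (\<bar>\<tau>\<bar> * ln 2) * 5 ^ n"
proof -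
  define x where "x = \<bar>\<tau>\<bar>"
  define d where "d = (\<lambda>n. case n of 0 \<Rightarrow> 1 | Suc n \<Rightarrow> x * pochhammer (x + of_nat (n + 2)) n / fact (Suc n))"
  have x: "x \<ge> 0" by (simp add: x_def)
  have d0: "d n \<ge> 0" for n using x
    by (auto simp: d_def pochhammer_prod split: nat.split simp del: fact_Suc intro!: mult_nonneg_nonneg divide_nonneg_pos prod_nonneg)
  have d: "catalan_coeff (of_real x) n = of_real (d n)" for n
  proof (cases n)
    case (Suc m)
    have "pochhammer (complex_of_real x + of_nat (m + 2)) m = of_real (pochhammer (x + of_nat (m + 2)) m)"
      by (simp add: pochhammer_of_real[symmetric])
    then show ?thesis using Suc x by (simp add: d_def catalan_coeff_Suc_eq del: fact_Suc of_nat_add)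
  qed (simp add: d_def)
  have le: "norm (catalan_coeff (\<i> * of_real \<tau>) n) \<le> d n" for n
  proof (cases n)
    case (Suc m)
    have "norm (catalan_coeff (\<i> * of_real \<tau>) (Suc m)) = x * norm (pochhammer (\<i> * of_real \<tau> + of_nat (m + 2)) m) / fact (Suc m)"
      by (subst catalan_coeff_Suc_eq) (simp_all add: norm_mult norm_divide x_def del: fact_Suc of_nat_add)
    also have "\<dots> \<le> x * pochhammer (norm (\<i> * of_real \<tau>) + of_nat (m + 2)) m / fact (Suc m)"
      using x by (intro divide_right_mono mult_left_mono norm_pochhammer_le) auto
    finally show ?thesis using Suc by (simp add: d_def x_def norm_mult)
  qed (simp add: d_def)
  define r where "r = (1 + csqrt (1 - 4 * (1/5))) / 2"
  have "(\<lambda>n. of_real (d n) * (1/5) ^ n) sums exp (- of_real x * Ln r)"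
    using catalan_series[of "of_real x" "1/5"] x by (simp add: d r_def norm_divide)
  from sums_Re[OF this] have "(\<lambda>n. d n * (1/5) ^ n) sums Re (exp (- of_real x * Ln r))"
    by (simp flip: of_real_power of_real_mult)
  then have "d n * (1/5) ^ n \<le> Re (exp (- of_real x * Ln r))"
    using sum_le_suminf[of "\<lambda>n. d n * (1/5) ^ n" "{n}"] d0 by (auto simp: sums_iff)
  also have "\<dots> \<le> norm (exp (- of_real x * Ln r))" by (rule complex_Re_le_cmod)
  also have "\<dots> = exp (- x * ln (norm r))"
  proof -
    have "Re r \<ge> 1/2" using csqrt_principal[of "1 - 4 * (1/5)"] by (auto simp: r_def)
    then have "r \<noteq> 0" by auto
    then show ?thesis by simp
  qed
  also have "\<dots> \<le> exp (x * ln 2)"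
  proof -
    have "Re r \<ge> 1/2" using csqrt_principal[of "1 - 4 * (1/5)"] by (auto simp: r_def)
    then have "norm r \<ge> 1/2" using complex_Re_le_cmod[of r] by linarith
    then have "ln (1/2) \<le> ln (norm r)" by (subst ln_le_cancel_iff) auto
    then have "- ln (norm r) \<le> ln 2" by (simp add: ln_div)
    from mult_left_mono[OF this x] show ?thesis by simp
  qed
  finally have "d n \<le> exp (x * ln 2) * 5 ^ n" by (simp add: field_simps)
  with le[of n] show ?thesis by (simp add: x_def)
qed

section \<open>Estimates and integrals for the Gamma function\<close>

lemma norm_Gamma_le: assumes "Re s > 0" shows "norm (Gamma s) \<le> Gamma (Re s)"
proof -
  have "norm (Gamma s) \<le> (LINT a|lborel. norm (exp (s * of_real a) * of_real (exp (- exp a))))"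
    using integral_norm_bound[of lborel "\<lambda>a. exp (s * of_real a) * of_real (exp (- exp a))"]
    by (simp only: Gamma_integral_exp_1(2)[OF assms])
  also have "\<dots> = (LINT a|lborel. exp (Re s * a) * exp (- 1 * exp a))"
    by (simp add: norm_mult)
  also have "\<dots> = Gamma (Re s)" using Gamma_integral_exp_real(2)[OF assms zero_less_one] by simp
  finally show ?thesis .
qed

lemma norm_sin_le: "norm (sin z) \<le> cosh (Im z)"
proof -
  have "sin z = (exp (\<i> * z) - exp (- (\<i> * z))) / (2 * \<i>)" by (simp add: sin_exp_eq)
  then have "norm (sin z) = norm (exp (\<i> * z) - exp (- (\<i> * z))) / 2" by (simp add: norm_divide norm_mult)
  also have "\<dots> \<le> (norm (exp (\<i> * z)) + norm (exp (- (\<i> * z)))) / 2"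
    by (intro divide_right_mono norm_triangle_ineq4) simp
  also have "\<dots> = cosh (Im z)" by (simp add: cosh_field_def)
  finally show ?thesis .
qed

text \<open>Each factor of the Pochhammer symbol is at least as large in absolute value as its real part. This transfers the
factorial decay in \<open>n\<close> from the real axis without loss of the decay in \<open>\<tau>\<close>.\<close>

lemma norm_rGamma_shift:
  assumes z: "Re z > 0"
  shows "norm (rGamma (z + of_nat n)) \<le> norm (rGamma z) * (Gamma (Re z) / Gamma (Re z + of_nat n))"
proof -
  define x where "x = Re z"
  have x: "x > 0" using z by (simp add: x_def)
  have "pochhammer x n \<le> norm (pochhammer z n)"
  proof (induction n)
    case (Suc n)
    have "x + of_nat n \<le> norm (z + of_nat n)" using complex_Re_le_cmod[of "z + of_nat n"] by (simp add: x_def)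
    with Suc show ?case using x unfolding pochhammer_Suc norm_mult
      by (intro mult_mono) auto
  qed simp
  moreover have "pochhammer x n = Gamma (x + of_nat n) / Gamma x"
    using x by (intro pochhammer_Gamma) auto
  moreover have "norm (rGamma z) = norm (pochhammer z n) * norm (rGamma (z + of_nat n))"
    by (subst pochhammer_rGamma[of z n]) (simp add: norm_mult)
  ultimately have "norm (rGamma z) \<ge> Gamma (x + of_nat n) / Gamma x * norm (rGamma (z + of_nat n))"
    by (metis mult_right_mono norm_ge_zero)
  then show ?thesis using x Gamma_real_pos[of x] Gamma_real_pos[of "x + of_nat n"]
    by (simp add: field_simps x_def[symmetric])
qed

text \<open>The reflection formula replaces asymptotic expansions of the Gamma function.\<close>

lemma norm_rGamma_le:
  assumes z: "Re z < 1"
  shows "norm (rGamma z) \<le> Gamma (1 - Re z) / pi * cosh (pi * Im z)"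
proof -
  have z1: "1 - z \<notin> \<int>\<^sub>\<le>\<^sub>0" using z by (auto elim!: nonpos_Ints_cases simp: complex_eq_iff)
  have "rGamma z * rGamma (1 - z) = sin (of_real pi * z) / of_real pi" by (rule rGamma_reflection_complex)
  moreover have "Gamma (1 - z) * rGamma (1 - z) = 1"
    using z1 by (simp add: rGamma_inverse_Gamma Gamma_eq_zero_iff)
  ultimately have "rGamma z = Gamma (1 - z) * (sin (of_real pi * z) / of_real pi)"
    by (metis mult.left_commute mult.right_neutral)
  then have "norm (rGamma z) = norm (Gamma (1 - z)) * (norm (sin (of_real pi * z)) / pi)"
    by (simp add: norm_mult norm_divide)
  also have "\<dots> \<le> Gamma (Re (1 - z)) * (cosh (Im (of_real pi * z)) / pi)"
    using z by (intro mult_mono norm_Gamma_le divide_right_mono norm_sin_le) (auto intro: Gamma_real_nonneg less_imp_le Gamma_real_pos)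
  finally show ?thesis by simp
qed

text \<open>Estimating the factors separately would cost \<open>cosh(\<pi> Im z)\<close> twice. The two arguments are related by reflection up to
conjugation, and jointly they cost it only once.\<close>

lemma norm_rGamma_product_le: "norm (rGamma z * rGamma (1 - cnj z)) \<le> cosh (pi * Im z) / pi"
proof -
  have "norm (rGamma (1 - cnj z)) = norm (rGamma (1 - z))"
    by (metis cnj_rGamma complex_cnj_diff complex_cnj_one complex_mod_cnj)
  then have "norm (rGamma z * rGamma (1 - cnj z)) = norm (rGamma z * rGamma (1 - z))" by (simp add: norm_mult)
  also have "\<dots> = norm (sin (of_real pi * z)) / pi" by (simp add: rGamma_reflection_complex norm_divide)
  also have "\<dots> \<le> cosh (Im (of_real pi * z)) / pi" by (intro divide_right_mono norm_sin_le) simp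
  finally show ?thesis by simp
qed

text \<open>The factor \<open>1 - e^{-t}\<close>, with \<open>t = e^a\<close>, supplies one power of \<open>t\<close> at the origin, so the difference of two Gamma integrals
converges for \<open>Re s > -1\<close>. Integration by parts reduces it to Gamma integrals with \<open>s + 1\<close>: the antiderivative
\<open>F\<close> below vanishes at both ends.\<close>

lemma Gamma_difference_integral:
  fixes s :: complex assumes s: "Re s > -1" "s \<noteq> 0" and r: "r > 0"
  shows "integrable lborel (\<lambda>a. exp (s * of_real a) * of_real ((1 - exp (- exp a)) * exp (- r * exp a)))" (is ?int)
    and "(LINT a|lborel. exp (s * of_real a) * of_real ((1 - exp (- exp a)) * exp (- r * exp a)))
      = Gamma s * (exp (- s * of_real (ln r)) - exp (- s * of_real (ln (r + 1))))"
    and "(LINT a|lborel. norm (exp (s * of_real a) * of_real ((1 - exp (- exp a)) * exp (- r * exp a))))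
      \<le> Gamma (Re s + 1) * exp (- (Re s + 1) * ln r)"
proof -
  define h where "h = (\<lambda>a. exp (s * of_real a) * of_real ((1 - exp (- exp a)) * exp (- r * exp a)))"
  define b where "b = (\<lambda>a. exp ((Re s + 1) * a) * exp (- r * exp a))"
  have hb: "norm (h a) \<le> b a" for a
  proof -
    have "1 - exp (- exp a) \<le> exp a" using exp_ge_add_one_self[of "- exp a"] by linarith
    moreover have "norm (h a) = exp (Re s * a) * ((1 - exp (- exp a)) * exp (- r * exp a))"
      unfolding h_def norm_mult norm_of_real by (simp add: abs_mult)
    ultimately have "norm (h a) \<le> exp (Re s * a) * (exp a * exp (- r * exp a))"
      by simp
    also have "\<dots> = b a" by (simp add: b_def ring_distribs exp_add)
    finally show ?thesis .
  qed
  have bi: "integrable lborel b" unfolding b_def using Gamma_integral_exp_real(1)[of "Re s + 1" r] s r by simp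
  have hi: "integrable lborel h"
  proof (rule Bochner_Integration.integrable_bound[OF bi])
    show "h \<in> borel_measurable lborel" unfolding h_def by measurable
    have "norm (h a) \<le> norm (b a)" for a using hb[of a] by (simp add: b_def)
    then show "AE a in lborel. norm (h a) \<le> norm (b a)" by simp
  qed
  show ?int using hi by (simp add: h_def)
  have "(LINT a|lborel. norm (h a)) \<le> (LINT a|lborel. b a)"
    by (rule integral_mono[OF integrable_norm[OF hi] bi hb])
  also have "\<dots> = Gamma (Re s + 1) * exp (- (Re s + 1) * ln r)"
    unfolding b_def using Gamma_integral_exp_real(2)[of "Re s + 1" r] s r by simp
  finally show "(LINT a|lborel. norm (exp (s * of_real a) * of_real ((1 - exp (- exp a)) * exp (- r * exp a))))
      \<le> Gamma (Re s + 1) * exp (- (Re s + 1) * ln r)" by (simp add: h_def)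
  define k where "k = (\<lambda>p::real. \<lambda>a. exp ((s + 1) * of_real a) * of_real (exp (- p * exp a)))"
  have ki: "integrable lborel (k p)" and kv: "(LINT a|lborel. k p a) = Gamma (s + 1) * exp (- (s + 1) * of_real (ln p))" if "p > 0" for p
    unfolding k_def using Gamma_integral_exp[of "s + 1" p] s that by simp_all
  define F where "F = (\<lambda>a. exp (s * of_real a) * of_real ((1 - exp (- exp a)) * exp (- r * exp a)) / s)"
  define f where "f = (\<lambda>a. h a + (of_real (r + 1) * k (r + 1) a - of_real r * k r a) / s)"
  have fi: "integrable lborel f" unfolding f_def using hi ki[of r] ki[of "r+1"] r
    by (intro Bochner_Integration.integrable_add Bochner_Integration.integrable_divide Bochner_Integration.integrable_diff integrable_mult_right) auto
  have Fd: "(F has_vector_derivative f a) (at a)" for a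
  proof -
    have dd: "((\<lambda>a. (1 - exp (- exp a)) * exp (- r * exp a)) has_real_derivative ((r + 1) * (exp a * exp (- (r + 1) * exp a)) - r * (exp a * exp (- r * exp a)))) (at a)"
      by (auto intro!: derivative_eq_intros simp: algebra_simps exp_add exp_diff exp_minus field_simps)
    have d2: "((\<lambda>a. complex_of_real ((1 - exp (- exp a)) * exp (- r * exp a))) has_vector_derivative of_real ((r + 1) * (exp a * exp (- (r + 1) * exp a)) - r * (exp a * exp (- r * exp a)))) (at a)"
      by (rule bounded_linear.has_vector_derivative[OF bounded_linear_of_real dd[unfolded has_real_derivative_iff_has_vector_derivative]])
    have d1: "((\<lambda>a. exp (s * of_real a)) has_vector_derivative s * exp (s * of_real a)) (at a)"
      by (rule has_vector_derivative_real_field) (auto intro!: derivative_eq_intros)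
    have "f a = (exp (s * of_real a) * of_real ((r + 1) * (exp a * exp (- (r + 1) * exp a)) - r * (exp a * exp (- r * exp a))) + s * exp (s * of_real a) * of_real ((1 - exp (- exp a)) * exp (- r * exp a))) / s"
      using s(2) unfolding f_def h_def k_def
      by (simp add: field_simps exp_add exp_of_real)
    then show ?thesis unfolding F_def
      using has_vector_derivative_divide[OF has_vector_derivative_mult[OF d1 d2], of s] by simp
  qed
  have Fb: "norm (F a) \<le> b a / norm s" for a
    using hb[of a] unfolding F_def h_def norm_divide by (rule divide_right_mono) simp
  have b0: "(b \<longlongrightarrow> 0) at_top" "(b \<longlongrightarrow> 0) at_bot"
  proof -
    define c where "c = Re s + 1"
    have c: "c > 0" using s by (simp add: c_def)
    show "(b \<longlongrightarrow> 0) at_top" "(b \<longlongrightarrow> 0) at_bot" unfolding b_def c_def[symmetric] using c r by real_asymp+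
  qed
  have F0: "(F \<longlongrightarrow> 0) G" if "(b \<longlongrightarrow> 0) G" for G
  proof (rule Lim_null_comparison)
    show "\<forall>\<^sub>F a in G. norm (F a) \<le> b a / norm s" by (rule always_eventually, rule allI, rule Fb)
    show "((\<lambda>a. b a / norm s) \<longlongrightarrow> 0) G" using tendsto_divide[OF that tendsto_const, of "norm s"] s(2) by simp
  qed
  have "interval_lebesgue_integral lborel (-\<infinity>) \<infinity> f = 0 - 0"
  proof (rule interval_integral_FTC_integrable)
    show "isCont f x" for x unfolding f_def h_def k_def using s(2) by (intro continuous_intros)
    show "set_integrable lborel (einterval (- \<infinity>) \<infinity>) f" using fi by (simp add: set_integrable_def einterval_def)
    show "((F \<circ> real_of_ereal) \<longlongrightarrow> 0) (at_right (- \<infinity>))" "((F \<circ> real_of_ereal) \<longlongrightarrow> 0) (at_left \<infinity>)"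
      using F0[OF b0(1)] F0[OF b0(2)] by (simp_all add: ereal_tendsto_simps)
  qed (use Fd in auto)
  then have "(LINT a|lborel. f a) = 0"
    by (simp add: interval_lebesgue_integral_def set_lebesgue_integral_def einterval_def)
  then have "(LINT a|lborel. h a) = (of_real r * (LINT a|lborel. k r a) - of_real (r + 1) * (LINT a|lborel. k (r + 1) a)) / s"
  proof -
    have g: "X = (B - A) / s" if "X + (A - B) / s = 0" for X A B :: complex
      using that s(2) by (simp add: field_simps eq_neg_iff_add_eq_0 add_eq_0_iff)
    have "(LINT a|lborel. f a) = (LINT a|lborel. h a) + (of_real (r + 1) * (LINT a|lborel. k (r + 1) a) - of_real r * (LINT a|lborel. k r a)) / s"
      unfolding f_def using hi ki[of r] ki[of "r+1"] r by (simp del: of_real_add)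
    then show ?thesis using \<open>(LINT a|lborel. f a) = 0\<close> by (intro g) simp
  qed
  also have "\<dots> = Gamma s * (exp (- s * of_real (ln r)) - exp (- s * of_real (ln (r + 1))))"
  proof -
    have nz: "s \<notin> \<int>\<^sub>\<le>\<^sub>0" using s by (auto elim!: nonpos_Ints_cases simp: complex_eq_iff)
    have G: "Gamma (s + 1) = s * Gamma s" by (rule Gamma_plus1[OF nz])
    have e: "of_real p * exp (- (s + 1) * of_real (ln p)) = exp (- s * of_real (ln p))" if "p > 0" for p :: real
      using that by (simp add: ring_distribs exp_add exp_diff exp_minus exp_of_real)
    have g: "(p * ((s * g) * x) - q * ((s * g) * y)) / s = g * (p * x - q * y)" for p q g x y :: complex
      using s(2) by (simp add: field_simps)
    have "(of_real r * (LINT a|lborel. k r a) - of_real (r + 1) * (LINT a|lborel. k (r + 1) a)) / s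
      = Gamma s * (of_real r * exp (- (s + 1) * of_real (ln r)) - of_real (r + 1) * exp (- (s + 1) * of_real (ln (r + 1))))"
      using kv[of r] kv[of "r+1"] r by (simp only: G g)
    then show ?thesis using e[of r] e[of "r+1"] r by (simp only: add_pos_pos zero_less_one)
  qed
  finally show "(LINT a|lborel. exp (s * of_real a) * of_real ((1 - exp (- exp a)) * exp (- r * exp a)))
      = Gamma s * (exp (- s * of_real (ln r)) - exp (- s * of_real (ln (r + 1))))" by (simp add: h_def)
qed

section \<open>The Macdonald function of real order\<close>

text \<open>The Macdonald function \<open>K_\<alpha>(z)\<close> for positive \<open>z\<close>, as an integral over the whole line: folding the line at 0 gives back
the integral of \<open>exp(-z cosh a) cosh(\<alpha> a)\<close> over the half-line.\<close>

definition macK :: "real \<Rightarrow> real \<Rightarrow> real" where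
  "macK \<alpha> z = 1/2 * (LINT a|lborel. exp (- z * cosh a + \<alpha> * a))"

lemma borel_measurable_cosh [measurable]: "(cosh :: real \<Rightarrow> real) \<in> borel_measurable borel"
  by (intro borel_measurable_continuous_onI continuous_intros)

lemma borel_measurable_cnj [measurable]: "cnj \<in> borel_measurable borel"
  by (intro borel_measurable_continuous_onI continuous_intros)

lemma integrable_exp_abs: "0 < k \<Longrightarrow> integrable lborel (\<lambda>x::real. exp (- k * \<bar>x\<bar>))"
proof -
  assume k: "0 < k"
  define e where "e = (\<lambda>x::real. exp (- x) * indicator {0<..} x)"
  have a: "integrable lborel e"
    using has_bochner_integral_I0i_power_exp_m[of 0] by (simp add: has_bochner_integral_iff e_def)
  have p: "integrable lborel (\<lambda>x::real. e (0 + k * x))"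
    by (subst lborel_integrable_real_affine_iff) (use k a in auto)
  have m: "integrable lborel (\<lambda>x::real. e (0 + (-k) * x))"
    by (subst lborel_integrable_real_affine_iff) (use k a in auto)
  show ?thesis
  proof (rule Bochner_Integration.integrable_bound[OF Bochner_Integration.integrable_add[OF p m]])
    have "exp (- k * \<bar>x\<bar>) \<le> norm (e (0 + k * x) + e (0 + (-k) * x))" if "x \<noteq> 0" for x :: real
    proof (cases "x > 0")
      case True
      then have "0 < k * x" using k by simp
      then show ?thesis using True by (simp add: e_def)
    next
      case False
      then have "k * x < 0" using k that by (simp add: mult_pos_neg)
      then show ?thesis using False by (simp add: e_def)
    qed
    then show "AE x in lborel. norm (exp (- k * \<bar>x\<bar>)) \<le> norm (e (0 + k * x) + e (0 + (-k) * x))"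
      using AE_lborel_singleton[of 0] by auto
  qed simp
qed

lemma cosh_ge_exp_abs: "exp \<bar>x\<bar> / 2 \<le> cosh (x::real)"
  by (cases "x \<ge> 0") (auto simp: cosh_field_def)

lemma macK_integrand_le: "exp (- z * cosh a + \<alpha> * a) \<le> exp (\<alpha> * a) * exp (- (z / 2) * exp a)" if "z > 0" for z a :: real
proof -
  have "exp a / 2 \<le> cosh a" by (simp add: cosh_field_def)
  then have "- z * cosh a \<le> - (z / 2) * exp a" using that by (simp add: field_simps)
  then show ?thesis by (simp flip: exp_add)
qed

lemma macK_measurable [measurable]: "macK \<alpha> \<in> borel_measurable borel"
proof -
  have "macK \<alpha> = (\<lambda>z. 1/2 * (LINT a|lborel. exp (- z * cosh a + \<alpha> * a)))" by (intro ext) (simp add: macK_def)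
  also have "\<dots> \<in> borel_measurable borel" by measurable
  finally show ?thesis .
qed

lemma macK_nonneg: "0 \<le> macK \<alpha> z" by (simp add: macK_def)

context
  fixes \<alpha> :: real assumes al: "0 < \<alpha>"
begin

lemma integrable_macK: "z > 0 \<Longrightarrow> integrable lborel (\<lambda>a. exp (- z * cosh a + \<alpha> * a))"
  by (rule Bochner_Integration.integrable_bound[OF Gamma_integral_exp_real(1)[of \<alpha> "z/2"]])
     (use al macK_integrand_le[of z] in auto)

text \<open>Keeping only half of \<open>cosh a = (e^a + e^{-a})/2\<close> in the exponent leaves a Gamma integral.\<close>

lemma macK_le: assumes z: "z > 0" shows "macK \<alpha> z \<le> 1/2 * Gamma \<alpha> * exp (- \<alpha> * ln (z / 2))"
proof -
  have "(LINT a|lborel. exp (- z * cosh a + \<alpha> * a)) \<le> (LINT a|lborel. exp (\<alpha> * a) * exp (- (z / 2) * exp a))"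
    by (rule integral_mono[OF integrable_macK[OF z] Gamma_integral_exp_real(1)]) (use al z macK_integrand_le[OF z] in auto)
  also have "\<dots> = Gamma \<alpha> * exp (- \<alpha> * ln (z / 2))" by (rule Gamma_integral_exp_real(2)) (use al z in auto)
  finally show ?thesis by (simp add: macK_def)
qed

lemma macK_scaled_le: assumes "c > 0" "0 < y"
  shows "macK \<alpha> (c * y) \<le> (1/2 * Gamma \<alpha> * 2 powr \<alpha>) * c powr (- \<alpha>) * y powr (- \<alpha>)"
proof -
  have "exp (- \<alpha> * ln (c * y / 2)) = 2 powr \<alpha> * c powr (- \<alpha>) * y powr (- \<alpha>)"
    using assms by (simp add: powr_def ln_div ln_mult ring_distribs exp_add exp_diff)
       (simp add: exp_minus field_simps)
  with macK_le[of "c * y"] assms show ?thesis by (simp add: mult_ac)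
qed

text \<open>The subtracted term is the leading singularity of \<open>K_\<alpha>\<close> at 0. It is the Gamma integral obtained by dropping \<open>e^{-a}\<close> from
the exponent, so the difference is an integral of \<open>1 - exp(-(z/2) e^{-a})\<close> against \<open>e^{\<alpha>a}\<close>, and translating \<open>a\<close> by \<open>ln(z/2)\<close> extracts
the factor \<open>(z/2)^\<alpha>\<close>. The remaining integral converges at \<open>-\<infinity>\<close> because \<open>\<alpha> > 0\<close> and at \<open>\<infinity>\<close> because
\<open>\<alpha> < 1\<close>.\<close>

lemma macK_small_argument:
  assumes a1: "\<alpha> < 1"
  obtains C where "\<And>z. z > 0 \<Longrightarrow> \<bar>macK \<alpha> z - 1/2 * Gamma \<alpha> * exp (- \<alpha> * ln (z / 2))\<bar> \<le> C * exp (\<alpha> * ln (z / 2))"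
proof
  fix z :: real assume z: "z > 0"
  define w :: "real \<Rightarrow> real" where "w = (\<lambda>a::real. (1 - exp (- exp (- a))) * exp (\<alpha> * a))"
  have w: "integrable lborel w"
  proof (rule Bochner_Integration.integrable_bound[OF Bochner_Integration.integrable_add[OF integrable_exp_abs[OF al] integrable_exp_abs]])
    show "0 < 1 - \<alpha>" using a1 by simp
    show "w \<in> borel_measurable lborel" by (simp add: w_def)
    have w0: "w a \<ge> 0" for a by (simp add: w_def)
    have "\<bar>w a\<bar> \<le> exp (- \<alpha> * \<bar>a\<bar>) + exp (- (1 - \<alpha>) * \<bar>a\<bar>)" for a
    proof (cases "a \<le> 0")
      case True
      have "w a \<le> 1 * exp (\<alpha> * a)" unfolding w_def by (intro mult_right_mono) auto
      also have "\<dots> = exp (- \<alpha> * \<bar>a\<bar>)" using True by simp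
      finally show ?thesis using w0[of a] exp_gt_zero[of "- (1 - \<alpha>) * \<bar>a\<bar>"] by linarith
    next
      case False
      have "1 - exp (- exp (- a)) \<le> exp (- a)" using exp_ge_add_one_self[of "- exp (- a)"] by linarith
      then have "w a \<le> exp (- a) * exp (\<alpha> * a)" unfolding w_def by (intro mult_right_mono) auto
      also have "\<dots> = exp (- (1 - \<alpha>) * \<bar>a\<bar>)" using False by (simp add: algebra_simps flip: exp_add)
      finally show ?thesis using w0[of a] exp_gt_zero[of "- \<alpha> * \<bar>a\<bar>"] by linarith
    qed
    then show "AE a in lborel. norm (w a) \<le> norm (exp (- \<alpha> * \<bar>a\<bar>) + exp (- (1 - \<alpha>) * \<bar>a\<bar>))"
      by (intro AE_I2) (simp add: abs_of_pos add_pos_pos)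
  qed
  define L where "L = ln (z / 2)"
  have eL: "exp L = z / 2" using z by (simp add: L_def)
  have G: "integrable lborel (\<lambda>a. exp (\<alpha> * a) * exp (- (z / 2) * exp a))"
    "(LINT a|lborel. exp (\<alpha> * a) * exp (- (z / 2) * exp a)) = Gamma \<alpha> * exp (- \<alpha> * L)"
    using Gamma_integral_exp_real[of \<alpha> "z/2"] al z by (auto simp: L_def)
  define d where "d = (\<lambda>a. exp (\<alpha> * a) * exp (- (z / 2) * exp a) - exp (- z * cosh a + \<alpha> * a))"
  have di: "integrable lborel d" unfolding d_def by (rule Bochner_Integration.integrable_diff[OF G(1) integrable_macK[OF z]])
  have dv: "(LINT a|lborel. d a) = Gamma \<alpha> * exp (- \<alpha> * L) - 2 * macK \<alpha> z"
    unfolding d_def using G integrable_macK[OF z] by (simp add: macK_def)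
  have d0: "0 \<le> d a" for a using macK_integrand_le[OF z, of a \<alpha>] by (simp add: d_def)
  have dw: "d a \<le> exp (\<alpha> * L) * w (- L + 1 * a)" for a
  proof -
    have "z * cosh a = exp L * exp a + exp L * exp (- a)"
    proof -
      have "z = 2 * exp L" using eL by simp
      then show ?thesis by (simp add: cosh_field_def algebra_simps)
    qed
    then have "d a = (1 - exp (- exp (- (- L + a)))) * exp (\<alpha> * a) * exp (- (exp L * exp a))"
      unfolding d_def eL[symmetric] by (simp add: exp_add exp_diff exp_minus algebra_simps) (simp add: field_simps exp_add exp_diff)
    also have "\<dots> \<le> (1 - exp (- exp (- (- L + a)))) * exp (\<alpha> * a) * 1"
      by (intro mult_left_mono) auto
    also have "\<dots> = exp (\<alpha> * L) * w (- L + 1 * a)"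
      by (simp add: w_def ring_distribs exp_add exp_diff exp_minus)
    finally show ?thesis .
  qed
  have wi: "integrable lborel (\<lambda>a. w (- L + 1 * a))" by (subst lborel_integrable_real_affine_iff) (use w in auto)
  have wv: "(LINT a|lborel. w (- L + 1 * a)) = (LINT a|lborel. w a)"
    by (subst (2) lborel_integral_real_affine[of 1 _ "- L"]) auto
  have "(LINT a|lborel. d a) \<le> (LINT a|lborel. exp (\<alpha> * L) * w (- L + 1 * a))"
    by (rule integral_mono[OF di integrable_mult_right[OF wi] dw])
  also have "\<dots> = exp (\<alpha> * L) * (LINT a|lborel. w a)" by (simp add: wv[simplified])
  finally have "(LINT a|lborel. d a) \<le> exp (\<alpha> * L) * (LINT a|lborel. w a)" .
  moreover have "0 \<le> (LINT a|lborel. d a)" using d0 by simp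
  ultimately have "\<bar>macK \<alpha> z - 1/2 * Gamma \<alpha> * exp (- \<alpha> * L)\<bar> \<le> (1/2 * (LINT a|lborel. w a)) * exp (\<alpha> * L)"
    unfolding dv by (simp add: abs_if mult_ac)
  then show "\<bar>macK \<alpha> z - 1/2 * Gamma \<alpha> * exp (- \<alpha> * ln (z / 2))\<bar> \<le> (1/2 * (LINT a|lborel. (1 - exp (- exp (- a))) * exp (\<alpha> * a))) * exp (\<alpha> * ln (z / 2))"
    by (simp only: L_def w_def)
qed

lemma Macdonald_K_full_line:
  assumes x: "x > 0" and mu: "Re \<mu> > 0"
  shows "integrable lborel (\<lambda>u. exp (- of_real (x * cosh u) + \<mu> * of_real u))"
    and "Macdonald_K \<mu> (of_real x) = 1/2 * (LINT u|lborel. exp (- of_real (x * cosh u) + \<mu> * of_real u))"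
proof -
  define h where "h = (\<lambda>u. exp (- complex_of_real (x * cosh u) + \<mu> * of_real u))"
  have h: "integrable lborel h"
  proof (rule Bochner_Integration.integrable_bound)
    show "integrable lborel (\<lambda>a. exp (Re \<mu> * a) * exp (- (x / 2) * exp a))"
      by (rule Gamma_integral_exp_real) (use x mu in auto)
    show "AE u in lborel. norm (h u) \<le> norm (exp (Re \<mu> * u) * exp (- (x / 2) * exp u))"
      using macK_integrand_le[OF x] by (intro AE_I2) (simp add: h_def)
  qed (simp add: h_def)
  then show "integrable lborel (\<lambda>u. exp (- of_real (x * cosh u) + \<mu> * of_real u))" by (simp add: h_def)
  have i1: "integrable lborel (\<lambda>u. indicator {0..} u *\<^sub>R h u)"
    using h by (rule integrable_mult_indicator[rotated]) simp
  have i2: "integrable lborel (\<lambda>u. indicator {..0} u *\<^sub>R h u)"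
    using h by (rule integrable_mult_indicator[rotated]) simp
  have r: "(\<lambda>u. indicator {0..} u *\<^sub>R h (-u)) = (\<lambda>u. indicator {..0} (0 + (-1) * u) *\<^sub>R h (0 + (-1) * u))"
    by (auto simp: indicator_def)
  have i3: "integrable lborel (\<lambda>u. indicator {0..} u *\<^sub>R h (- u))"
    unfolding r by (subst lborel_integrable_real_affine_iff) (use i2 in auto)
  have v3: "(LINT u|lborel. indicator {0..} u *\<^sub>R h (- u)) = (LINT u|lborel. indicator {..0} u *\<^sub>R h u)"
    unfolding r by (subst (2) lborel_integral_real_affine[of "-1" _ 0]) auto
  have "Macdonald_K \<mu> (of_real x) = (LINT u|lborel. 1/2 * (indicator {0..} u *\<^sub>R h u + indicator {0..} u *\<^sub>R h (- u)))"
    unfolding Macdonald_K_def set_lebesgue_integral_def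
  proof (intro Bochner_Integration.integral_cong refl)
    fix u :: real
    have "exp (- complex_of_real x * cosh (complex_of_real u)) * cosh (\<mu> * complex_of_real u) = 1/2 * (h u + h (- u))"
    proof -
      have "cosh (complex_of_real u) = of_real (cosh u)" by (simp add: cosh_field_def flip: exp_of_real)
      then show ?thesis
        by (simp add: h_def cosh_field_def[of "\<mu> * _"] exp_add exp_diff exp_minus field_simps)
    qed
    then show "indicator {0..} u *\<^sub>R (exp (- complex_of_real x * cosh (complex_of_real u)) * cosh (\<mu> * complex_of_real u))
       = 1/2 * (indicator {0..} u *\<^sub>R h u + indicator {0..} u *\<^sub>R h (- u))" by (simp add: indicator_def)
  qed
  also have "\<dots> = 1/2 * ((LINT u|lborel. indicator {0..} u *\<^sub>R h u) + (LINT u|lborel. indicator {..0} u *\<^sub>R h u))"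
    using i1 i3 by (simp add: v3)
  also have "(LINT u|lborel. indicator {0..} u *\<^sub>R h u) + (LINT u|lborel. indicator {..0} u *\<^sub>R h u) = (LINT u|lborel. indicator {0..} u *\<^sub>R h u + indicator {..0} u *\<^sub>R h u)"
    using i1 i2 by simp
  also have "\<dots> = (LINT u|lborel. h u)"
  proof (rule integral_cong_AE)
    show "AE u in lborel. indicator {0..} u *\<^sub>R h u + indicator {..0} u *\<^sub>R h u = h u"
      using AE_lborel_singleton[of 0] by eventually_elim (auto simp: indicator_def)
  qed (use h in \<open>auto simp: h_def\<close>)
  finally show "Macdonald_K \<mu> (of_real x) = 1/2 * (LINT u|lborel. exp (- of_real (x * cosh u) + \<mu> * of_real u))"
    by (simp add: h_def)
qed

text \<open>In the double integral for \<open>K_\<mu> K_{\<mu>'}\<close>, with \<open>\<mu>'\<close> the conjugate of \<open>\<mu>\<close>, substitute \<open>u = a + b\<close>, \<open>v = a - b\<close>. Then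
\<open>cosh u + cosh v = 2 cosh a cosh b\<close> and \<open>\<mu>u + \<mu>'v = \<alpha>a + i\<tau>b\<close>, so the integral over \<open>a\<close> is a Macdonald function of order \<open>\<alpha>\<close>. The
substitution is carried out as two one-dimensional ones, first in \<open>v\<close> and then in \<open>u\<close>.\<close>

lemma norm_Macdonald_K_squared:
  assumes x: "x > 0"
  shows "of_real ((norm (Macdonald_K ((\<i> * of_real \<tau> + of_real \<alpha>) / 2) (of_real x)))\<^sup>2)
     = (LINT b|lborel. exp (\<i> * of_real (\<tau> * b)) * of_real (macK \<alpha> (2 * x * cosh b)))"
proof -
  define \<mu> where "\<mu> = (\<i> * of_real \<tau> + of_real \<alpha>) / 2"
  define h where "h = (\<lambda>u. exp (- complex_of_real (x * cosh u) + \<mu> * of_real u))"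
  define N where "N = (\<lambda>u. exp (- (x * cosh u) + \<alpha> / 2 * u))"
  have mu: "Re \<mu> > 0" "Re \<mu> = \<alpha> / 2" using al by (auto simp: \<mu>_def)
  have h: "integrable lborel h" unfolding h_def by (rule Macdonald_K_full_line(1)[OF x mu(1)])
  have K: "Macdonald_K \<mu> (of_real x) = 1/2 * (LINT u|lborel. h u)"
    unfolding h_def by (rule Macdonald_K_full_line(2)[OF x mu(1)])
  have Nh: "norm (h u) = N u" for u by (simp add: h_def N_def mu(2))
  have Ni: "integrable lborel N" using integrable_norm[OF h] by (simp only: Nh)
  define w where "w = (\<lambda>u b. h u * cnj (h (u + (-2) * b)))"
  have [measurable]: "h \<in> borel_measurable borel" using h by simp
  have wi: "integrable (lborel \<Otimes>\<^sub>M lborel) (\<lambda>(u, b). w u b)"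
  proof (rule lborel_pair.Fubini_integrable)
    show "(\<lambda>(u, b). w u b) \<in> borel_measurable (lborel \<Otimes>\<^sub>M lborel)"
      unfolding w_def by measurable
    have "(LINT b|lborel. norm (w u b)) = N u * (1/2 * (LINT v|lborel. N v))" for u
    proof -
      have "(LINT v|lborel. N v) = 2 * (LINT b|lborel. N (u + (-2) * b))"
        by (subst lborel_integral_real_affine[of "-2" _ u]) auto
      then show ?thesis by (simp add: w_def norm_mult Nh)
    qed
    then show "integrable lborel (\<lambda>u. LINT b|lborel. norm (case (u, b) of (u, b) \<Rightarrow> w u b))"
      by (simp only: prod.case) (intro integrable_mult_left impI Ni)
    have "integrable lborel (w u)" for u
      unfolding w_def by (intro integrable_mult_right integrable_cnj lborel_integrable_real_affine h) simp
    then show "AE u in lborel. integrable lborel (\<lambda>b. case (u, b) of (u, b) \<Rightarrow> w u b)" by simp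
  qed
  have "of_real ((norm (Macdonald_K \<mu> (of_real x)))\<^sup>2) = Macdonald_K \<mu> (of_real x) * cnj (Macdonald_K \<mu> (of_real x))"
    by (rule complex_norm_square)
  also have "\<dots> = 1/4 * (LINT u|lborel. h u * (LINT v|lborel. cnj (h v)))"
    unfolding K by (simp add: integral_cnj)
  also have "(LINT u|lborel. h u * (LINT v|lborel. cnj (h v))) = (LINT u|lborel. 2 * (LINT b|lborel. w u b))"
  proof (rule Bochner_Integration.integral_cong[OF refl])
    fix u
    have "(LINT v|lborel. cnj (h v)) = 2 * (LINT b|lborel. cnj (h (u + (-2) * b)))"
      by (subst lborel_integral_real_affine[of "-2" _ u]) (auto simp: scaleR_conv_of_real)
    then show "h u * (LINT v|lborel. cnj (h v)) = 2 * (LINT b|lborel. w u b)"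
      unfolding w_def by simp
  qed
  also have "\<dots> = 2 * (LINT b|lborel. LINT u|lborel. w u b)"
    using lborel_pair.Fubini_integral[OF wi] by simp
  also have "(LINT b|lborel. LINT u|lborel. w u b) = (LINT b|lborel. 2 * (exp (\<i> * of_real (\<tau> * b)) * of_real (macK \<alpha> (2 * x * cosh b))))"
  proof (rule Bochner_Integration.integral_cong[OF refl])
    fix b
    have ww: "w (b + 1 * a) b = exp (\<i> * of_real (\<tau> * b)) * of_real (exp (- (2 * x * cosh b) * cosh a + \<alpha> * a))" for a
    proof -
      have c: "cosh (a + b) + cosh (a - b) = 2 * cosh a * cosh b" by (simp add: cosh_add cosh_diff)
      have "w (b + 1 * a) b = h (a + b) * cnj (h (a - b))" by (simp add: w_def algebra_simps)
      also have "\<dots> = exp (- complex_of_real (x * (cosh (a + b) + cosh (a - b))) + (\<mu> * of_real (a + b) + cnj \<mu> * of_real (a - b)))"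
        unfolding h_def exp_cnj exp_add[symmetric] by (intro arg_cong[where f=exp]) (simp add: algebra_simps)
      also have "\<mu> * of_real (a + b) + cnj \<mu> * of_real (a - b) = of_real (\<alpha> * a) + \<i> * of_real (\<tau> * b)"
        by (simp add: \<mu>_def complex_eq_iff field_simps)
      also have "exp (- complex_of_real (x * (cosh (a + b) + cosh (a - b))) + (of_real (\<alpha> * a) + \<i> * of_real (\<tau> * b)))
         = exp (\<i> * of_real (\<tau> * b)) * exp (of_real (- (2 * x * cosh b) * cosh a + \<alpha> * a))"
        unfolding c exp_add[symmetric] by (intro arg_cong[where f=exp]) (simp add: algebra_simps)
      finally show ?thesis by (simp only: exp_of_real)
    qed
    have "(LINT u|lborel. w u b) = (LINT a|lborel. w (b + 1 * a) b)"
      by (subst lborel_integral_real_affine[of 1 _ b]) auto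
    also have "\<dots> = exp (\<i> * of_real (\<tau> * b)) * of_real (LINT a|lborel. exp (- (2 * x * cosh b) * cosh a + \<alpha> * a))"
      unfolding ww by (simp only: integral_mult_right_zero integral_complex_of_real)
    finally show "(LINT u|lborel. w u b) = 2 * (exp (\<i> * of_real (\<tau> * b)) * of_real (macK \<alpha> (2 * x * cosh b)))"
      by (simp add: macK_def)
  qed
  finally show ?thesis by (simp add: \<mu>_def)
qed

end

section \<open>The Macdonald transform and its Fourier representation\<close>

lemma (in pair_sigma_finite) integrable_product_bound:
  fixes f :: "'a \<Rightarrow> 'b \<Rightarrow> complex"
  assumes f: "(\<lambda>(x, y). f x y) \<in> borel_measurable (M1 \<Otimes>\<^sub>M M2)"
    and u: "integrable M1 u" and v: "integrable M2 v"
    and le: "\<And>x y. x \<in> space M1 \<Longrightarrow> y \<in> space M2 \<Longrightarrow> norm (f x y) \<le> u x * v y"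
  shows "integrable (M1 \<Otimes>\<^sub>M M2) (\<lambda>(x, y). f x y)"
proof (rule Bochner_Integration.integrable_bound)
  have [measurable]: "u \<in> borel_measurable M1" "v \<in> borel_measurable M2" using u v by auto
  show "integrable (M1 \<Otimes>\<^sub>M M2) (\<lambda>(x, y). u x * v y :: real)"
  proof (rule Fubini_integrable)
    show "(\<lambda>(x, y). u x * v y) \<in> borel_measurable (M1 \<Otimes>\<^sub>M M2)" by measurable
    show "integrable M1 (\<lambda>x. LINT y|M2. norm (case (x, y) of (x, y) \<Rightarrow> u x * v y))"
      using u by (simp add: abs_mult)
    show "AE x in M1. integrable M2 (\<lambda>y. case (x, y) of (x, y) \<Rightarrow> u x * v y)" using v by simp
  qed
  have "norm (f x y) \<le> norm (u x * v y)" if "x \<in> space M1" "y \<in> space M2" for x y using le[OF that] by simp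
  then show "AE z in M1 \<Otimes>\<^sub>M M2. norm (case z of (x, y) \<Rightarrow> f x y) \<le> norm (case z of (x, y) \<Rightarrow> u x * v y)"
    by (intro AE_I2) (auto simp: space_pair_measure)
qed (rule f)

text \<open>The integral of \<open>K_\<alpha>(xy) f(x)\<close> over the positive half-line, written for \<open>\<phi>(c) = f(e^c)\<close>.\<close>

definition macdonald_transform :: "real \<Rightarrow> (real \<Rightarrow> complex) \<Rightarrow> real \<Rightarrow> complex" where
  "macdonald_transform \<alpha> \<phi> y = (LINT c|lborel. \<phi> c * of_real (exp c * macK \<alpha> (exp c * y)))"

text \<open>All that is used of the original function, on the logarithmic scale: \<open>mom\<close> is the condition \<open>f*(1-\<alpha>) = 0\<close>.\<close>

locale macdonald_source =
  fixes \<alpha> :: real and \<phi> :: "real \<Rightarrow> complex"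
  assumes al: "0 < \<alpha>" "\<alpha> < 1"
    and cont: "\<And>c. isCont \<phi> c"
    and phi1: "integrable lborel (\<lambda>c. of_real (exp ((1 - \<alpha>) * c)) * \<phi> c)"
    and phi2: "integrable lborel (\<lambda>c. of_real (exp ((1 + \<alpha>) * c)) * \<phi> c)"
    and mom: "(LINT c|lborel. of_real (exp ((1 - \<alpha>) * c)) * \<phi> c) = 0"
begin

lemma phi_measurable [measurable]: "\<phi> \<in> borel_measurable borel"
  using cont by (intro borel_measurable_continuous_onI) (simp add: continuous_at_imp_continuous_on)

definition weight_phi where "weight_phi = (\<lambda>c. exp ((1 - \<alpha>) * c) * norm (\<phi> c))"

lemma weight_phi: "integrable lborel weight_phi"
  using integrable_norm[OF phi1] by (simp add: norm_mult weight_phi_def)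

definition macK_const where "macK_const = 1/2 * Gamma \<alpha> * 2 powr \<alpha>"

lemma macK_const: "macK_const > 0" using al by (simp add: macK_const_def)

lemma macK_bound: "y > 0 \<Longrightarrow> exp c * macK \<alpha> (exp c * y) \<le> macK_const * exp ((1 - \<alpha>) * c) * y powr (- \<alpha>)"
proof -
  assume y: "y > 0"
  have "macK \<alpha> (exp c * y) \<le> macK_const * exp c powr (- \<alpha>) * y powr (- \<alpha>)"
    unfolding macK_const_def using macK_scaled_le[OF al(1), of "exp c" y] y by simp
  from mult_left_mono[OF this, of "exp c"]
  have "exp c * macK \<alpha> (exp c * y) \<le> macK_const * (exp c * exp c powr (- \<alpha>)) * y powr (- \<alpha>)"
    by (simp add: mult_ac)
  also have "exp c * exp c powr (- \<alpha>) = exp ((1 - \<alpha>) * c)"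
    by (simp add: powr_def algebra_simps flip: exp_add)
  finally show ?thesis .
qed

lemma phi_macK_bound: "y > 0 \<Longrightarrow> norm (\<phi> c * of_real (exp c * macK \<alpha> (exp c * y))) \<le> weight_phi c * (macK_const * y powr (- \<alpha>))"
  using mult_left_mono[OF macK_bound[of y c], of "norm (\<phi> c)"] macK_nonneg[of \<alpha> "exp c * y"]
  by (simp add: norm_mult weight_phi_def abs_mult mult_ac)

lemma integrable_phi_macK: "y > 0 \<Longrightarrow> integrable lborel (\<lambda>c. \<phi> c * of_real (exp c * macK \<alpha> (exp c * y)))"
proof (rule Bochner_Integration.integrable_bound)
  assume y: "y > 0"
  show "integrable lborel (\<lambda>c. weight_phi c * (macK_const * y powr (- \<alpha>)))" using weight_phi by simp
  have "norm (\<phi> c * of_real (exp c * macK \<alpha> (exp c * y))) \<le> norm (weight_phi c * (macK_const * y powr (- \<alpha>)))" for c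
    using phi_macK_bound[OF y, of c] by simp
  then show "AE c in lborel. norm (\<phi> c * of_real (exp c * macK \<alpha> (exp c * y))) \<le> norm (weight_phi c * (macK_const * y powr (- \<alpha>)))" by simp
qed measurable

definition line_transform where "line_transform = (\<lambda>b. macdonald_transform \<alpha> \<phi> (2 * cosh b))"

lemma line_transform_measurable [measurable]: "line_transform \<in> borel_measurable borel"
  unfolding line_transform_def macdonald_transform_def by measurable

lemma norm_transform_le: "y > 0 \<Longrightarrow> norm (macdonald_transform \<alpha> \<phi> y) \<le> integral\<^sup>L lborel weight_phi * (macK_const * y powr (- \<alpha>))"
proof -
  assume y: "y > 0"
  have "norm (macdonald_transform \<alpha> \<phi> y) \<le> (LINT c|lborel. norm (\<phi> c * of_real (exp c * macK \<alpha> (exp c * y))))"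
    unfolding macdonald_transform_def by (rule integral_norm_bound)
  also have "\<dots> \<le> (LINT c|lborel. weight_phi c * (macK_const * y powr (- \<alpha>)))"
    by (rule integral_mono[OF integrable_norm[OF integrable_phi_macK[OF y]] _ phi_macK_bound[OF y]]) (use weight_phi in simp)
  finally show ?thesis by simp
qed

text \<open>This makes the transform on the line \<open>y = 2 cosh b\<close> integrable in \<open>b\<close>.\<close>

lemma two_cosh_powr_le: "(2 * cosh b) powr (- \<alpha>) \<le> exp (- \<alpha> * \<bar>b\<bar>)"
proof -
  have "ln (exp \<bar>b\<bar>) \<le> ln (2 * cosh b)"
    using cosh_ge_exp_abs[of b] by (subst ln_le_cancel_iff) auto
  then have "\<alpha> * \<bar>b\<bar> \<le> \<alpha> * ln (2 * cosh b)" using al by (intro mult_left_mono) auto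
  then show ?thesis by (simp add: powr_def)
qed

lemma norm_line_transform_le: "norm (line_transform b) \<le> integral\<^sup>L lborel weight_phi * macK_const * exp (- \<alpha> * \<bar>b\<bar>)"
proof -
  have "norm (line_transform b) \<le> integral\<^sup>L lborel weight_phi * macK_const * (2 * cosh b) powr (- \<alpha>)"
    unfolding line_transform_def using norm_transform_le[of "2 * cosh b"] by simp
  also have "\<dots> \<le> integral\<^sup>L lborel weight_phi * macK_const * exp (- \<alpha> * \<bar>b\<bar>)"
    using macK_const two_cosh_powr_le by (intro mult_left_mono) (auto simp: weight_phi_def intro!: mult_nonneg_nonneg integral_nonneg_AE)
  finally show ?thesis .
qed

lemma line_transform_integrable: "integrable lborel line_transform"
proof (rule Bochner_Integration.integrable_bound)
  show "integrable lborel (\<lambda>b. integral\<^sup>L lborel weight_phi * macK_const * exp (- \<alpha> * \<bar>b\<bar>))"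
    by (intro integrable_mult_right integrable_exp_abs al)
  have "norm (line_transform b) \<le> norm (integral\<^sup>L lborel weight_phi * macK_const * exp (- \<alpha> * \<bar>b\<bar>))" for b
    using norm_line_transform_le[of b] by (simp only: real_norm_def)
  then show "AE b in lborel. norm (line_transform b) \<le> norm (integral\<^sup>L lborel weight_phi * macK_const * exp (- \<alpha> * \<bar>b\<bar>))" by simp
qed simp

lemma macK_continuous: "z0 > 0 \<Longrightarrow> isCont (macK \<alpha>) z0"
proof -
  assume z0: "z0 > 0"
  have "isCont (\<lambda>z. LINT a|lborel. complex_of_real (exp (- z * cosh a + \<alpha> * a))) z0"
  proof (rule isCont_integral_dominated[where r="z0/2" and w="\<lambda>a. exp (- (z0/2) * cosh a + \<alpha> * a)"])
    show "integrable lborel (\<lambda>a. exp (- (z0/2) * cosh a + \<alpha> * a))" by (rule integrable_macK) (use al z0 in auto)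
    show "norm (complex_of_real (exp (- t * cosh x + \<alpha> * x))) \<le> exp (- (z0/2) * cosh x + \<alpha> * x)" if "dist t z0 < z0/2" for t x
    proof -
      have "z0/2 \<le> t" using that unfolding dist_real_def by linarith
      then have "z0/2 * cosh x \<le> t * cosh x" by (intro mult_right_mono) auto
      then show ?thesis by simp
    qed
  qed (use z0 in \<open>auto intro!: continuous_intros\<close>)
  then have "isCont (\<lambda>z. Re (LINT a|lborel. complex_of_real (exp (- z * cosh a + \<alpha> * a)))) z0"
    by (rule isCont_Re)
  then have "isCont (\<lambda>z. 1/2 * (LINT a|lborel. exp (- z * cosh a + \<alpha> * a))) z0"
    unfolding integral_complex_of_real Re_complex_of_real by (intro continuous_intros)
  then show ?thesis unfolding macK_def[abs_def] .
qed

lemma line_transform_continuous: "isCont line_transform b"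
  unfolding line_transform_def macdonald_transform_def
proof (rule isCont_integral_dominated[where r=1 and w="\<lambda>c. weight_phi c * macK_const"])
  show "isCont (\<lambda>t. \<phi> c * of_real (exp c * macK \<alpha> (exp c * (2 * cosh t)))) b" for c
    by (intro continuous_intros isCont_o2[where f="\<lambda>t. exp c * (2 * cosh t)" and g="macK \<alpha>"] macK_continuous) auto
  show "norm (\<phi> c * of_real (exp c * macK \<alpha> (exp c * (2 * cosh t)))) \<le> weight_phi c * macK_const" for t c
  proof -
    have "norm (\<phi> c * of_real (exp c * macK \<alpha> (exp c * (2 * cosh t)))) \<le> weight_phi c * (macK_const * (2 * cosh t) powr (- \<alpha>))"
      by (rule phi_macK_bound) simp
    also have "\<dots> \<le> weight_phi c * (macK_const * exp (- \<alpha> * \<bar>t\<bar>))"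
      using macK_const two_cosh_powr_le[of t] by (intro mult_left_mono) (auto simp: weight_phi_def)
    also have "\<dots> \<le> weight_phi c * (macK_const * 1)"
      using macK_const al by (intro mult_left_mono) (auto simp: weight_phi_def)
    finally show ?thesis by simp
  qed
  show "integrable lborel (\<lambda>c. weight_phi c * macK_const)" using weight_phi by simp
qed simp_all

text \<open>The product formula under the integral sign. The double integral converges absolutely because
\<open>K_\<alpha>(2x cosh b)\<close> is at most a constant times \<open>x^{-\<alpha>} (2 cosh b)^{-\<alpha>}\<close>.\<close>

lemma F_transform_eq:
  "(LINT c|lborel. of_real (exp c) * (of_real ((norm (Macdonald_K ((\<i> * of_real \<tau> + of_real \<alpha>) / 2) (of_real (exp c))))\<^sup>2) * \<phi> c))
   = (LINT b|lborel. exp (\<i> * of_real (\<tau> * b)) * macdonald_transform \<alpha> \<phi> (2 * cosh b))"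
proof -
  define w where "w = (\<lambda>c b. exp (\<i> * of_real (\<tau> * b)) * (\<phi> c * of_real (exp c * macK \<alpha> (exp c * (2 * cosh b)))))"
  have wi: "integrable (lborel \<Otimes>\<^sub>M lborel) (\<lambda>(c, b). w c b)"
  proof (rule lborel_pair.integrable_product_bound[OF _ weight_phi])
    show "(\<lambda>(c, b). w c b) \<in> borel_measurable (lborel \<Otimes>\<^sub>M lborel)" unfolding w_def by measurable
    show "integrable lborel (\<lambda>b. macK_const * exp (- \<alpha> * \<bar>b\<bar>))" by (intro integrable_mult_right integrable_exp_abs al)
    show "norm (w c b) \<le> weight_phi c * (macK_const * exp (- \<alpha> * \<bar>b\<bar>))" for c b
    proof -
      have "norm (w c b) = norm (\<phi> c * of_real (exp c * macK \<alpha> (exp c * (2 * cosh b))))"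
        unfolding w_def norm_mult[of "exp _"] by simp
      also have "\<dots> \<le> weight_phi c * (macK_const * (2 * cosh b) powr (- \<alpha>))" by (rule phi_macK_bound) simp
      also have "\<dots> \<le> weight_phi c * (macK_const * exp (- \<alpha> * \<bar>b\<bar>))"
        using macK_const two_cosh_powr_le[of b] by (intro mult_left_mono) (auto simp: weight_phi_def)
      finally show ?thesis .
    qed
  qed
  have e: "of_real (exp c) * (of_real ((norm (Macdonald_K ((\<i> * of_real \<tau> + of_real \<alpha>) / 2) (of_real (exp c))))\<^sup>2) * \<phi> c) = (LINT b|lborel. w c b)" for c
  proof -
    have "w c b = (of_real (exp c) * \<phi> c) * (exp (\<i> * of_real (\<tau> * b)) * of_real (macK \<alpha> (2 * exp c * cosh b)))" for b
      by (simp add: w_def mult_ac)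
    then have "(LINT b|lborel. w c b) = (of_real (exp c) * \<phi> c) * of_real ((norm (Macdonald_K ((\<i> * of_real \<tau> + of_real \<alpha>) / 2) (of_real (exp c))))\<^sup>2)"
      unfolding norm_Macdonald_K_squared[OF al(1) exp_gt_zero] by (simp only: integral_mult_right_zero)
    then show ?thesis by (simp only: mult_ac)
  qed
  have "(LINT b|lborel. exp (\<i> * of_real (\<tau> * b)) * macdonald_transform \<alpha> \<phi> (2 * cosh b)) = (LINT b|lborel. LINT c|lborel. w c b)"
    unfolding macdonald_transform_def w_def by (simp only: integral_mult_right_zero)
  then show ?thesis unfolding e by (simp only: lborel_pair.Fubini_integral[OF wi])
qed

end

locale macdonald_inversion = macdonald_source +
  fixes F :: "real \<Rightarrow> complex"
  assumes F: "\<And>\<tau>. F \<tau> = (LINT b|lborel. exp (\<i> * of_real (\<tau> * b)) * macdonald_transform \<alpha> \<phi> (2 * cosh b))"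
    and Fi: "integrable lborel (\<lambda>\<tau>. of_real (\<tau> * exp (pi * \<bar>\<tau>\<bar>)) * F \<tau>)"
begin

lemma F_measurable [measurable]: "F \<in> borel_measurable borel"
proof -
  have "F = (\<lambda>\<tau>. LINT b|lborel. exp (\<i> * of_real (\<tau> * b)) * line_transform b)" using F by (auto simp: line_transform_def)
  also have "\<dots> \<in> borel_measurable borel" by measurable
  finally show ?thesis .
qed

definition weight_F where "weight_F = (\<lambda>\<tau>. exp (pi * \<bar>\<tau>\<bar>) * norm (F \<tau>))"

text \<open>The hypothesis controls \<open>F\<close> only away from \<open>\<tau> = 0\<close>; near 0 the transform is bounded as the Fourier transform of an integrable
function.\<close>

lemma weight_F_integrable: "integrable lborel (\<lambda>\<tau>. (1 + \<bar>\<tau>\<bar>) * weight_F \<tau>)"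
proof (rule Bochner_Integration.integrable_bound)
  define B where "B = (LINT b|lborel. norm (line_transform b))"
  have FB: "norm (F \<tau>) \<le> B" for \<tau>
  proof -
    have "F \<tau> = (LINT b|lborel. exp (\<i> * of_real (\<tau> * b)) * line_transform b)" by (simp only: F line_transform_def)
    then have "norm (F \<tau>) \<le> (LINT b|lborel. norm (exp (\<i> * of_real (\<tau> * b)) * line_transform b))"
      by (simp only: integral_norm_bound)
    then show ?thesis by (simp add: norm_mult B_def)
  qed
  define u where "u = (\<lambda>\<tau>. 2 * norm (of_real (\<tau> * exp (pi * \<bar>\<tau>\<bar>)) * F \<tau>) + 2 * exp pi * B * indicator {-1..1} \<tau>)"
  show "integrable lborel u" unfolding u_def
    by (intro Bochner_Integration.integrable_add integrable_mult_right integrable_norm Fi integrable_real_indicator) auto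
  have B0: "B \<ge> 0" by (simp add: B_def)
  have "(1 + \<bar>\<tau>\<bar>) * weight_F \<tau> \<le> u \<tau>" for \<tau>
  proof (cases "\<bar>\<tau>\<bar> \<le> 1")
    case True
    have "weight_F \<tau> \<le> exp pi * B" unfolding weight_F_def using True FB B0 by (intro mult_mono) auto
    then have "(1 + \<bar>\<tau>\<bar>) * weight_F \<tau> \<le> 2 * (exp pi * B)" using True by (intro mult_mono) (auto simp: weight_F_def)
    also have "\<dots> = 2 * exp pi * B * indicator {-1..1} \<tau>" using True by (auto simp: indicator_def)
    also have "\<dots> \<le> u \<tau>" by (simp add: u_def)
    finally show ?thesis .
  next
    case False
    have "(1 + \<bar>\<tau>\<bar>) * weight_F \<tau> \<le> (2 * \<bar>\<tau>\<bar>) * weight_F \<tau>" using False by (intro mult_right_mono) (auto simp: weight_F_def)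
    also have "\<dots> = 2 * norm (of_real (\<tau> * exp (pi * \<bar>\<tau>\<bar>)) * F \<tau>)" by (simp add: weight_F_def norm_mult abs_mult)
    also have "\<dots> \<le> u \<tau>" using B0 by (simp add: u_def)
    finally show ?thesis .
  qed
  then have "norm ((1 + \<bar>\<tau>\<bar>) * weight_F \<tau>) \<le> norm (u \<tau>)" for \<tau>
    by (metis weight_F_def abs_ge_zero add_nonneg_nonneg exp_ge_zero mult_nonneg_nonneg norm_ge_zero abs_of_nonneg order_trans real_norm_def zero_le_one)
  then show "AE \<tau> in lborel. norm ((1 + \<bar>\<tau>\<bar>) * weight_F \<tau>) \<le> norm (u \<tau>)" by simp
qed (simp add: weight_F_def)

lemma F_dominated:
  fixes h :: "real \<Rightarrow> complex"
  assumes "h \<in> borel_measurable borel" and le: "\<And>\<tau>. norm (h \<tau>) \<le> C * (1 + \<bar>\<tau>\<bar>) * exp (pi * \<bar>\<tau>\<bar>)"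
  shows "integrable lborel (\<lambda>\<tau>. F \<tau> * h \<tau>)"
proof (rule Bochner_Integration.integrable_bound)
  show "integrable lborel (\<lambda>\<tau>. C * ((1 + \<bar>\<tau>\<bar>) * weight_F \<tau>))" using weight_F_integrable by simp
  show "(\<lambda>\<tau>. F \<tau> * h \<tau>) \<in> borel_measurable lborel" using assms(1) by measurable
  have "norm (F \<tau> * h \<tau>) \<le> norm (C * ((1 + \<bar>\<tau>\<bar>) * weight_F \<tau>))" for \<tau>
  proof -
    have "norm (F \<tau> * h \<tau>) \<le> norm (F \<tau>) * (C * (1 + \<bar>\<tau>\<bar>) * exp (pi * \<bar>\<tau>\<bar>))"
      unfolding norm_mult by (intro mult_left_mono le) simp
    also have "\<dots> = C * ((1 + \<bar>\<tau>\<bar>) * weight_F \<tau>)" by (simp add: weight_F_def)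
    finally show ?thesis unfolding real_norm_def by linarith
  qed
  then show "AE \<tau> in lborel. norm (F \<tau> * h \<tau>) \<le> norm (C * ((1 + \<bar>\<tau>\<bar>) * weight_F \<tau>))" by simp
qed

lemma F_integrable: "integrable lborel F"
proof -
  have "1 \<le> 1 * (1 + \<bar>\<tau>\<bar>) * exp (pi * \<bar>\<tau>\<bar>)" for \<tau>
    using mult_mono[of 1 "1 + \<bar>\<tau>\<bar>" 1 "exp (pi * \<bar>\<tau>\<bar>)"] by simp
  then show ?thesis using F_dominated[of "\<lambda>_. 1" 1] by simp
qed

lemma transform_eq_fourier: "line_transform b = 1 / (2 * of_real pi) * (LINT \<tau>|lborel. F \<tau> * exp (- \<i> * of_real (\<tau> * b)))"
proof (rule fourier_inversion[OF line_transform_integrable _ line_transform_continuous _ F_integrable])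
  show "norm (line_transform x) \<le> integral\<^sup>L lborel weight_phi * macK_const" for x
  proof -
    have "norm (line_transform x) \<le> integral\<^sup>L lborel weight_phi * macK_const * exp (- \<alpha> * \<bar>x\<bar>)" by (rule norm_line_transform_le)
    also have "\<dots> \<le> integral\<^sup>L lborel weight_phi * macK_const * 1"
      using macK_const al by (intro mult_left_mono) (auto simp: weight_phi_def intro!: mult_nonneg_nonneg integral_nonneg_AE)
    finally show ?thesis by simp
  qed
  show "F t = (LINT x|lborel. exp (\<i> * of_real (t * x)) * line_transform x)" for t by (simp add: F line_transform_def)
qed

end

section \<open>Continuation to imaginary arguments\<close>

context macdonald_inversion
begin

text \<open>Writing the transform at \<open>2 cosh t\<close> as one integral over pairs \<open>(c, a)\<close> makes the integrand explicitly holomorphic in \<open>t\<close>.\<close>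

definition strip_kernel :: "complex \<Rightarrow> real \<times> real \<Rightarrow> complex" where
  "strip_kernel t = (\<lambda>(c, a). \<phi> c * of_real (exp c / 2) * exp (- (of_real (exp c * cosh a) * (2 * cosh t)) + of_real (\<alpha> * a)))"

definition strip :: "complex set" where "strip = {t. \<bar>Im t\<bar> < pi / 2}"

definition strip_majorant :: "real \<Rightarrow> real \<times> real \<Rightarrow> real" where
  "strip_majorant \<delta> = (\<lambda>(c, a). norm (\<phi> c) * (exp c / 2) * exp (- (exp c * \<delta>) * cosh a + \<alpha> * a))"

lemma strip_kernel_measurable [measurable]: "strip_kernel t \<in> borel_measurable (lborel \<Otimes>\<^sub>M lborel)"
  unfolding strip_kernel_def by measurable

lemma strip_kernel_le:
  assumes "\<delta> \<le> Re (2 * cosh t)"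
  shows "norm (strip_kernel t z) \<le> strip_majorant \<delta> z"
proof -
  obtain c a where z: "z = (c, a)" by (cases z)
  have "exp c * cosh a * \<delta> \<le> exp c * cosh a * Re (2 * cosh t)"
    by (intro mult_left_mono assms) auto
  then show ?thesis unfolding z strip_kernel_def strip_majorant_def
    by (simp add: norm_mult mult_left_mono mult_ac)
qed

lemma strip_majorant_integrable:
  assumes d: "\<delta> > 0" shows "integrable (lborel \<Otimes>\<^sub>M lborel) (strip_majorant \<delta>)"
proof (rule lborel_pair.Fubini_integrable)
  show "strip_majorant \<delta> \<in> borel_measurable (lborel \<Otimes>\<^sub>M lborel)" unfolding strip_majorant_def by measurable
  have i: "integrable lborel (\<lambda>a. strip_majorant \<delta> (c, a))" for c
    unfolding strip_majorant_def prod.case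
    by (intro integrable_mult_right integrable_macK al) (use d in simp)
  then show "AE c in lborel. integrable lborel (\<lambda>a. strip_majorant \<delta> (c, a))" by simp
  have "(LINT a|lborel. norm (strip_majorant \<delta> (c, a))) = norm (\<phi> c * of_real (exp c * macK \<alpha> (exp c * \<delta>)))" for c
    using macK_nonneg[of \<alpha> "exp c * \<delta>"]
    by (simp add: strip_majorant_def abs_mult norm_mult) (simp add: macK_def)
  then show "integrable lborel (\<lambda>c. LINT a|lborel. norm (strip_majorant \<delta> (c, a)))"
    using integrable_norm[OF integrable_phi_macK[OF d]] by simp
qed

lemma strip_integral_eq_transform:
  assumes y: "y > 0" and t: "2 * cosh t = of_real y"
  shows "(LINT z|(lborel \<Otimes>\<^sub>M lborel). strip_kernel t z) = macdonald_transform \<alpha> \<phi> y"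
proof -
  have i: "integrable (lborel \<Otimes>\<^sub>M lborel) (strip_kernel t)"
  proof (rule Bochner_Integration.integrable_bound[OF strip_majorant_integrable[OF y]])
    have "norm (strip_kernel t z) \<le> norm (strip_majorant y z)" for z
      using strip_kernel_le[of y t z] t by simp
    then show "AE z in (lborel \<Otimes>\<^sub>M lborel). norm (strip_kernel t z) \<le> norm (strip_majorant y z)" by simp
  qed simp
  have "(LINT z|(lborel \<Otimes>\<^sub>M lborel). strip_kernel t z) = (LINT c|lborel. LINT a|lborel. strip_kernel t (c, a))"
    by (rule lborel_pair.integral_fst'[OF i, symmetric])
  also have "\<dots> = macdonald_transform \<alpha> \<phi> y"
    unfolding macdonald_transform_def
  proof (rule Bochner_Integration.integral_cong[OF refl])
    fix c
    have "strip_kernel t (c, a) = \<phi> c * of_real (exp c / 2) * of_real (exp (- (exp c * y) * cosh a + \<alpha> * a))" for a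
      unfolding strip_kernel_def prod.case t exp_of_real[symmetric] by (simp add: mult_ac)
    then have "(LINT a|lborel. strip_kernel t (c, a)) = \<phi> c * of_real (exp c / 2) * of_real (LINT a|lborel. exp (- (exp c * y) * cosh a + \<alpha> * a))"
      by (simp only: integral_mult_right_zero integral_complex_of_real)
    then show "(LINT a|lborel. strip_kernel t (c, a)) = \<phi> c * of_real (exp c * macK \<alpha> (exp c * y))"
      by (simp add: macK_def)
  qed
  finally show ?thesis .
qed

lemma open_strip: "open strip" and convex_strip: "convex strip"
proof -
  have s: "strip = {t. Im t < pi / 2} \<inter> {t. Im t > - (pi / 2)}" by (auto simp: strip_def abs_less_iff)
  show "open strip" unfolding s by (intro open_Int open_halfspace_Im_lt open_halfspace_Im_gt)
  show "convex strip" unfolding s by (intro convex_Int convex_halfspace_Im_lt convex_halfspace_Im_gt)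
qed

lemma strip_ball:
  assumes z: "z \<in> strip"
  obtains r \<theta> where "r > 0" "0 < \<theta>" "\<theta> < pi / 2" "\<And>t. t \<in> ball z r \<Longrightarrow> \<bar>Im t\<bar> \<le> \<theta>"
proof
  define \<theta> where "\<theta> = (\<bar>Im z\<bar> + pi / 2) / 2"
  show "\<theta> - \<bar>Im z\<bar> > 0" "\<theta> < pi / 2" using z by (auto simp: strip_def \<theta>_def)
  show "0 < \<theta>" unfolding \<theta>_def by (simp add: add_nonneg_pos)
  fix t assume "t \<in> ball z (\<theta> - \<bar>Im z\<bar>)"
  then have "\<bar>Im (t - z)\<bar> < \<theta> - \<bar>Im z\<bar>" using abs_Im_le_cmod[of "t - z"] by (simp add: dist_norm norm_minus_commute)
  then show "\<bar>Im t\<bar> \<le> \<theta>" by simp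
qed

text \<open>\<open>Re cosh t = cosh(Re t) cos(Im t)\<close> is bounded below on every smaller closed strip, which gives a majorant that does not
depend on \<open>t\<close>.\<close>

lemma Re_cosh_ge:
  assumes "\<bar>Im t\<bar> \<le> \<theta>" "\<theta> < pi / 2"
  shows "2 * cos \<theta> \<le> Re (2 * cosh t)"
proof -
  have "cosh t = cos (\<i> * t)" by (simp add: cosh_field_def cos_exp_eq)
  then have "Re (cosh t) = cosh (Re t) * cos (Im t)"
    by (simp add: Re_cos cosh_field_def)
  moreover have "cos \<theta> \<le> cos (Im t)"
    using assms cos_monotone_0_pi_le[of "\<bar>Im t\<bar>" \<theta>] by (simp add: cos_abs_real)
  moreover have "0 \<le> cos \<theta>" using assms by (intro cos_ge_zero) auto
  ultimately have "1 * cos \<theta> \<le> Re (cosh t)" using cosh_real_ge_1[of "Re t"]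
    by (simp only:) (intro mult_mono, auto)
  then show ?thesis by simp
qed

lemma strip_integral_holomorphic: "(\<lambda>t. LINT z|(lborel \<Otimes>\<^sub>M lborel). strip_kernel t z) holomorphic_on strip"
proof (rule holomorphic_on_integral)
  show "(\<lambda>t. strip_kernel t z) holomorphic_on strip" for z
    unfolding strip_kernel_def by (cases z) (auto simp: cosh_field_def intro!: holomorphic_intros)
  fix z assume z: "z \<in> strip"
  obtain r \<theta> where r: "r > 0" and th: "0 < \<theta>" "\<theta> < pi / 2" and b: "\<And>t. t \<in> ball z r \<Longrightarrow> \<bar>Im t\<bar> \<le> \<theta>"
    using strip_ball[OF z] by metis
  have c: "2 * cos \<theta> > 0" using th by (simp add: cos_gt_zero)
  show "\<exists>r>0. \<exists>w. ball z r \<subseteq> strip \<and> integrable (lborel \<Otimes>\<^sub>M lborel) w \<and> (\<forall>z'\<in>ball z r. \<forall>x. norm (strip_kernel z' x) \<le> w x)"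
  proof (intro exI[of _ r] exI[of _ "strip_majorant (2 * cos \<theta>)"] conjI ballI allI r)
    show "ball z r \<subseteq> strip"
    proof
      fix t assume "t \<in> ball z r"
      from b[OF this] th show "t \<in> strip" by (simp add: strip_def)
    qed
    show "integrable (lborel \<Otimes>\<^sub>M lborel) (strip_majorant (2 * cos \<theta>))" by (rule strip_majorant_integrable[OF c])
    show "norm (strip_kernel t x) \<le> strip_majorant (2 * cos \<theta>) x" if "t \<in> ball z r" for t x
      by (rule strip_kernel_le[OF Re_cosh_ge[OF b[OF that] th(2)]])
  qed
qed simp

lemma fourier_integral_holomorphic: "(\<lambda>t. LINT \<tau>|lborel. F \<tau> * exp (- \<i> * (of_real \<tau> * t))) holomorphic_on strip"
proof (rule holomorphic_on_integral)
  show "(\<lambda>t. F \<tau> * exp (- \<i> * (of_real \<tau> * t))) holomorphic_on strip" for \<tau>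
    by (intro holomorphic_intros)
  show "(\<lambda>\<tau>. F \<tau> * exp (- \<i> * (of_real \<tau> * t))) \<in> borel_measurable lborel" for t by measurable
  fix z assume z: "z \<in> strip"
  obtain r \<theta> where r: "r > 0" and th: "0 < \<theta>" "\<theta> < pi / 2" and b: "\<And>t. t \<in> ball z r \<Longrightarrow> \<bar>Im t\<bar> \<le> \<theta>"
    using strip_ball[OF z] by metis
  show "\<exists>r>0. \<exists>w. ball z r \<subseteq> strip \<and> integrable lborel w \<and> (\<forall>z'\<in>ball z r. \<forall>\<tau>. norm (F \<tau> * exp (- \<i> * (of_real \<tau> * z'))) \<le> w \<tau>)"
  proof (intro exI[of _ r] exI[of _ "\<lambda>\<tau>. (1 + \<bar>\<tau>\<bar>) * weight_F \<tau>"] conjI ballI allI r)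
    show "ball z r \<subseteq> strip"
    proof
      fix t assume "t \<in> ball z r"
      from b[OF this] th show "t \<in> strip" by (simp add: strip_def)
    qed
    show "integrable lborel (\<lambda>\<tau>. (1 + \<bar>\<tau>\<bar>) * weight_F \<tau>)" by (rule weight_F_integrable)
    show "norm (F \<tau> * exp (- \<i> * (of_real \<tau> * t))) \<le> (1 + \<bar>\<tau>\<bar>) * weight_F \<tau>" if "t \<in> ball z r" for t \<tau>
    proof -
      have "\<tau> * Im t \<le> \<bar>\<tau>\<bar> * \<bar>Im t\<bar>" by (metis abs_ge_self abs_mult)
      also have "\<dots> \<le> \<bar>\<tau>\<bar> * pi" using b[OF that] th by (intro mult_left_mono) auto
      finally have "norm (F \<tau>) * exp (\<tau> * Im t) \<le> weight_F \<tau>" by (simp add: weight_F_def mult_ac mult_left_mono)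
      also have "weight_F \<tau> \<le> (1 + \<bar>\<tau>\<bar>) * weight_F \<tau>"
        using mult_right_mono[of 1 "1 + \<bar>\<tau>\<bar>" "weight_F \<tau>"] by (simp add: weight_F_def)
      finally show ?thesis by (simp add: norm_mult)
    qed
  qed
qed

text \<open>Both sides are holomorphic in the strip and agree on the real axis by Fourier inversion.\<close>

lemma transform_eq_fourier_strip:
  assumes t: "t \<in> strip"
  shows "(LINT z|(lborel \<Otimes>\<^sub>M lborel). strip_kernel t z) = 1 / (2 * of_real pi) * (LINT \<tau>|lborel. F \<tau> * exp (- \<i> * (of_real \<tau> * t)))"
proof -
  define h where "h = (\<lambda>t. (LINT z|(lborel \<Otimes>\<^sub>M lborel). strip_kernel t z) - 1 / (2 * of_real pi) * (LINT \<tau>|lborel. F \<tau> * exp (- \<i> * (of_real \<tau> * t))))"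
  have "h t = 0"
  proof (rule analytic_continuation[of h strip "\<real>" 0])
    show "h holomorphic_on strip" unfolding h_def
      by (intro holomorphic_intros strip_integral_holomorphic fourier_integral_holomorphic)
    show "connected strip" using convex_strip by (rule convex_connected)
    show "\<real> \<subseteq> strip" by (auto simp: strip_def elim!: Reals_cases)
    show "0 \<in> strip" by (simp add: strip_def)
    show "(0::complex) islimpt \<real>"
      unfolding islimpt_approachable
    proof (intro allI impI)
      fix e :: real assume "e > 0"
      then show "\<exists>x'\<in>\<real>. x' \<noteq> 0 \<and> dist x' (0::complex) < e"
        by (intro bexI[of _ "of_real (e/2)"]) auto
    qed
    show "h z = 0" if zr: "z \<in> \<real>" for z
    proof -
      obtain b where z: "z = of_real b" using zr by (elim Reals_cases)
      have "2 * cosh (complex_of_real b) = of_real (2 * cosh b)" by (simp add: cosh_field_def flip: exp_of_real)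
      then have "(LINT x|(lborel \<Otimes>\<^sub>M lborel). strip_kernel z x) = line_transform b"
        unfolding line_transform_def z by (intro strip_integral_eq_transform) auto
      also have "\<dots> = 1 / (2 * of_real pi) * (LINT \<tau>|lborel. F \<tau> * exp (- \<i> * (of_real \<tau> * z)))"
        unfolding transform_eq_fourier z of_real_mult ..
      finally show ?thesis by (simp add: h_def)
    qed
  qed (use t open_strip in auto)
  then show ?thesis by (simp add: h_def)
qed

lemma transform_cos:
  assumes th: "\<bar>\<theta>\<bar> < pi / 2"
  shows "macdonald_transform \<alpha> \<phi> (2 * cos \<theta>) = 1 / (2 * of_real pi) * (LINT \<tau>|lborel. F \<tau> * of_real (exp (\<tau> * \<theta>)))"
proof -
  have c: "2 * cos \<theta> > 0" using th by (simp add: cos_gt_zero_pi abs_less_iff)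
  have "2 * cosh (\<i> * of_real \<theta>) = of_real (2 * cos \<theta>)"
    by (simp add: cosh_field_def complex_eq_iff Re_exp Im_exp)
  then have "macdonald_transform \<alpha> \<phi> (2 * cos \<theta>) = (LINT z|(lborel \<Otimes>\<^sub>M lborel). strip_kernel (\<i> * of_real \<theta>) z)"
    by (rule strip_integral_eq_transform[OF c, symmetric])
  also have "\<dots> = 1 / (2 * of_real pi) * (LINT \<tau>|lborel. F \<tau> * exp (- \<i> * (of_real \<tau> * (\<i> * of_real \<theta>))))"
    by (rule transform_eq_fourier_strip) (use th in \<open>simp add: strip_def\<close>)
  also have "(\<lambda>\<tau>. F \<tau> * exp (- \<i> * (of_real \<tau> * (\<i> * of_real \<theta>)))) = (\<lambda>\<tau>. F \<tau> * of_real (exp (\<tau> * \<theta>)))"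
    by (auto simp: exp_of_real[symmetric] algebra_simps)
  finally show ?thesis .
qed

text \<open>By the vanishing moment the leading singularity of \<open>K_\<alpha>\<close> may be subtracted under the integral sign.\<close>

lemma transform_small:
  obtains C where "\<And>y. y > 0 \<Longrightarrow> norm (macdonald_transform \<alpha> \<phi> y) \<le> C * y powr \<alpha>"
proof -
  obtain C where C: "\<And>z. z > 0 \<Longrightarrow> \<bar>macK \<alpha> z - 1/2 * Gamma \<alpha> * exp (- \<alpha> * ln (z / 2))\<bar> \<le> C * exp (\<alpha> * ln (z / 2))"
    using macK_small_argument[OF al] by metis
  define A2 where "A2 = (\<lambda>c. exp ((1 + \<alpha>) * c) * norm (\<phi> c))"
  have A2: "integrable lborel A2" using integrable_norm[OF phi2] by (simp add: norm_mult A2_def)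
  have "norm (macdonald_transform \<alpha> \<phi> y) \<le> (C * 2 powr (- \<alpha>) * integral\<^sup>L lborel A2) * y powr \<alpha>" if y: "y > 0" for y
  proof -
    define K where "K = 1/2 * Gamma \<alpha> * exp (- \<alpha> * ln (y / 2))"
    define J where "J = (\<lambda>c. 1/2 * Gamma \<alpha> * exp (- \<alpha> * ln (exp c * y / 2)))"
    have e: "\<phi> c * of_real (exp c * J c) = of_real K * (of_real (exp ((1 - \<alpha>) * c)) * \<phi> c)" for c
    proof -
      have "ln (exp c * y / 2) = c + ln (y / 2)" using y by (simp add: ln_mult ln_div)
      then have "exp c * J c = K * exp ((1 - \<alpha>) * c)"
      proof -
        have 1: "exp (- \<alpha> * (c + ln (y / 2))) = exp (- \<alpha> * ln (y / 2)) * exp (- \<alpha> * c)"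
          unfolding exp_add[symmetric] by (simp add: algebra_simps)
        have 2: "exp ((1 - \<alpha>) * c) = exp c * exp (- \<alpha> * c)"
          unfolding exp_add[symmetric] by (simp add: algebra_simps)
        show ?thesis unfolding K_def J_def \<open>ln (exp c * y / 2) = c + ln (y / 2)\<close> 1 2
          by (simp only: mult_ac)
      qed
      then show ?thesis by (simp only: of_real_mult[symmetric] mult.assoc[symmetric]) (simp only: mult.commute)
    qed
    have k0: "integrable lborel (\<lambda>c. \<phi> c * of_real (exp c * J c))"
      unfolding e using phi1 by (rule integrable_mult_right)
    have "(LINT c|lborel. \<phi> c * of_real (exp c * J c)) = 0"
      unfolding e integral_mult_right_zero mom by simp
    then have eq: "macdonald_transform \<alpha> \<phi> y = (LINT c|lborel. \<phi> c * of_real (exp c * macK \<alpha> (exp c * y)) - \<phi> c * of_real (exp c * J c))"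
      unfolding macdonald_transform_def using integrable_phi_macK[OF y] k0 by simp
    have "norm (macdonald_transform \<alpha> \<phi> y) \<le> (LINT c|lborel. norm (\<phi> c * of_real (exp c * macK \<alpha> (exp c * y)) - \<phi> c * of_real (exp c * J c)))"
      unfolding eq by (rule integral_norm_bound)
    also have "\<dots> \<le> (LINT c|lborel. (C * 2 powr (- \<alpha>) * y powr \<alpha>) * A2 c)"
    proof (rule integral_mono)
      show "integrable lborel (\<lambda>c. norm (\<phi> c * of_real (exp c * macK \<alpha> (exp c * y)) - \<phi> c * of_real (exp c * J c)))"
        by (intro integrable_norm Bochner_Integration.integrable_diff integrable_phi_macK y k0)
      show "integrable lborel (\<lambda>c. (C * 2 powr (- \<alpha>) * y powr \<alpha>) * A2 c)" using A2 by simp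
      fix c
      define X where "X = macK \<alpha> (exp c * y) - J c"
      have "\<phi> c * of_real (exp c * macK \<alpha> (exp c * y)) - \<phi> c * of_real (exp c * J c) = \<phi> c * of_real (exp c * X)"
        unfolding X_def right_diff_distrib of_real_diff by simp
      then have "norm (\<phi> c * of_real (exp c * macK \<alpha> (exp c * y)) - \<phi> c * of_real (exp c * J c)) = norm (\<phi> c) * exp c * \<bar>X\<bar>"
        by (simp only: norm_mult norm_of_real abs_mult) simp
      also have "\<dots> \<le> norm (\<phi> c) * exp c * (C * exp (\<alpha> * ln (exp c * y / 2)))"
        unfolding X_def J_def by (intro mult_left_mono C) (use y in auto)
      also have "exp (\<alpha> * ln (exp c * y / 2)) = exp (\<alpha> * c) * (2 powr (- \<alpha>) * y powr \<alpha>)"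
      proof -
        have "\<alpha> * ln (exp c * y / 2) = \<alpha> * c + (- \<alpha> * ln 2 + \<alpha> * ln y)"
          using y by (simp add: ln_mult ln_div algebra_simps)
        then show ?thesis using y by (simp only: exp_add) (simp add: powr_def)
      qed
      also have "norm (\<phi> c) * exp c * (C * (exp (\<alpha> * c) * (2 powr (- \<alpha>) * y powr \<alpha>))) = (C * 2 powr (- \<alpha>) * y powr \<alpha>) * A2 c"
      proof -
        have "exp ((1 + \<alpha>) * c) = exp c * exp (\<alpha> * c)" unfolding exp_add[symmetric] by (simp add: algebra_simps)
        then show ?thesis by (simp add: A2_def)
      qed
      finally show "norm (\<phi> c * of_real (exp c * macK \<alpha> (exp c * y)) - \<phi> c * of_real (exp c * J c)) \<le> (C * 2 powr (- \<alpha>) * y powr \<alpha>) * A2 c" .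
    qed
    also have "\<dots> = (C * 2 powr (- \<alpha>) * integral\<^sup>L lborel A2) * y powr \<alpha>" by simp
    finally show ?thesis .
  qed
  then show ?thesis by (rule that)
qed

lemma exp_pi_half_le: "exp (\<tau> * \<theta>) \<le> 1 * (1 + \<bar>\<tau>\<bar>) * exp (pi * \<bar>\<tau>\<bar>)" if "\<bar>\<theta>\<bar> \<le> pi"
proof -
  have "\<tau> * \<theta> \<le> \<bar>\<tau>\<bar> * \<bar>\<theta>\<bar>" by (metis abs_ge_self abs_mult)
  also have "\<dots> \<le> \<bar>\<tau>\<bar> * pi" using that by (intro mult_left_mono) auto
  finally have "exp (\<tau> * \<theta>) \<le> exp (pi * \<bar>\<tau>\<bar>)" by (simp add: mult_ac)
  also have "\<dots> \<le> (1 + \<bar>\<tau>\<bar>) * exp (pi * \<bar>\<tau>\<bar>)" by simp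
  finally show ?thesis by simp
qed

text \<open>Let \<open>\<theta>\<close> tend to \<open>\<pi>/2\<close> or \<open>-\<pi>/2\<close>, according to the sign \<open>s\<close>. Then \<open>2 cos \<theta>\<close> tends to 0, where the transform vanishes, while
dominated convergence applies to the Fourier side.\<close>

lemma exp_moment_zero:
  assumes s: "s = 1 \<or> s = (-1::real)"
  shows "(LINT \<tau>|lborel. F \<tau> * of_real (exp (\<tau> * (s * (pi / 2))))) = 0"
proof -
  define th where "th = (\<lambda>n::nat. s * (pi / 2 - 1 / real (Suc n)))"
  have th1: "\<bar>th n\<bar> < pi / 2" for n
  proof -
    have "1 / real (Suc n) \<le> 1" by simp
    moreover have "1 / real (Suc n) > 0" by simp
    ultimately have "\<bar>pi / 2 - 1 / real (Suc n)\<bar> < pi / 2" using pi_gt3 by linarith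
    moreover have "\<bar>s\<bar> = 1" using s by auto
    ultimately show ?thesis unfolding th_def abs_mult by simp
  qed
  have lim: "th \<longlonglongrightarrow> s * (pi / 2 - 0)"
    unfolding th_def by (intro tendsto_intros LIMSEQ_Suc[OF lim_1_over_n])
  have c1: "(\<lambda>n. 2 * cos (th n)) \<longlonglongrightarrow> 2 * cos (s * (pi / 2 - 0))"
    by (intro tendsto_intros lim)
  have c0: "2 * cos (s * (pi / 2 - 0)) = 0" using s by auto
  obtain C where C: "\<And>y. y > 0 \<Longrightarrow> norm (macdonald_transform \<alpha> \<phi> y) \<le> C * y powr \<alpha>"
    using transform_small by metis
  have pos: "2 * cos (th n) > 0" for n using th1[of n] by (simp add: cos_gt_zero_pi abs_less_iff)
  have "(\<lambda>n. C * (2 * cos (th n)) powr \<alpha>) \<longlonglongrightarrow> C * 0 powr \<alpha>"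
  proof (intro tendsto_mult tendsto_const tendsto_powr'[OF c1[unfolded c0]] disjI2 conjI)
    show "\<forall>\<^sub>F n in sequentially. 0 \<le> 2 * cos (th n)"
      using pos by (intro always_eventually allI) (simp add: less_imp_le)
  qed (use al in auto)
  then have C0: "(\<lambda>n. C * (2 * cos (th n)) powr \<alpha>) \<longlonglongrightarrow> 0" by simp
  have l0: "(\<lambda>n. macdonald_transform \<alpha> \<phi> (2 * cos (th n))) \<longlonglongrightarrow> 0"
    by (rule Lim_null_comparison[OF always_eventually C0]) (rule allI, rule C, rule pos)
  have l1: "(\<lambda>n. LINT \<tau>|lborel. F \<tau> * of_real (exp (\<tau> * th n))) \<longlonglongrightarrow> (LINT \<tau>|lborel. F \<tau> * of_real (exp (\<tau> * (s * (pi / 2)))))"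
  proof (rule integral_dominated_convergence[where w="\<lambda>\<tau>. (1 + \<bar>\<tau>\<bar>) * weight_F \<tau>"])
    show "AE \<tau> in lborel. (\<lambda>n. F \<tau> * of_real (exp (\<tau> * th n))) \<longlonglongrightarrow> F \<tau> * of_real (exp (\<tau> * (s * (pi / 2))))"
      using lim by (intro AE_I2 tendsto_intros) auto
    show "integrable lborel (\<lambda>\<tau>. (1 + \<bar>\<tau>\<bar>) * weight_F \<tau>)" by (rule weight_F_integrable)
    show "AE \<tau> in lborel. norm (F \<tau> * of_real (exp (\<tau> * th n))) \<le> (1 + \<bar>\<tau>\<bar>) * weight_F \<tau>" for n
    proof (rule AE_I2)
      fix \<tau>
      have "\<bar>th n\<bar> \<le> pi" using th1[of n] pi_gt_zero by linarith
      from mult_left_mono[OF exp_pi_half_le[OF this, of \<tau>] norm_ge_zero[of "F \<tau>"]]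
      show "norm (F \<tau> * of_real (exp (\<tau> * th n))) \<le> (1 + \<bar>\<tau>\<bar>) * weight_F \<tau>"
        by (simp add: norm_mult weight_F_def mult_ac)
    qed
  qed measurable
  have "(\<lambda>n. 1 / (2 * of_real pi) * (LINT \<tau>|lborel. F \<tau> * of_real (exp (\<tau> * th n)))) \<longlonglongrightarrow> 1 / (2 * of_real pi) * (LINT \<tau>|lborel. F \<tau> * of_real (exp (\<tau> * (s * (pi / 2)))))"
    by (intro tendsto_mult tendsto_const l1)
  then have "(\<lambda>n. macdonald_transform \<alpha> \<phi> (2 * cos (th n))) \<longlonglongrightarrow> 1 / (2 * of_real pi) * (LINT \<tau>|lborel. F \<tau> * of_real (exp (\<tau> * (s * (pi / 2)))))"
    using transform_cos[OF th1] by simp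
  from LIMSEQ_unique[OF this l0] show ?thesis by simp
qed

lemma cosh_moment_zero:
  shows "integrable lborel (\<lambda>\<tau>. F \<tau> * of_real (cosh (pi * \<tau> / 2)))"
    and "(LINT \<tau>|lborel. F \<tau> * of_real (cosh (pi * \<tau> / 2))) = 0"
proof -
  have i: "integrable lborel (\<lambda>\<tau>. F \<tau> * of_real (exp (\<tau> * (s * (pi / 2)))))" if "s = 1 \<or> s = -1" for s :: real
  proof (rule F_dominated)
    show "norm (complex_of_real (exp (\<tau> * (s * (pi / 2))))) \<le> 1 * (1 + \<bar>\<tau>\<bar>) * exp (pi * \<bar>\<tau>\<bar>)" for \<tau>
      using exp_pi_half_le[of "s * (pi/2)" \<tau>] that by auto
  qed measurable
  have e: "F \<tau> * of_real (cosh (pi * \<tau> / 2)) = (F \<tau> * of_real (exp (\<tau> * (1 * (pi / 2)))) + F \<tau> * of_real (exp (\<tau> * (-1 * (pi / 2))))) / 2" for \<tau>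
    by (simp add: cosh_field_def field_simps)
  show "integrable lborel (\<lambda>\<tau>. F \<tau> * of_real (cosh (pi * \<tau> / 2)))"
    unfolding e by (intro Bochner_Integration.integrable_divide Bochner_Integration.integrable_add i) auto
  show "(LINT \<tau>|lborel. F \<tau> * of_real (cosh (pi * \<tau> / 2))) = 0"
    unfolding e integral_divide_zero using i[of 1] i[of "-1"] exp_moment_zero[of 1] exp_moment_zero[of "-1"]
    by (subst Bochner_Integration.integral_add) auto
qed

end

section \<open>Integrals of series\<close>

text \<open>Series of integrals over the line are treated as integrals over the product with the counting measure, so that
a single application of Fubini's theorem exchanges the sum, the integral over \<open>\<tau>\<close> and a further integral.\<close>

abbreviation nat_line :: "(real \<times> nat) measure" where
  "nat_line \<equiv> lborel \<Otimes>\<^sub>M count_space UNIV"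

lemma sigma_finite_nat: "sigma_finite_measure (count_space (UNIV :: nat set))"
  by (rule sigma_finite_measure_count_space)

interpretation nat_line: pair_sigma_finite lborel "count_space (UNIV :: nat set)"
  by (intro pair_sigma_finite.intro sigma_finite_nat sigma_finite_lborel)

interpretation nat_line_real: pair_sigma_finite nat_line lborel
  by (intro pair_sigma_finite.intro sigma_finite_lborel) (rule nat_line.sigma_finite_measure_axioms)

lemma borel_measurable_nat_line:
  assumes "\<And>n. (\<lambda>x. f x n) \<in> borel_measurable M"
  shows "(\<lambda>(x, n). f x n) \<in> borel_measurable (M \<Otimes>\<^sub>M count_space (UNIV :: nat set))"
proof -
  have "(\<lambda>z. (\<lambda>n z. f (fst z) n) (snd z) z) \<in> borel_measurable (M \<Otimes>\<^sub>M count_space (UNIV :: nat set))"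
    by (rule measurable_compose_countable'[where I=UNIV]) (use assms in auto)
  then show ?thesis by (simp add: case_prod_beta')
qed

lemma nat_line_integral:
  fixes f :: "real \<Rightarrow> nat \<Rightarrow> complex"
  assumes f: "\<And>n. (\<lambda>x. f x n) \<in> borel_measurable borel"
    and u: "integrable lborel u" and v: "summable v"
    and le: "\<And>x n. norm (f x n) \<le> u x * v n" and v0: "\<And>n. 0 \<le> v n"
  shows "integrable nat_line (\<lambda>(x, n). f x n)"
    and "(LINT z|nat_line. f (fst z) (snd z)) = (LINT x|lborel. (\<Sum>n. f x n))"
    and "integrable lborel (\<lambda>x. \<Sum>n. f x n)"
proof -
  show i: "integrable nat_line (\<lambda>(x, n). f x n)"
  proof (rule nat_line.integrable_product_bound[OF _ u])
    show "(\<lambda>(x, n). f x n) \<in> borel_measurable nat_line" using f by (intro borel_measurable_nat_line) simp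
    show "integrable (count_space UNIV) v" using v v0 by (simp add: integrable_count_space_nat_iff)
  qed (rule le)
  have s: "summable (\<lambda>n. norm (f x n))" for x
    by (rule summable_comparison_test'[OF summable_mult[OF v, of "u x"]]) (use le in auto)
  have e: "(LINT n|count_space UNIV. f x n) = (\<Sum>n. f x n)" for x
    by (rule integral_count_space_nat) (simp add: integrable_count_space_nat_iff s)
  have "(LINT z|nat_line. f (fst z) (snd z)) = (LINT x|lborel. LINT n|count_space UNIV. f x n)"
    using nat_line.integral_fst'[OF i] by (simp add: case_prod_beta')
  then show "(LINT z|nat_line. f (fst z) (snd z)) = (LINT x|lborel. (\<Sum>n. f x n))" by (simp only: e)
  show "integrable lborel (\<lambda>x. \<Sum>n. f x n)"
    using nat_line.integrable_fst'[OF i] by (simp add: e)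
qed

lemma nat_line_integrable_product:
  fixes u :: "real \<Rightarrow> real" and v :: "nat \<Rightarrow> real"
  assumes u: "integrable lborel u" and v: "summable v" and u0: "\<And>x. 0 \<le> u x" and v0: "\<And>n. 0 \<le> v n"
  shows "integrable nat_line (\<lambda>z. u (fst z) * v (snd z))"
proof -
  have "integrable nat_line (\<lambda>(x, n). complex_of_real (u x * v n))"
  proof (rule nat_line_integral(1)[OF _ u v _ v0])
    show "norm (complex_of_real (u x * v n)) \<le> u x * v n" for x n
      using u0[of x] v0[of n] by (simp only: norm_of_real) simp
  qed (use u in measurable)
  then show ?thesis unfolding case_prod_beta' complex_of_real_integrable_eq .
qed

lemma nat_line_Fubini:
  fixes f :: "real \<Rightarrow> nat \<Rightarrow> real \<Rightarrow> complex"
  assumes f: "\<And>n. (\<lambda>(x, a). f x n a) \<in> borel_measurable (borel \<Otimes>\<^sub>M borel)"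
    and fi: "\<And>x n. integrable lborel (f x n)"
    and u: "integrable lborel u" and v: "summable v"
    and le: "\<And>x n. (LINT a|lborel. norm (f x n a)) \<le> u x * v n" and v0: "\<And>n. 0 \<le> v n"
  shows "integrable lborel (\<lambda>a. LINT z|nat_line. f (fst z) (snd z) a)"
    and "(LINT a|lborel. LINT z|nat_line. f (fst z) (snd z) a) = (LINT z|nat_line. LINT a|lborel. f (fst z) (snd z) a)"
proof -
  have m: "(\<lambda>(z, a). f (fst z) (snd z) a) \<in> borel_measurable (nat_line \<Otimes>\<^sub>M lborel)"
  proof -
    have "(\<lambda>w. (\<lambda>n w. f (fst (fst w)) n (snd w)) ((\<lambda>w. snd (fst w)) w) w) \<in> borel_measurable (nat_line \<Otimes>\<^sub>M lborel)"
    proof (rule measurable_compose_countable'[where I=UNIV and f="\<lambda>n w. f (fst (fst w)) n (snd w)" and g="\<lambda>w. snd (fst w)"])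
      fix n
      have "(\<lambda>w. (fst (fst w), snd w)) \<in> measurable (nat_line \<Otimes>\<^sub>M lborel) (borel \<Otimes>\<^sub>M borel)" by measurable
      from measurable_compose[OF this f[of n]]
      show "(\<lambda>w. f (fst (fst w)) n (snd w)) \<in> borel_measurable (nat_line \<Otimes>\<^sub>M lborel)" by simp
    qed auto
    then show ?thesis by (simp add: case_prod_beta')
  qed
  have "integrable nat_line (\<lambda>(x, n). complex_of_real (LINT a|lborel. norm (f x n a)))"
  proof (rule nat_line_integral(1)[OF _ u v])
    show "(\<lambda>x. complex_of_real (LINT a|lborel. norm (f x n a))) \<in> borel_measurable borel" for n
    proof -
      have [measurable]: "(\<lambda>z. f (fst z) n (snd z)) \<in> borel_measurable (borel \<Otimes>\<^sub>M borel)"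
        using f[of n] by (simp add: case_prod_beta')
      have "(\<lambda>z. norm (f (fst z) n (snd z))) \<in> borel_measurable (borel \<Otimes>\<^sub>M lborel)"
        by measurable
      then have "(\<lambda>(x, a). norm (f x n a)) \<in> borel_measurable (borel \<Otimes>\<^sub>M lborel)"
        by (simp add: case_prod_beta')
      then have "(\<lambda>x. LINT a|lborel. norm (f x n a)) \<in> borel_measurable borel"
        by (rule lborel.borel_measurable_lebesgue_integral)
      then show ?thesis by measurable
    qed
  qed (use le v0 in auto)
  then have ni: "integrable nat_line (\<lambda>z. LINT a|lborel. norm (f (fst z) (snd z) a))"
    by (simp add: case_prod_beta' complex_of_real_integrable_eq)
  have i: "integrable (nat_line \<Otimes>\<^sub>M lborel) (\<lambda>(z, a). f (fst z) (snd z) a)"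
    by (rule nat_line_real.Fubini_integrable[OF m]) (use ni fi in auto)
  show "integrable lborel (\<lambda>a. LINT z|nat_line. f (fst z) (snd z) a)"
    by (rule nat_line_real.integrable_snd[OF i])
  show "(LINT a|lborel. LINT z|nat_line. f (fst z) (snd z) a) = (LINT z|nat_line. LINT a|lborel. f (fst z) (snd z) a)"
    by (rule nat_line_real.Fubini_integral[OF i])
qed

lemma summable_power_over_Gamma:
  assumes "\<beta> > (0::real)" "x \<ge> 0"
  shows "summable (\<lambda>n. x ^ n / Gamma (\<beta> + of_nat n))"
proof -
  obtain N :: nat where N: "2 * x \<le> real N" using real_arch_simple by blast
  show ?thesis
  proof (rule summable_ratio_test[of "1/2" N])
    fix n assume n: "N \<le> n"
    have b: "\<beta> + real n > 0" using assms by (simp add: add_pos_nonneg)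
    then have G: "Gamma (\<beta> + real (Suc n)) = (\<beta> + real n) * Gamma (\<beta> + real n)"
      using Gamma_plus1[of "\<beta> + real n"] by (simp add: add_ac nonpos_Ints_def)
    have Gp: "Gamma (\<beta> + real n) > 0" using b by simp
    have "2 * x \<le> \<beta> + real n" using N n assms by linarith
    then have "x / (\<beta> + real n) \<le> 1/2" using b by (simp add: field_simps)
    then have "x / (\<beta> + real n) * (x ^ n / Gamma (\<beta> + real n)) \<le> 1/2 * (x ^ n / Gamma (\<beta> + real n))"
      using assms Gp by (intro mult_right_mono) auto
    then show "norm (x ^ Suc n / Gamma (\<beta> + real (Suc n))) \<le> 1/2 * norm (x ^ n / Gamma (\<beta> + real n))"
      unfolding G using b Gp assms by (simp add: abs_mult)
  qed simp
qed

lemma borel_measurable_rGamma [measurable]: "(rGamma :: complex \<Rightarrow> complex) \<in> borel_measurable borel"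
  by (intro borel_measurable_continuous_onI continuous_on_rGamma)

lemma borel_measurable_catalan_coeff [measurable]: "(\<lambda>x. catalan_coeff (\<i> * of_real x) n) \<in> borel_measurable borel"
  unfolding catalan_coeff_def pochhammer_prod by measurable

text \<open>The growth of the coefficients, \<open>2^{|\<tau>|}\<close>, and that of the reciprocal Gamma functions fit together into the weight
\<open>e^{\<pi>|\<tau>|}\<close>, since \<open>ln 2 + \<pi>/2 < \<pi>\<close>.\<close>

lemma exp_ln2_cosh_le: "exp (\<bar>\<tau>\<bar> * ln 2) * cosh (pi * \<tau> / 2) \<le> exp (pi * \<bar>\<tau>\<bar>)"
proof -
  have "cosh (pi * \<tau> / 2) \<le> exp (\<bar>\<tau>\<bar> * (pi / 2))"
    by (cases "\<tau> \<ge> 0") (auto simp: cosh_field_def mult_ac mult_nonneg_nonpos mult_nonneg_nonneg)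
  then have "exp (\<bar>\<tau>\<bar> * ln 2) * cosh (pi * \<tau> / 2) \<le> exp (\<bar>\<tau>\<bar> * ln 2) * exp (\<bar>\<tau>\<bar> * (pi / 2))" by simp
  also have "\<dots> = exp (\<bar>\<tau>\<bar> * (ln 2 + pi / 2))" by (simp add: ring_distribs exp_add)
  also have "\<dots> \<le> exp (\<bar>\<tau>\<bar> * pi)"
  proof -
    have "ln 2 \<le> (2::real) - 1" by (rule ln_le_minus_one) simp
    then have "ln 2 + pi / 2 \<le> pi" using pi_gt3 by linarith
    then show ?thesis by (simp add: mult_left_mono)
  qed
  finally show ?thesis by (simp add: mult.commute)
qed

context macdonald_inversion
begin

section \<open>The inner Laplace transform\<close>

text \<open>The power of \<open>y^2\<close> in the \<open>n\<close>-th term of \<open>y^{-\<alpha>} e^{-i\<tau>t}\<close>, with the opposite sign, where \<open>y = 2 cosh t\<close>.\<close>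

definition exponent :: "real \<Rightarrow> nat \<Rightarrow> complex" where "exponent \<tau> n = (\<i> * of_real \<tau> + of_real \<alpha>) / 2 + of_nat n"

lemma Re_exponent: "Re (exponent \<tau> n) = \<alpha> / 2 + n" by (simp add: exponent_def)

lemma exponent_measurable [measurable]: "(\<lambda>\<tau>. exponent \<tau> n) \<in> borel_measurable borel"
  unfolding exponent_def by measurable

text \<open>Inverting the Laplace transform of a power divides by the Gamma function of the exponent. The factor
\<open>2^{-s}\<close> arises because the transform is taken at \<open>y^2/2\<close>.\<close>

definition coeff1 :: "real \<Rightarrow> nat \<Rightarrow> complex" where
  "coeff1 \<tau> n = F \<tau> * (catalan_coeff (\<i> * of_real \<tau>) n * exp (- exponent \<tau> n * of_real (ln 2)) * rGamma (exponent \<tau> n))"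

lemma coeff1_measurable [measurable]: "(\<lambda>\<tau>. coeff1 \<tau> n) \<in> borel_measurable borel"
  unfolding coeff1_def by measurable

definition coeff1_const :: real where "coeff1_const = exp (- (\<alpha> / 2) * ln 2) * Gamma (1 - \<alpha> / 2) / pi * Gamma (\<alpha> / 2)"

lemma coeff1_const: "coeff1_const \<ge> 0" using al by (simp add: coeff1_const_def)

lemma norm_coeff1_le: "norm (coeff1 \<tau> n) \<le> (coeff1_const * weight_F \<tau>) * ((5/2) ^ n / Gamma (\<alpha> / 2 + n))"
proof -
  have r: "norm (rGamma (exponent \<tau> n)) \<le> Gamma (1 - \<alpha> / 2) / pi * cosh (pi * \<tau> / 2) * (Gamma (\<alpha> / 2) / Gamma (\<alpha> / 2 + n))"
  proof -
    define z where "z = (\<i> * of_real \<tau> + of_real \<alpha>) / 2"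
    have z: "Re z = \<alpha> / 2" "Im z = \<tau> / 2" by (simp_all add: z_def)
    have "norm (rGamma (exponent \<tau> n)) \<le> norm (rGamma z) * (Gamma (\<alpha> / 2) / Gamma (\<alpha> / 2 + n))"
      using norm_rGamma_shift[of z n] al by (simp add: z exponent_def z_def[symmetric])
    also have "\<dots> \<le> (Gamma (1 - \<alpha> / 2) / pi * cosh (pi * \<tau> / 2)) * (Gamma (\<alpha> / 2) / Gamma (\<alpha> / 2 + n))"
      using norm_rGamma_le[of z] al by (intro mult_right_mono) (auto simp: z)
    finally show ?thesis .
  qed
  have e: "norm (exp (- exponent \<tau> n * of_real (ln 2))) = exp (- (\<alpha> / 2) * ln 2) * (1/2) ^ n"
  proof -
    have "norm (exp (- exponent \<tau> n * of_real (ln 2))) = exp (- (\<alpha> / 2) * ln 2 + real n * (- ln 2))"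
      by (simp add: Re_exponent algebra_simps)
    also have "\<dots> = exp (- (\<alpha> / 2) * ln 2) * (1/2) ^ n"
      unfolding exp_add exp_of_nat_mult by (simp add: exp_minus)
    finally show ?thesis .
  qed
  have "norm (coeff1 \<tau> n) = norm (F \<tau>) * (norm (catalan_coeff (\<i> * of_real \<tau>) n) * (exp (- (\<alpha> / 2) * ln 2) * (1/2) ^ n) * norm (rGamma (exponent \<tau> n)))"
    unfolding coeff1_def norm_mult e ..
  also have "\<dots> \<le> norm (F \<tau>) * ((exp (\<bar>\<tau>\<bar> * ln 2) * 5 ^ n) * (exp (- (\<alpha> / 2) * ln 2) * (1/2) ^ n) * (Gamma (1 - \<alpha> / 2) / pi * cosh (pi * \<tau> / 2) * (Gamma (\<alpha> / 2) / Gamma (\<alpha> / 2 + n))))"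
    by (intro mult_left_mono mult_mono r norm_catalan_coeff_le) auto
  also have "\<dots> = (norm (F \<tau>) * (exp (\<bar>\<tau>\<bar> * ln 2) * cosh (pi * \<tau> / 2)) * coeff1_const) * ((5 * (1/2)) ^ n / Gamma (\<alpha> / 2 + n))"
    unfolding power_mult_distrib coeff1_const_def by simp
  also have "\<dots> \<le> (norm (F \<tau>) * exp (pi * \<bar>\<tau>\<bar>) * coeff1_const) * ((5 * (1/2)) ^ n / Gamma (\<alpha> / 2 + n))"
    using al coeff1_const exp_ln2_cosh_le by (intro mult_right_mono mult_left_mono) (auto intro!: divide_nonneg_nonneg less_imp_le Gamma_real_pos add_pos_nonneg)
  also have "\<dots> = (coeff1_const * weight_F \<tau>) * ((5/2) ^ n / Gamma (\<alpha> / 2 + n))" by (simp add: weight_F_def)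
  finally show ?thesis .
qed

lemma weight_F_integrable0: "integrable lborel weight_F"
proof (rule Bochner_Integration.integrable_bound[OF weight_F_integrable])
  show "weight_F \<in> borel_measurable lborel" unfolding weight_F_def by measurable
  have "norm (weight_F \<tau>) \<le> norm ((1 + \<bar>\<tau>\<bar>) * weight_F \<tau>)" for \<tau>
    using mult_right_mono[of 1 "1 + \<bar>\<tau>\<bar>" "weight_F \<tau>"] by (simp add: weight_F_def)
  then show "AE \<tau> in lborel. norm (weight_F \<tau>) \<le> norm ((1 + \<bar>\<tau>\<bar>) * weight_F \<tau>)" by simp
qed

text \<open>\<open>\<Phi>(r)\<close> is the integral of \<open>e^{-r x^2} x^{-\<alpha>} f(x)\<close> over the positive half-line, a Laplace transform in the variable \<open>x^2\<close>.\<close>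

definition \<Phi> :: "real \<Rightarrow> complex" where
  "\<Phi> r = (LINT c|lborel. of_real (exp ((1 - \<alpha>) * c)) * \<phi> c * of_real (exp (- r * exp (2 * c))))"

lemma Phi_integrable: "r \<ge> 0 \<Longrightarrow> integrable lborel (\<lambda>c. of_real (exp ((1 - \<alpha>) * c)) * \<phi> c * of_real (exp (- r * exp (2 * c))))"
  by (rule Bochner_Integration.integrable_bound[OF phi1]) (auto simp: norm_mult mult_left_le intro!: AE_I2)

text \<open>The function whose Laplace transform at \<open>y^2/2\<close> is \<open>y^{-\<alpha>}\<close> times the Macdonald transform, in the variable \<open>a = ln w\<close>.\<close>

definition stage1 where "stage1 a = of_real (1/2 * exp (\<alpha> * a)) * \<Phi> (exp (- a) / 2)"

definition series1 where "series1 a = (LINT z|nat_line. coeff1 (fst z) (snd z) * exp (exponent (fst z) (snd z) * of_real a))"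

lemma stage1_cont: "isCont stage1 a"
proof -
  have "isCont (\<lambda>a. \<Phi> (exp (- a) / 2)) a"
    unfolding \<Phi>_def
  proof (rule isCont_integral_dominated[where r=1 and w=weight_phi])
    show "norm (of_real (exp ((1 - \<alpha>) * c)) * \<phi> c * of_real (exp (- (exp (- t) / 2) * exp (2 * c)))) \<le> weight_phi c" for t c
      by (simp add: norm_mult weight_phi_def mult_left_le)
  qed (use weight_phi in \<open>auto intro!: continuous_intros\<close>)
  then show ?thesis unfolding stage1_def by (intro continuous_intros)
qed

lemma summable_series1_bound: "summable (\<lambda>n. (5/2) ^ n / Gamma (\<alpha> / 2 + real n) * exp ((\<alpha> / 2 + real n) * b))"
proof -
  have e: "exp ((\<alpha> / 2 + real n) * b) = exp (\<alpha> / 2 * b) * exp b ^ n" for n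
    unfolding exp_of_nat_mult[symmetric] exp_add[symmetric] by (simp add: algebra_simps)
  have "(\<lambda>n. (5/2) ^ n / Gamma (\<alpha> / 2 + real n) * exp ((\<alpha> / 2 + real n) * b)) = (\<lambda>n. exp (\<alpha> / 2 * b) * ((5/2 * exp b) ^ n / Gamma (\<alpha> / 2 + real n)))"
    unfolding e power_mult_distrib by (simp add: fun_eq_iff)
  then show ?thesis using summable_mult[OF summable_power_over_Gamma[of "\<alpha>/2" "5/2 * exp b"]] al by simp
qed

lemma Gamma_half_pos: "Gamma (\<alpha> / 2 + real n) > 0" using al by (simp add: add_pos_nonneg)

lemma norm_coeff1_exp_le:
  assumes "t \<le> b"
  shows "norm (coeff1 \<tau> n * exp (exponent \<tau> n * of_real t)) \<le> (coeff1_const * weight_F \<tau>) * ((5/2) ^ n / Gamma (\<alpha> / 2 + real n) * exp ((\<alpha> / 2 + real n) * b))"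
proof -
  have "(\<alpha> / 2 + real n) * t \<le> (\<alpha> / 2 + real n) * b" using al by (intro mult_left_mono assms) auto
  then have "norm (exp (exponent \<tau> n * of_real t)) \<le> exp ((\<alpha> / 2 + real n) * b)" by (simp add: Re_exponent)
  then have "norm (coeff1 \<tau> n * exp (exponent \<tau> n * of_real t)) \<le> (coeff1_const * weight_F \<tau>) * ((5/2) ^ n / Gamma (\<alpha> / 2 + n)) * exp ((\<alpha> / 2 + n) * b)"
    unfolding norm_mult using coeff1_const Gamma_half_pos[of n] by (intro mult_mono norm_coeff1_le) (auto simp: weight_F_def)
  then show ?thesis by simp
qed

lemma series1_cont: "isCont series1 a"
  unfolding series1_def
proof (rule isCont_integral_dominated[where r=1])
  show "(\<lambda>z. coeff1 (fst z) (snd z) * exp (exponent (fst z) (snd z) * of_real t)) \<in> borel_measurable nat_line" for t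
  proof -
    have "(\<lambda>(\<tau>, n). coeff1 \<tau> n * exp (exponent \<tau> n * of_real t)) \<in> borel_measurable nat_line"
      by (rule borel_measurable_nat_line) measurable
    then show ?thesis by (simp add: case_prod_beta')
  qed
  show "isCont (\<lambda>t. coeff1 (fst z) (snd z) * exp (exponent (fst z) (snd z) * of_real t)) a" for z
    by (intro continuous_intros)
  show "norm (coeff1 (fst z) (snd z) * exp (exponent (fst z) (snd z) * of_real t)) \<le> (coeff1_const * weight_F (fst z)) * ((5/2) ^ snd z / Gamma (\<alpha> / 2 + real (snd z)) * exp ((\<alpha> / 2 + real (snd z)) * (a + 1)))"
    if t: "dist t a < 1" for t z
    by (rule norm_coeff1_exp_le) (use t in \<open>simp add: dist_real_def abs_less_iff\<close>)
  show "integrable nat_line (\<lambda>z. (coeff1_const * weight_F (fst z)) * ((5/2) ^ snd z / Gamma (\<alpha> / 2 + real (snd z)) * exp ((\<alpha> / 2 + real (snd z)) * (a + 1))))"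
  proof (rule nat_line_integrable_product[OF _ summable_series1_bound])
    show "integrable lborel (\<lambda>\<tau>. coeff1_const * weight_F \<tau>)" using weight_F_integrable0 by simp
    show "0 \<le> (5/2) ^ n / Gamma (\<alpha> / 2 + real n) * exp ((\<alpha> / 2 + real n) * (a + 1))" for n
      using Gamma_half_pos[of n] by (simp add: less_imp_le)
  qed (use coeff1_const in \<open>simp add: weight_F_def\<close>)
qed simp

text \<open>Translating the variable of integration by \<open>c - ln y\<close> turns \<open>y^2 e^a + e^{2c-a}\<close> into \<open>2 e^c y cosh a\<close>, which is the exponent of
the Macdonald function.\<close>

lemma stage1_laplace:
  assumes y: "y > 0"
  shows "integrable lborel (\<lambda>a. of_real (exp (- (y\<^sup>2 / 2) * exp a)) * stage1 a)"
    and "(LINT a|lborel. of_real (exp (- (y\<^sup>2 / 2) * exp a)) * stage1 a) = of_real (y powr (- \<alpha>)) * macdonald_transform \<alpha> \<phi> y"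
proof -
  define w where "w = (\<lambda>c a. (of_real (exp ((1 - \<alpha>) * c)) * \<phi> c) * of_real (1/2 * exp (\<alpha> * a) * exp (- (y\<^sup>2 / 2) * exp a) * exp (- (exp (- a) / 2) * exp (2 * c))))"
  have wi: "integrable (lborel \<Otimes>\<^sub>M lborel) (\<lambda>(c, a). w c a)"
  proof (rule lborel_pair.integrable_product_bound[OF _ weight_phi])
    show "(\<lambda>(c, a). w c a) \<in> borel_measurable (lborel \<Otimes>\<^sub>M lborel)" unfolding w_def by measurable
    show "integrable lborel (\<lambda>a. 1/2 * (exp (\<alpha> * a) * exp (- (y\<^sup>2 / 2) * exp a)))"
      by (intro integrable_mult_right Gamma_integral_exp_real al) (use y in auto)
    show "norm (w c a) \<le> weight_phi c * (1/2 * (exp (\<alpha> * a) * exp (- (y\<^sup>2 / 2) * exp a)))" for c a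
    proof -
      have "norm (w c a) = weight_phi c * (1/2 * (exp (\<alpha> * a) * exp (- (y\<^sup>2 / 2) * exp a)) * exp (- (exp (- a) / 2) * exp (2 * c)))"
        by (simp add: w_def norm_mult weight_phi_def)
      also have "\<dots> \<le> weight_phi c * (1/2 * (exp (\<alpha> * a) * exp (- (y\<^sup>2 / 2) * exp a)) * 1)"
        by (intro mult_left_mono) (auto simp: weight_phi_def)
      finally show ?thesis by simp
    qed
  qed
  have e: "of_real (exp (- (y\<^sup>2 / 2) * exp a)) * stage1 a = (LINT c|lborel. w c a)" for a
  proof -
    have "w c a = of_real (exp (- (y\<^sup>2 / 2) * exp a)) * (of_real (1/2 * exp (\<alpha> * a)) * (of_real (exp ((1 - \<alpha>) * c)) * \<phi> c * of_real (exp (- (exp (- a) / 2) * exp (2 * c)))))" for c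
      by (simp add: w_def)
    then show ?thesis unfolding stage1_def \<Phi>_def by (simp only: integral_mult_right_zero)
  qed
  show "integrable lborel (\<lambda>a. of_real (exp (- (y\<^sup>2 / 2) * exp a)) * stage1 a)"
    unfolding e by (rule lborel_pair.integrable_snd[OF wi])
  have "(LINT a|lborel. of_real (exp (- (y\<^sup>2 / 2) * exp a)) * stage1 a) = (LINT c|lborel. LINT a|lborel. w c a)"
    unfolding e by (rule lborel_pair.Fubini_integral[OF wi])
  also have "\<dots> = (LINT c|lborel. of_real (y powr (- \<alpha>)) * (\<phi> c * of_real (exp c * macK \<alpha> (exp c * y))))"
  proof (rule Bochner_Integration.integral_cong[OF refl])
    fix c
    define \<eta> where "\<eta> = ln y"
    have ye: "y = exp \<eta>" using y by (simp add: \<eta>_def)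
    define q where "q = (\<lambda>a. 1/2 * exp (\<alpha> * a) * exp (- (y\<^sup>2 / 2) * exp a) * exp (- (exp (- a) / 2) * exp (2 * c)))"
    have qe: "q ((c - \<eta>) + 1 * a) = exp (\<alpha> * (c - \<eta>)) * (1/2 * exp (- (exp c * y) * cosh a + \<alpha> * a))" for a
    proof -
      have 1: "y\<^sup>2 / 2 * exp ((c - \<eta>) + a) = exp (c + \<eta> + a) / 2"
        by (simp add: ye power2_eq_square flip: exp_add)
      have 2: "exp (- ((c - \<eta>) + a)) / 2 * exp (2 * c) = exp (c + \<eta> - a) / 2"
        by (simp flip: exp_add)
      have 3: "exp c * y * cosh a = exp (c + \<eta> + a) / 2 + exp (c + \<eta> - a) / 2"
        by (simp add: ye cosh_field_def exp_add exp_diff exp_minus field_simps)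
      have "q ((c - \<eta>) + 1 * a) = 1/2 * exp (\<alpha> * (c - \<eta>) + \<alpha> * a - (y\<^sup>2 / 2 * exp ((c - \<eta>) + a)) - (exp (- ((c - \<eta>) + a)) / 2 * exp (2 * c)))"
        unfolding q_def mult.assoc exp_add[symmetric] by (simp add: algebra_simps)
      also have "\<dots> = 1/2 * exp (\<alpha> * (c - \<eta>) + (- (exp c * y * cosh a) + \<alpha> * a))"
        unfolding 1 2 3 by (simp add: algebra_simps)
      finally show ?thesis unfolding exp_add[of "\<alpha> * (c - \<eta>)"] by simp
    qed
    have "(LINT a|lborel. q a) = (LINT a|lborel. q ((c - \<eta>) + 1 * a))"
      by (subst lborel_integral_real_affine[of 1 _ "c - \<eta>"]) auto
    also have "\<dots> = exp (\<alpha> * (c - \<eta>)) * macK \<alpha> (exp c * y)"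
      unfolding qe by (simp add: macK_def)
    finally have qi: "(LINT a|lborel. q a) = exp (\<alpha> * (c - \<eta>)) * macK \<alpha> (exp c * y)" .
    have "(LINT a|lborel. w c a) = (of_real (exp ((1 - \<alpha>) * c)) * \<phi> c) * of_real (LINT a|lborel. q a)"
      unfolding w_def q_def by (simp only: integral_mult_right_zero integral_complex_of_real)
    also have "\<dots> = of_real (exp ((1 - \<alpha>) * c) * exp (\<alpha> * (c - \<eta>))) * (\<phi> c * of_real (macK \<alpha> (exp c * y)))"
      unfolding qi by simp
    also have "exp ((1 - \<alpha>) * c) * exp (\<alpha> * (c - \<eta>)) = y powr (- \<alpha>) * exp c"
      using y by (simp add: powr_def \<eta>_def algebra_simps flip: exp_add)
    finally show "(LINT a|lborel. w c a) = of_real (y powr (- \<alpha>)) * (\<phi> c * of_real (exp c * macK \<alpha> (exp c * y)))"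
      by simp
  qed
  finally show "(LINT a|lborel. of_real (exp (- (y\<^sup>2 / 2) * exp a)) * stage1 a) = of_real (y powr (- \<alpha>)) * macdonald_transform \<alpha> \<phi> y"
    by (simp only: integral_mult_right_zero macdonald_transform_def)
qed

lemma coeff1_exp_measurable: "(\<lambda>(\<tau>, a). coeff1 \<tau> n * exp (exponent \<tau> n * of_real a) * of_real (h a)) \<in> borel_measurable (borel \<Otimes>\<^sub>M borel)"
  if "h \<in> borel_measurable borel" for h :: "real \<Rightarrow> real"
  using that by measurable

text \<open>The expansion in inverse powers of \<open>y^2\<close>, with the factor \<open>y^{-\<alpha>}\<close> of the inner Laplace transform absorbed into the
exponents.\<close>

lemma fourier_kernel_series:
  assumes t: "t > 0"
  shows "(\<lambda>n. F \<tau> * (catalan_coeff (\<i> * of_real \<tau>) n * exp (- exponent \<tau> n * of_real (ln ((2 * cosh t)\<^sup>2)))))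
    sums (of_real ((2 * cosh t) powr (- \<alpha>)) * (F \<tau> * exp (- \<i> * of_real (\<tau> * t))))"
proof -
  define s where "s = \<i> * complex_of_real \<tau>"
  define L where "L = ln (2 * cosh t)"
  have L2: "ln ((2 * cosh t)\<^sup>2) = 2 * L" unfolding L_def by (subst ln_realpow) auto
  have e1: "exp (- exponent \<tau> n * of_real (2 * L)) = exp (- of_real (\<alpha> * L)) * exp (- s * of_real L) * of_real ((1 / (2 * cosh t)\<^sup>2) ^ n)" for n
  proof -
    have p: "(1 / (2 * cosh t)\<^sup>2) ^ n = exp (real n * (- (2 * L)))"
      unfolding exp_of_nat_mult exp_minus L2[symmetric] by (simp add: inverse_eq_divide)
    have "- exponent \<tau> n * of_real (2 * L) = - of_real (\<alpha> * L) + (- s * of_real L) + of_real (real n * (- (2 * L)))"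
      by (simp add: exponent_def s_def algebra_simps)
    then show ?thesis unfolding p exp_of_real[symmetric] by (simp only: exp_add)
  qed
  have "(\<lambda>n. F \<tau> * (exp (- of_real (\<alpha> * L)) * exp (- s * of_real L)) * (catalan_coeff s n * of_real ((1 / (2 * cosh t)\<^sup>2) ^ n)))
     sums (F \<tau> * (exp (- of_real (\<alpha> * L)) * exp (- s * of_real L)) * exp (- s * of_real (t - L)))"
    unfolding L_def by (intro sums_mult catalan_series_cosh t) (simp add: s_def)
  moreover have "F \<tau> * (exp (- of_real (\<alpha> * L)) * exp (- s * of_real L)) * exp (- s * of_real (t - L)) = of_real ((2 * cosh t) powr (- \<alpha>)) * (F \<tau> * exp (- \<i> * of_real (\<tau> * t)))"
  proof -
    have "exp (- s * of_real L) * exp (- s * of_real (t - L)) = exp (- \<i> * of_real (\<tau> * t))"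
      unfolding exp_add[symmetric] by (simp add: s_def algebra_simps)
    moreover have "exp (- complex_of_real (\<alpha> * L)) = of_real ((2 * cosh t) powr (- \<alpha>))"
      by (simp add: powr_def L_def flip: exp_of_real)
    moreover have "F \<tau> * (x * y) * z = x * (F \<tau> * (y * z))" for x y z by (simp only: mult_ac)
    ultimately show ?thesis by (simp only:)
  qed
  ultimately have "(\<lambda>n. F \<tau> * (exp (- of_real (\<alpha> * L)) * exp (- s * of_real L)) * (catalan_coeff s n * of_real ((1 / (2 * cosh t)\<^sup>2) ^ n)))
     sums (of_real ((2 * cosh t) powr (- \<alpha>)) * (F \<tau> * exp (- \<i> * of_real (\<tau> * t))))" by (simp only:)
  moreover have "F \<tau> * (x * y) * (z * w) = F \<tau> * (z * (x * y * w))" for x y z w by (simp only: mult_ac)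
  ultimately show ?thesis unfolding L2 e1 s_def by (simp only:)
qed

text \<open>Termwise integration. The bound \<open>p \<ge> 3\<close> makes the majorant a convergent geometric series of ratio \<open>5/(2p)\<close>; it
also ensures that \<open>y^2 = 2p > 4\<close>, so that \<open>y = 2 cosh t\<close> for some \<open>t > 0\<close>.\<close>

lemma series1_laplace:
  assumes p: "p \<ge> 3"
  shows "integrable lborel (\<lambda>a. of_real (exp (- p * exp a)) * series1 a)"
    and "(LINT a|lborel. of_real (exp (- p * exp a)) * series1 a)
      = (LINT \<tau>|lborel. (\<Sum>n. F \<tau> * (catalan_coeff (\<i> * of_real \<tau>) n * exp (- exponent \<tau> n * of_real (ln (2 * p))))))"
proof -
  define f where "f = (\<lambda>\<tau> n a. coeff1 \<tau> n * exp (exponent \<tau> n * of_real a) * of_real (exp (- p * exp a)))"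
  have p0: "p > 0" using p by simp
  have Rs: "Re (exponent \<tau> n) > 0" for \<tau> n using al by (simp add: Re_exponent add_pos_nonneg)
  have ff: "f \<tau> n a = coeff1 \<tau> n * (exp (exponent \<tau> n * of_real a) * of_real (exp (- p * exp a)))" for \<tau> n a
    by (simp add: f_def)
  have fi: "integrable lborel (f \<tau> n)" for \<tau> n
    unfolding f_def mult.assoc by (intro integrable_mult_right Gamma_integral_exp Rs p0)
  have nn: "coeff1 \<tau> n * Gamma (exponent \<tau> n) = F \<tau> * (catalan_coeff (\<i> * of_real \<tau>) n * exp (- exponent \<tau> n * of_real (ln 2)))" for \<tau> n
  proof -
    have "rGamma (exponent \<tau> n) * Gamma (exponent \<tau> n) = 1"
    proof -
      have "exponent \<tau> n \<notin> \<int>\<^sub>\<le>\<^sub>0" using Rs[of \<tau> n] by (auto elim!: nonpos_Ints_cases)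
      then show ?thesis by (simp add: rGamma_inverse_Gamma Gamma_eq_zero_iff)
    qed
    then show ?thesis by (simp add: coeff1_def mult.assoc)
  qed
  have fv: "(LINT a|lborel. f \<tau> n a) = F \<tau> * (catalan_coeff (\<i> * of_real \<tau>) n * exp (- exponent \<tau> n * of_real (ln (2 * p))))" for \<tau> n
  proof -
    have "(LINT a|lborel. f \<tau> n a) = coeff1 \<tau> n * (Gamma (exponent \<tau> n) * exp (- exponent \<tau> n * of_real (ln p)))"
      unfolding ff integral_mult_right_zero Gamma_integral_exp(2)[OF Rs p0] ..
    also have "\<dots> = F \<tau> * (catalan_coeff (\<i> * of_real \<tau>) n * (exp (- exponent \<tau> n * of_real (ln 2)) * exp (- exponent \<tau> n * of_real (ln p))))"
      unfolding mult.assoc[symmetric] nn ..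
    also have "exp (- exponent \<tau> n * of_real (ln 2)) * exp (- exponent \<tau> n * of_real (ln p)) = exp (- exponent \<tau> n * of_real (ln (2 * p)))"
      unfolding exp_add[symmetric] using p0 by (simp add: ln_mult algebra_simps)
    finally show ?thesis .
  qed
  define v where "v = (\<lambda>n. exp (- (\<alpha> / 2) * ln p) * (5 / 2 / p) ^ n)"
  have v: "summable v" unfolding v_def using p by (intro summable_mult summable_geometric) auto
  have v0: "0 \<le> v n" for n using p0 by (simp add: v_def)
  have fn: "(LINT a|lborel. norm (f \<tau> n a)) \<le> (coeff1_const * weight_F \<tau>) * v n" for \<tau> n
  proof -
    have "(LINT a|lborel. norm (f \<tau> n a)) = norm (coeff1 \<tau> n) * (LINT a|lborel. exp ((\<alpha> / 2 + n) * a) * exp (- p * exp a))"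
      unfolding f_def by (simp add: norm_mult Re_exponent mult.assoc)
    also have "(LINT a|lborel. exp ((\<alpha> / 2 + n) * a) * exp (- p * exp a)) = Gamma (\<alpha> / 2 + n) * exp (- (\<alpha> / 2 + n) * ln p)"
      by (rule Gamma_integral_exp_real) (use al p0 in \<open>auto simp: add_pos_nonneg\<close>)
    also have "norm (coeff1 \<tau> n) * (Gamma (\<alpha> / 2 + n) * exp (- (\<alpha> / 2 + n) * ln p)) \<le> ((coeff1_const * weight_F \<tau>) * ((5/2) ^ n / Gamma (\<alpha> / 2 + n))) * (Gamma (\<alpha> / 2 + n) * exp (- (\<alpha> / 2 + n) * ln p))"
      using Gamma_half_pos[of n] by (intro mult_right_mono norm_coeff1_le) (auto simp: less_imp_le)
    also have "\<dots> = (coeff1_const * weight_F \<tau>) * ((5/2) ^ n * exp (- (\<alpha> / 2 + n) * ln p))" using Gamma_half_pos[of n] by simp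
    also have "exp (- (\<alpha> / 2 + n) * ln p) = exp (- (\<alpha> / 2) * ln p) * (1 / p) ^ n"
    proof -
      have "(1 / p) ^ n = exp (real n * (- ln p))" unfolding exp_of_nat_mult using p0 by (simp add: exp_minus inverse_eq_divide)
      then show ?thesis unfolding exp_add[symmetric] by (simp add: algebra_simps flip: exp_add)
    qed
    also have "(5/2) ^ n * (exp (- (\<alpha> / 2) * ln p) * (1 / p) ^ n) = v n" by (simp add: v_def power_divide power_mult_distrib)
    finally show ?thesis .
  qed
  have u: "integrable lborel (\<lambda>\<tau>. coeff1_const * weight_F \<tau>)" using weight_F_integrable0 by simp
  have fm: "(\<lambda>(x, a). f x n a) \<in> borel_measurable (borel \<Otimes>\<^sub>M borel)" for n
    unfolding f_def by (rule coeff1_exp_measurable) simp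
  have e: "(LINT z|nat_line. f (fst z) (snd z) a) = of_real (exp (- p * exp a)) * series1 a" for a
    unfolding f_def series1_def integral_mult_left_zero by (rule mult.commute)
  show "integrable lborel (\<lambda>a. of_real (exp (- p * exp a)) * series1 a)"
    using nat_line_Fubini(1)[OF fm fi u v fn v0] unfolding e .
  have "(LINT a|lborel. of_real (exp (- p * exp a)) * series1 a) = (LINT z|nat_line. LINT a|lborel. f (fst z) (snd z) a)"
    using nat_line_Fubini(2)[OF fm fi u v fn v0] unfolding e .
  also have "\<dots> = (LINT \<tau>|lborel. (\<Sum>n. F \<tau> * (catalan_coeff (\<i> * of_real \<tau>) n * exp (- exponent \<tau> n * of_real (ln (2 * p))))))"
    unfolding fv
  proof (rule nat_line_integral(2)[OF _ u v _ v0])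
    show "norm (F x * (catalan_coeff (\<i> * of_real x) n * exp (- exponent x n * of_real (ln (2 * p))))) \<le> coeff1_const * weight_F x * v n" for x n
      unfolding fv[symmetric] using integral_norm_bound[of lborel "f x n"] fn[of x n] by (rule order_trans)
  qed measurable
  finally show "(LINT a|lborel. of_real (exp (- p * exp a)) * series1 a)
      = (LINT \<tau>|lborel. (\<Sum>n. F \<tau> * (catalan_coeff (\<i> * of_real \<tau>) n * exp (- exponent \<tau> n * of_real (ln (2 * p))))))" .
qed

text \<open>Both sides are continuous, and their Laplace transforms agree for \<open>p \<ge> 3\<close> by Fourier inversion and the series for
\<open>e^{-i\<tau>t}\<close>.\<close>

lemma stage1_eq_series1: "stage1 a = 1 / (2 * of_real pi) * series1 a"
proof -
  define H where "H = (\<lambda>a. stage1 a - 1 / (2 * of_real pi) * series1 a)"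
  have lp: "integrable lborel (\<lambda>a. of_real (exp (- p * exp (1 * a))) * H a) \<and> (LINT a|lborel. of_real (exp (- p * exp (1 * a))) * H a) = 0"
    if p: "p \<ge> 3" for p
  proof -
    define y where "y = sqrt (2 * p)"
    have y2: "y\<^sup>2 = 2 * p" using p by (simp add: y_def)
    have "sqrt 4 < y" unfolding y_def using p by (intro real_sqrt_less_mono) simp
    then have y: "y > 2" by simp
    define t where "t = arcosh (y / 2)"
    have t: "t > 0" "2 * cosh t = y" using y by (auto simp: t_def)
    have "integrable lborel (\<lambda>a. of_real (exp (- (y\<^sup>2 / 2) * exp a)) * stage1 a)"
      "(LINT a|lborel. of_real (exp (- (y\<^sup>2 / 2) * exp a)) * stage1 a) = of_real (y powr (- \<alpha>)) * macdonald_transform \<alpha> \<phi> y"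
      using stage1_laplace[of y] y by auto
    then have h1: "integrable lborel (\<lambda>a. of_real (exp (- p * exp a)) * stage1 a)"
      "(LINT a|lborel. of_real (exp (- p * exp a)) * stage1 a) = of_real (y powr (- \<alpha>)) * macdonald_transform \<alpha> \<phi> y"
      by (simp_all add: y2)
    have h2: "integrable lborel (\<lambda>a. of_real (exp (- p * exp a)) * series1 a)" by (rule series1_laplace(1)[OF p])
    have "(LINT a|lborel. of_real (exp (- p * exp a)) * series1 a) = (LINT \<tau>|lborel. of_real (y powr (- \<alpha>)) * (F \<tau> * exp (- \<i> * of_real (\<tau> * t))))"
      unfolding series1_laplace(2)[OF p] y2[symmetric] t(2)[symmetric] using sums_unique[OF fourier_kernel_series[OF t(1)]] by simp
    also have "\<dots> = of_real (y powr (- \<alpha>)) * (2 * of_real pi * line_transform t)"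
      unfolding integral_mult_right_zero transform_eq_fourier[of t] by simp
    finally have lap2: "(LINT a|lborel. of_real (exp (- p * exp a)) * series1 a) = of_real (y powr (- \<alpha>)) * (2 * of_real pi * macdonald_transform \<alpha> \<phi> y)"
      by (simp add: line_transform_def t(2))
    have e: "of_real (exp (- p * exp (1 * a))) * H a = of_real (exp (- p * exp a)) * stage1 a - 1 / (2 * of_real pi) * (of_real (exp (- p * exp a)) * series1 a)" for a
      by (simp add: H_def algebra_simps)
    show ?thesis unfolding e
    proof
      show "integrable lborel (\<lambda>a. of_real (exp (- p * exp a)) * stage1 a - 1 / (2 * of_real pi) * (of_real (exp (- p * exp a)) * series1 a))"
        by (intro Bochner_Integration.integrable_diff integrable_mult_right h1 h2)
      have "(LINT a|lborel. of_real (exp (- p * exp a)) * stage1 a - 1 / (2 * of_real pi) * (of_real (exp (- p * exp a)) * series1 a))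
        = (LINT a|lborel. of_real (exp (- p * exp a)) * stage1 a) - (LINT a|lborel. 1 / (2 * of_real pi) * (of_real (exp (- p * exp a)) * series1 a))"
        by (rule Bochner_Integration.integral_diff[OF h1(1) integrable_mult_right[OF h2]])
      also have "\<dots> = 0" unfolding integral_mult_right_zero h1(2) lap2 by simp
      finally show "(LINT a|lborel. of_real (exp (- p * exp a)) * stage1 a - 1 / (2 * of_real pi) * (of_real (exp (- p * exp a)) * series1 a)) = 0" .
    qed
  qed
  have "H a = 0"
  proof (rule laplace_unique[where k=1 and ?p0.0=3])
    show "isCont H a" for a unfolding H_def by (intro continuous_intros stage1_cont series1_cont) simp
    show "integrable lborel (\<lambda>a. of_real (exp (- 3 * exp (1 * a))) * H a)" using lp[of 3] by simp
    show "(LINT a|lborel. of_real (exp (- (3 + real n) * exp (1 * a))) * H a) = 0" for n using lp[of "3 + real n"] by simp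
  qed simp
  then show ?thesis by (simp add: H_def)
qed

section \<open>The outer Laplace transform\<close>

definition exponent2 :: "real \<Rightarrow> nat \<Rightarrow> complex" where "exponent2 \<tau> n = exponent \<tau> n - of_real \<alpha>"

lemma Re_exponent2: "Re (exponent2 \<tau> n) = n - \<alpha> / 2" by (simp add: exponent2_def Re_exponent)

lemma exponent2_measurable [measurable]: "(\<lambda>\<tau>. exponent2 \<tau> n) \<in> borel_measurable borel"
  unfolding exponent2_def by measurable

text \<open>The coefficient after inverting both Laplace transforms: one reciprocal Gamma factor for each of them.\<close>

definition coeff2 :: "real \<Rightarrow> nat \<Rightarrow> complex" where
  "coeff2 \<tau> n = coeff1 \<tau> n * (exp (- exponent2 \<tau> n * of_real (ln 2)) * rGamma (exponent2 \<tau> n))"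

lemma coeff2_measurable [measurable]: "(\<lambda>\<tau>. coeff2 \<tau> n) \<in> borel_measurable borel"
  unfolding coeff2_def by measurable

text \<open>The identity of the inner Laplace transform, read at \<open>w = 1/(2r)\<close>.\<close>

lemma Phi_eq:
  assumes r: "r > 0"
  shows "\<Phi> r = 1 / of_real pi * (LINT z|nat_line. coeff1 (fst z) (snd z) * exp (- exponent2 (fst z) (snd z) * of_real (ln 2)) * exp (- exponent2 (fst z) (snd z) * of_real (ln r)))"
    and "integrable nat_line (\<lambda>z. coeff1 (fst z) (snd z) * exp (- exponent2 (fst z) (snd z) * of_real (ln 2)) * exp (- exponent2 (fst z) (snd z) * of_real (ln r)))"
proof -
  define a where "a = - ln (2 * r)"
  have ea: "exp (- a) / 2 = r" using r by (simp add: a_def)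
  have e: "coeff1 \<tau> n * exp (- exponent2 \<tau> n * of_real (ln 2)) * exp (- exponent2 \<tau> n * of_real (ln r)) = of_real (exp (- \<alpha> * a)) * (coeff1 \<tau> n * exp (exponent \<tau> n * of_real a))" for \<tau> n
  proof -
    have "exp (- exponent2 \<tau> n * of_real (ln 2)) * exp (- exponent2 \<tau> n * of_real (ln r)) = exp (of_real (- \<alpha> * a)) * exp (exponent \<tau> n * of_real a)"
      unfolding exp_add[symmetric] a_def using r by (simp add: exponent2_def ln_mult algebra_simps)
    then have "coeff1 \<tau> n * exp (- exponent2 \<tau> n * of_real (ln 2)) * exp (- exponent2 \<tau> n * of_real (ln r)) = coeff1 \<tau> n * (exp (of_real (- \<alpha> * a)) * exp (exponent \<tau> n * of_real a))"
      by (simp only: mult.assoc)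
    then show ?thesis by (simp only: exp_of_real mult.left_commute)
  qed
  have "of_real (1/2 * exp (\<alpha> * a)) * \<Phi> r = 1 / (2 * of_real pi) * series1 a"
    using stage1_eq_series1[of a] unfolding stage1_def ea .
  then have "of_real (exp (- \<alpha> * a)) * 2 * (of_real (1/2 * exp (\<alpha> * a)) * \<Phi> r) = of_real (exp (- \<alpha> * a)) * 2 * (1 / (2 * of_real pi) * series1 a)"
    by (simp only:)
  moreover have "of_real (exp (- \<alpha> * a)) * 2 * (of_real (1/2 * exp (\<alpha> * a)) * \<Phi> r) = \<Phi> r"
    by (simp add: exp_minus flip: mult.assoc of_real_mult)
  ultimately have "\<Phi> r = of_real (exp (- \<alpha> * a)) * (1 / of_real pi * series1 a)" by simp
  then show "\<Phi> r = 1 / of_real pi * (LINT z|nat_line. coeff1 (fst z) (snd z) * exp (- exponent2 (fst z) (snd z) * of_real (ln 2)) * exp (- exponent2 (fst z) (snd z) * of_real (ln r)))"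
    unfolding e integral_mult_right_zero series1_def by simp
  have i: "integrable nat_line (\<lambda>(\<tau>, n). coeff1 \<tau> n * exp (exponent \<tau> n * of_real a))"
  proof (rule nat_line_integral(1)[OF _ _ summable_series1_bound[of a]])
    show "integrable lborel (\<lambda>\<tau>. coeff1_const * weight_F \<tau>)" using weight_F_integrable0 by simp
    show "norm (coeff1 x n * exp (exponent x n * of_real a)) \<le> (coeff1_const * weight_F x) * ((5/2) ^ n / Gamma (\<alpha> / 2 + real n) * exp ((\<alpha> / 2 + real n) * a))" for x n
      by (rule norm_coeff1_exp_le) simp
    show "0 \<le> (5/2) ^ n / Gamma (\<alpha> / 2 + real n) * exp ((\<alpha> / 2 + real n) * a)" for n
      using Gamma_half_pos[of n] by (simp add: less_imp_le)
  qed measurable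
  show "integrable nat_line (\<lambda>z. coeff1 (fst z) (snd z) * exp (- exponent2 (fst z) (snd z) * of_real (ln 2)) * exp (- exponent2 (fst z) (snd z) * of_real (ln r)))"
    unfolding e using i by (intro integrable_mult_right) (simp add: case_prod_beta')
qed

definition coeff2_const :: real where "coeff2_const = Gamma (\<alpha> / 2) * Gamma (1 - \<alpha> / 2) / pi"

lemma coeff2_const: "coeff2_const \<ge> 0" using al by (simp add: coeff2_const_def)

definition coeff2_weight :: "nat \<Rightarrow> real" where
  "coeff2_weight n = (1 + real n) * (5/4) ^ n / (Gamma (\<alpha> / 2 + real n) * Gamma (1 - \<alpha> / 2 + real n))"

lemma Gamma_half_pos': "Gamma (1 - \<alpha> / 2 + real n) > 0" using al by (simp add: add_pos_nonneg)

text \<open>Writing \<open>rGamma z\<close> as \<open>z rGamma (z + 1)\<close> moves the second argument into the right half-plane at the expense of the factor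
\<open>(1 + |\<tau>|)(1 + n)\<close>. After this shift the two Gamma arguments are related by reflection, up to conjugation and integer steps.\<close>

lemma norm_coeff2_le: "norm (coeff2 \<tau> n) \<le> (coeff2_const * ((1 + \<bar>\<tau>\<bar>) * weight_F \<tau>)) * coeff2_weight n"
proof -
  define z where "z = (\<i> * of_real \<tau> + of_real \<alpha>) / 2"
  have z: "Re z = \<alpha> / 2" "Im z = \<tau> / 2" by (simp_all add: z_def)
  have sz: "exponent \<tau> n = z + of_nat n" by (simp add: exponent_def z_def)
  have gz: "exponent2 \<tau> n + 1 = (1 - cnj z) + of_nat n" by (simp add: exponent2_def exponent_def z_def complex_eq_iff)
  have r1: "norm (rGamma (exponent \<tau> n)) \<le> norm (rGamma z) * (Gamma (\<alpha> / 2) / Gamma (\<alpha> / 2 + n))"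
    using norm_rGamma_shift[of z n] al by (simp add: z sz)
  have r2: "norm (rGamma (exponent2 \<tau> n + 1)) \<le> norm (rGamma (1 - cnj z)) * (Gamma (1 - \<alpha> / 2) / Gamma (1 - \<alpha> / 2 + n))"
    using norm_rGamma_shift[of "1 - cnj z" n] al by (simp add: z gz)
  have r3: "norm (exponent2 \<tau> n) \<le> (1 + \<bar>\<tau>\<bar>) * (1 + real n)"
  proof -
    have "norm (exponent2 \<tau> n) \<le> \<bar>Re (exponent2 \<tau> n)\<bar> + \<bar>Im (exponent2 \<tau> n)\<bar>" by (rule cmod_le)
    also have "\<dots> \<le> 1 + real n + \<bar>\<tau>\<bar>" using al by (simp add: Re_exponent2) (simp add: exponent2_def exponent_def abs_if)
    also have "\<dots> \<le> (1 + \<bar>\<tau>\<bar>) * (1 + real n)" by (simp add: algebra_simps)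
    finally show ?thesis .
  qed
  have rr: "norm (rGamma z) * norm (rGamma (1 - cnj z)) \<le> cosh (pi * \<tau> / 2) / pi"
    using norm_rGamma_product_le[of z] by (simp add: norm_mult z)
  have e: "norm (exp (- exponent \<tau> n * of_real (ln 2))) * norm (exp (- exponent2 \<tau> n * of_real (ln 2))) = (1/4) ^ n"
  proof -
    have "norm (exp (- exponent \<tau> n * of_real (ln 2))) * norm (exp (- exponent2 \<tau> n * of_real (ln 2))) = exp (real n * (- ln 2) + real n * (- ln 2))"
      by (simp add: Re_exponent Re_exponent2 algebra_simps flip: exp_add)
    also have "\<dots> = (1/4) ^ n" unfolding exp_add exp_of_nat_mult by (simp add: exp_minus flip: power_mult_distrib)
    finally show ?thesis .
  qed
  define X where "X = Gamma (\<alpha> / 2) / Gamma (\<alpha> / 2 + real n) * (Gamma (1 - \<alpha> / 2) / Gamma (1 - \<alpha> / 2 + real n))"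
  have X: "X \<ge> 0" unfolding X_def using al Gamma_half_pos[of n] Gamma_half_pos'[of n]
    by (intro mult_nonneg_nonneg divide_nonneg_nonneg) (auto simp: less_imp_le)
  have "coeff2 \<tau> n = F \<tau> * catalan_coeff (\<i> * of_real \<tau>) n * (exp (- exponent \<tau> n * of_real (ln 2)) * exp (- exponent2 \<tau> n * of_real (ln 2))) * (rGamma (exponent \<tau> n) * (exponent2 \<tau> n * rGamma (exponent2 \<tau> n + 1)))"
    unfolding coeff2_def coeff1_def rGamma_plus1 by (simp add: mult_ac)
  then have "norm (coeff2 \<tau> n) = norm (F \<tau>) * norm (catalan_coeff (\<i> * of_real \<tau>) n) * (1/4) ^ n * (norm (rGamma (exponent \<tau> n)) * (norm (exponent2 \<tau> n) * norm (rGamma (exponent2 \<tau> n + 1))))"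
    by (simp only: norm_mult e)
  also have "\<dots> \<le> norm (F \<tau>) * (exp (\<bar>\<tau>\<bar> * ln 2) * 5 ^ n) * (1/4) ^ n * ((norm (rGamma z) * (Gamma (\<alpha> / 2) / Gamma (\<alpha> / 2 + n))) * (((1 + \<bar>\<tau>\<bar>) * (1 + real n)) * (norm (rGamma (1 - cnj z)) * (Gamma (1 - \<alpha> / 2) / Gamma (1 - \<alpha> / 2 + n)))))"
    using al Gamma_half_pos[of n] Gamma_half_pos'[of n]
    by (intro mult_mono mult_left_mono mult_right_mono r1 r2 r3 norm_catalan_coeff_le mult_nonneg_nonneg) (auto simp: less_imp_le)
  also have "\<dots> = norm (F \<tau>) * exp (\<bar>\<tau>\<bar> * ln 2) * (norm (rGamma z) * norm (rGamma (1 - cnj z))) * ((1 + \<bar>\<tau>\<bar>) * ((1 + real n) * (5 * (1/4)) ^ n * X))"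
    unfolding power_mult_distrib X_def by (simp only: mult_ac)
  also have "\<dots> \<le> norm (F \<tau>) * exp (\<bar>\<tau>\<bar> * ln 2) * (cosh (pi * \<tau> / 2) / pi) * ((1 + \<bar>\<tau>\<bar>) * ((1 + real n) * (5 * (1/4)) ^ n * X))"
    by (intro mult_right_mono mult_left_mono rr mult_nonneg_nonneg X) auto
  also have "\<dots> = (norm (F \<tau>) * (exp (\<bar>\<tau>\<bar> * ln 2) * cosh (pi * \<tau> / 2))) * ((1 + \<bar>\<tau>\<bar>) * ((1 + real n) * (5/4) ^ n * X) / pi)"
    by simp
  also have "\<dots> \<le> (norm (F \<tau>) * exp (pi * \<bar>\<tau>\<bar>)) * ((1 + \<bar>\<tau>\<bar>) * ((1 + real n) * (5/4) ^ n * X) / pi)"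
    by (intro mult_right_mono mult_left_mono exp_ln2_cosh_le divide_nonneg_nonneg mult_nonneg_nonneg X) auto
  also have "\<dots> = (coeff2_const * ((1 + \<bar>\<tau>\<bar>) * weight_F \<tau>)) * coeff2_weight n"
    by (simp add: weight_F_def coeff2_const_def coeff2_weight_def X_def mult_ac)
  finally show ?thesis .
qed

lemma coeff2_weight_nonneg: "0 \<le> coeff2_weight n"
  using Gamma_half_pos[of n] Gamma_half_pos'[of n] by (simp add: coeff2_weight_def less_imp_le)

lemma one_plus_le_power2: "1 + real n \<le> 2 ^ n"
  using Bernoulli_inequality[of 1 n] by simp

lemma summable_coeff2_weight: assumes x: "x \<ge> 0" shows "summable (\<lambda>n. coeff2_weight n * x ^ n)"
proof -
  have "(\<lambda>n. 1 ^ n / Gamma (1 - \<alpha> / 2 + real n)) \<longlonglongrightarrow> 0"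
    by (rule summable_LIMSEQ_zero[OF summable_power_over_Gamma]) (use al in auto)
  then have "Bseq (\<lambda>n. 1 ^ n / Gamma (1 - \<alpha> / 2 + real n))" by (rule convergentI[THEN convergent_imp_Bseq])
  then obtain B where B: "\<And>n. norm (1 ^ n / Gamma (1 - \<alpha> / 2 + real n)) \<le> B" unfolding Bseq_def by blast
  have s: "summable (\<lambda>n. B * ((5/2 * x) ^ n / Gamma (\<alpha> / 2 + real n)))"
    by (intro summable_mult summable_power_over_Gamma) (use al x in auto)
  show ?thesis
  proof (rule summable_comparison_test'[OF s])
    fix n :: nat
    have G: "1 / Gamma (1 - \<alpha> / 2 + real n) \<le> B" using B[of n] Gamma_half_pos'[of n] by simp
    have "norm (coeff2_weight n * x ^ n) = coeff2_weight n * x ^ n" using coeff2_weight_nonneg[of n] x by simp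
    also have "\<dots> = (1 + real n) * ((5/4) ^ n * x ^ n / Gamma (\<alpha> / 2 + real n)) * (1 / Gamma (1 - \<alpha> / 2 + real n))"
      by (simp add: coeff2_weight_def)
    also have "\<dots> \<le> 2 ^ n * ((5/4) ^ n * x ^ n / Gamma (\<alpha> / 2 + real n)) * B"
      using Gamma_half_pos[of n] Gamma_half_pos'[of n] x
      by (intro mult_mono G one_plus_le_power2) (auto simp: less_imp_le)
    also have "\<dots> = B * ((2 * (5/4) * x) ^ n / Gamma (\<alpha> / 2 + real n))"
      unfolding power_mult_distrib by simp
    finally show "norm (coeff2_weight n * x ^ n) \<le> B * ((5/2 * x) ^ n / Gamma (\<alpha> / 2 + real n))" by simp
  qed
qed

lemma norm_coeff2_exp_le:
  assumes "b1 \<le> t" "t \<le> b2"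
  shows "norm (coeff2 \<tau> n * exp (exponent2 \<tau> n * of_real t)) \<le> (coeff2_const * ((1 + \<bar>\<tau>\<bar>) * weight_F \<tau>)) * (exp (- (\<alpha> / 2 * b1)) * (coeff2_weight n * exp b2 ^ n))"
proof -
  have "(real n - \<alpha> / 2) * t = real n * t + - (\<alpha> / 2 * t)" by (simp add: algebra_simps)
  also have "\<dots> \<le> real n * b2 + - (\<alpha> / 2 * b1)"
    using al assms by (intro add_mono le_imp_neg_le mult_left_mono) auto
  finally have "exp ((real n - \<alpha> / 2) * t) \<le> exp (real n * b2 + - (\<alpha> / 2 * b1))" by simp
  then have "norm (exp (exponent2 \<tau> n * of_real t)) \<le> exp b2 ^ n * exp (- (\<alpha> / 2 * b1))"
    unfolding exp_add exp_of_nat_mult by (simp add: Re_exponent2)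
  then have "norm (coeff2 \<tau> n * exp (exponent2 \<tau> n * of_real t)) \<le> ((coeff2_const * ((1 + \<bar>\<tau>\<bar>) * weight_F \<tau>)) * coeff2_weight n) * (exp b2 ^ n * exp (- (\<alpha> / 2 * b1)))"
    unfolding norm_mult using coeff2_const coeff2_weight_nonneg[of n] by (intro mult_mono norm_coeff2_le) (auto simp: weight_F_def)
  then show ?thesis by (simp add: mult_ac)
qed

lemma coeff2_const_weight_F: "integrable lborel (\<lambda>\<tau>. coeff2_const * ((1 + \<bar>\<tau>\<bar>) * weight_F \<tau>))" "0 \<le> coeff2_const * ((1 + \<bar>\<tau>\<bar>) * weight_F \<tau>)"
  using weight_F_integrable coeff2_const by (auto simp: weight_F_def)

definition series2 where "series2 a = (LINT z|nat_line. coeff2 (fst z) (snd z) * exp (exponent2 (fst z) (snd z) * of_real a))"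

lemma series2_cont: "isCont series2 a"
  unfolding series2_def
proof (rule isCont_integral_dominated[where r=1])
  show "(\<lambda>z. coeff2 (fst z) (snd z) * exp (exponent2 (fst z) (snd z) * of_real t)) \<in> borel_measurable nat_line" for t
  proof -
    have "(\<lambda>(\<tau>, n). coeff2 \<tau> n * exp (exponent2 \<tau> n * of_real t)) \<in> borel_measurable nat_line"
      by (rule borel_measurable_nat_line) measurable
    then show ?thesis by (simp add: case_prod_beta')
  qed
  show "isCont (\<lambda>t. coeff2 (fst z) (snd z) * exp (exponent2 (fst z) (snd z) * of_real t)) a" for z
    by (intro continuous_intros)
  show "norm (coeff2 (fst z) (snd z) * exp (exponent2 (fst z) (snd z) * of_real t)) \<le> (coeff2_const * ((1 + \<bar>fst z\<bar>) * weight_F (fst z))) * (exp (- (\<alpha> / 2 * (a - 1))) * (coeff2_weight (snd z) * exp (a + 1) ^ snd z))"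
    if "dist t a < 1" for t z
    by (rule norm_coeff2_exp_le) (use that in \<open>auto simp: dist_real_def abs_less_iff\<close>)
  show "integrable nat_line (\<lambda>z. (coeff2_const * ((1 + \<bar>fst z\<bar>) * weight_F (fst z))) * (exp (- (\<alpha> / 2 * (a - 1))) * (coeff2_weight (snd z) * exp (a + 1) ^ snd z)))"
    by (rule nat_line_integrable_product[OF coeff2_const_weight_F(1) _ coeff2_const_weight_F(2)]) (auto intro!: summable_mult summable_coeff2_weight mult_nonneg_nonneg coeff2_weight_nonneg)
qed simp

text \<open>Termwise integration against \<open>(1 - e^{-t}) e^{-rt}\<close>, with \<open>t = e^a\<close>. The second reciprocal Gamma factor cancels, and what remains are
the series for \<open>\<Phi>\<close> at \<open>r\<close> and \<open>r + 1\<close>.\<close>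

lemma series2_laplace:
  assumes r: "r > 0"
  shows "integrable lborel (\<lambda>a. of_real ((1 - exp (- exp a)) * exp (- r * exp a)) * series2 a)"
    and "(LINT a|lborel. of_real ((1 - exp (- exp a)) * exp (- r * exp a)) * series2 a) = of_real pi * (\<Phi> r - \<Phi> (r + 1))"
proof -
  define f where "f = (\<lambda>\<tau> n a. coeff2 \<tau> n * exp (exponent2 \<tau> n * of_real a) * of_real ((1 - exp (- exp a)) * exp (- r * exp a)))"
  have ff: "f \<tau> n a = coeff2 \<tau> n * (exp (exponent2 \<tau> n * of_real a) * of_real ((1 - exp (- exp a)) * exp (- r * exp a)))" for \<tau> n a
    by (simp add: f_def)
  have Rsg: "Re (exponent2 \<tau> n) > -1" and sg0: "exponent2 \<tau> n \<noteq> 0" for \<tau> n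
  proof -
    show "Re (exponent2 \<tau> n) > -1" using al by (simp add: Re_exponent2)
    have "Re (exponent2 \<tau> n) \<noteq> 0" using al by (cases n) (simp_all add: Re_exponent2)
    then show "exponent2 \<tau> n \<noteq> 0" by auto
  qed
  have fi: "integrable lborel (f \<tau> n)" for \<tau> n
    unfolding f_def mult.assoc by (intro integrable_mult_right Gamma_difference_integral(1) Rsg sg0 r)
  have GG: "rGamma (exponent2 \<tau> n) * Gamma (exponent2 \<tau> n) = 1" for \<tau> n
  proof -
    have "exponent2 \<tau> n \<notin> \<int>\<^sub>\<le>\<^sub>0"
    proof
      assume "exponent2 \<tau> n \<in> \<int>\<^sub>\<le>\<^sub>0"
      then obtain m where m: "exponent2 \<tau> n = of_int m" "m \<le> 0" by (elim nonpos_Ints_cases)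
      have "Re (exponent2 \<tau> n) = of_int m" by (simp add: m)
      then have "m = 0" using Rsg[of \<tau> n] m(2) by simp
      with m sg0 show False by simp
    qed
    then show ?thesis by (simp add: rGamma_inverse_Gamma Gamma_eq_zero_iff)
  qed
  define E where "E = (\<lambda>r \<tau> n. coeff1 \<tau> n * exp (- exponent2 \<tau> n * of_real (ln 2)) * exp (- exponent2 \<tau> n * of_real (ln r)))"
  have fv: "(LINT a|lborel. f \<tau> n a) = E r \<tau> n - E (r + 1) \<tau> n" for \<tau> n
  proof -
    have "(LINT a|lborel. f \<tau> n a) = coeff2 \<tau> n * (Gamma (exponent2 \<tau> n) * (exp (- exponent2 \<tau> n * of_real (ln r)) - exp (- exponent2 \<tau> n * of_real (ln (r + 1)))))"
      unfolding ff integral_mult_right_zero Gamma_difference_integral(2)[OF Rsg sg0 r] ..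
    also have "\<dots> = coeff1 \<tau> n * exp (- exponent2 \<tau> n * of_real (ln 2)) * (rGamma (exponent2 \<tau> n) * Gamma (exponent2 \<tau> n)) * (exp (- exponent2 \<tau> n * of_real (ln r)) - exp (- exponent2 \<tau> n * of_real (ln (r + 1))))"
      unfolding coeff2_def by (simp only: mult_ac)
    finally show ?thesis unfolding GG E_def by (simp add: right_diff_distrib)
  qed
  define v where "v = (\<lambda>n. exp (- (1 - \<alpha> / 2) * ln r) * ((1 + real n) * ((5/4) ^ n * (1 / r) ^ n / Gamma (\<alpha> / 2 + real n))))"
  have v0: "0 \<le> v n" for n unfolding v_def using r Gamma_half_pos[of n]
    by (intro mult_nonneg_nonneg divide_nonneg_nonneg) (auto simp: less_imp_le)
  have v: "summable v"
  proof -
    have "summable (\<lambda>n. (1 + real n) * ((5/4) ^ n * (1 / r) ^ n / Gamma (\<alpha> / 2 + real n)))"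
    proof (rule summable_comparison_test'[OF summable_power_over_Gamma[of "\<alpha> / 2" "2 * (5/4) * (1 / r)"]])
      fix n :: nat
      have "norm ((1 + real n) * ((5/4) ^ n * (1 / r) ^ n / Gamma (\<alpha> / 2 + real n))) = (1 + real n) * ((5/4) ^ n * (1 / r) ^ n / Gamma (\<alpha> / 2 + real n))"
        using r Gamma_half_pos[of n] by (simp add: abs_mult)
      also have "\<dots> \<le> 2 ^ n * ((5/4) ^ n * (1 / r) ^ n / Gamma (\<alpha> / 2 + real n))"
        using r Gamma_half_pos[of n] by (intro mult_right_mono one_plus_le_power2) (auto simp: less_imp_le)
      also have "\<dots> = (2 * (5/4) * (1 / r)) ^ n / Gamma (\<alpha> / 2 + real n)"
        unfolding power_mult_distrib by simp
      finally show "norm ((1 + real n) * ((5/4) ^ n * (1 / r) ^ n / Gamma (\<alpha> / 2 + real n))) \<le> (2 * (5/4) * (1 / r)) ^ n / Gamma (\<alpha> / 2 + real n)" .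
    qed (use al r in auto)
    then show ?thesis unfolding v_def by (rule summable_mult)
  qed
  have fn: "(LINT a|lborel. norm (f \<tau> n a)) \<le> (coeff2_const * ((1 + \<bar>\<tau>\<bar>) * weight_F \<tau>)) * v n" for \<tau> n
  proof -
    have "(LINT a|lborel. norm (f \<tau> n a)) = norm (coeff2 \<tau> n) * (LINT a|lborel. norm (exp (exponent2 \<tau> n * of_real a) * of_real ((1 - exp (- exp a)) * exp (- r * exp a))))"
      unfolding ff norm_mult[of "coeff2 \<tau> n"] by simp
    also have "\<dots> \<le> norm (coeff2 \<tau> n) * (Gamma (Re (exponent2 \<tau> n) + 1) * exp (- (Re (exponent2 \<tau> n) + 1) * ln r))"
      by (intro mult_left_mono Gamma_difference_integral(3) Rsg sg0 r) simp
    also have "Re (exponent2 \<tau> n) + 1 = 1 - \<alpha> / 2 + real n" by (simp add: Re_exponent2)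
    also have "exp (- (1 - \<alpha> / 2 + real n) * ln r) = exp (- (1 - \<alpha> / 2) * ln r) * (1 / r) ^ n"
    proof -
      have "(1 / r) ^ n = exp (real n * (- ln r))" unfolding exp_of_nat_mult using r by (simp add: exp_minus inverse_eq_divide)
      then show ?thesis unfolding exp_add[symmetric] by (simp add: algebra_simps flip: exp_add)
    qed
    also have "norm (coeff2 \<tau> n) * (Gamma (1 - \<alpha> / 2 + real n) * (exp (- (1 - \<alpha> / 2) * ln r) * (1 / r) ^ n))
      \<le> ((coeff2_const * ((1 + \<bar>\<tau>\<bar>) * weight_F \<tau>)) * coeff2_weight n) * (Gamma (1 - \<alpha> / 2 + real n) * (exp (- (1 - \<alpha> / 2) * ln r) * (1 / r) ^ n))"
      using Gamma_half_pos'[of n] r by (intro mult_right_mono norm_coeff2_le mult_nonneg_nonneg) (auto simp: less_imp_le)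
    also have "\<dots> = (coeff2_const * ((1 + \<bar>\<tau>\<bar>) * weight_F \<tau>)) * v n"
      using Gamma_half_pos'[of n] by (simp add: v_def coeff2_weight_def)
    finally show ?thesis .
  qed
  have fm: "(\<lambda>(x, a). f x n a) \<in> borel_measurable (borel \<Otimes>\<^sub>M borel)" for n
    unfolding f_def by measurable
  have e: "(LINT z|nat_line. f (fst z) (snd z) a) = of_real ((1 - exp (- exp a)) * exp (- r * exp a)) * series2 a" for a
    unfolding f_def series2_def integral_mult_left_zero by (rule mult.commute)
  show "integrable lborel (\<lambda>a. of_real ((1 - exp (- exp a)) * exp (- r * exp a)) * series2 a)"
    using nat_line_Fubini(1)[OF fm fi coeff2_const_weight_F(1) v fn v0] unfolding e .
  have "(LINT a|lborel. of_real ((1 - exp (- exp a)) * exp (- r * exp a)) * series2 a) = (LINT z|nat_line. LINT a|lborel. f (fst z) (snd z) a)"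
    using nat_line_Fubini(2)[OF fm fi coeff2_const_weight_F(1) v fn v0] unfolding e .
  also have "\<dots> = (LINT z|nat_line. E r (fst z) (snd z)) - (LINT z|nat_line. E (r + 1) (fst z) (snd z))"
    unfolding fv using Phi_eq(2)[of r] Phi_eq(2)[of "r + 1"] r
    by (subst Bochner_Integration.integral_diff) (auto simp: E_def)
  also have "\<dots> = of_real pi * (\<Phi> r - \<Phi> (r + 1))"
    using Phi_eq(1)[of r] Phi_eq(1)[of "r + 1"] r unfolding E_def by (simp add: right_diff_distrib)
  finally show "(LINT a|lborel. of_real ((1 - exp (- exp a)) * exp (- r * exp a)) * series2 a) = of_real pi * (\<Phi> r - \<Phi> (r + 1))" .
qed

text \<open>\<open>x^{1-\<alpha>} f(x)\<close> as a function of \<open>a = ln x^2\<close>.\<close>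

definition stage2 where "stage2 a = of_real (exp ((1 - \<alpha>) * (a / 2))) * \<phi> (a / 2)"

lemma stage2_laplace:
  assumes r: "r > 0"
  shows "integrable lborel (\<lambda>a. of_real ((1 - exp (- exp a)) * exp (- r * exp a)) * stage2 a)"
    and "(LINT a|lborel. of_real ((1 - exp (- exp a)) * exp (- r * exp a)) * stage2 a) = 2 * (\<Phi> r - \<Phi> (r + 1))"
proof -
  define w where "w = (\<lambda>a. of_real ((1 - exp (- exp a)) * exp (- r * exp a)) * stage2 a)"
  have e: "w (0 + 2 * c) = of_real (exp ((1 - \<alpha>) * c)) * \<phi> c * of_real (exp (- r * exp (2 * c))) - of_real (exp ((1 - \<alpha>) * c)) * \<phi> c * of_real (exp (- (r + 1) * exp (2 * c)))" for c
  proof -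
    have "(1 - exp (- exp (2 * c))) * exp (- r * exp (2 * c)) = exp (- r * exp (2 * c)) - exp (- (r + 1) * exp (2 * c))"
      by (simp add: algebra_simps flip: exp_add)
    then have "w (0 + 2 * c) = of_real (exp (- r * exp (2 * c)) - exp (- (r + 1) * exp (2 * c))) * (of_real (exp ((1 - \<alpha>) * c)) * \<phi> c)"
      unfolding w_def stage2_def by simp
    then show ?thesis by (simp only: of_real_diff algebra_simps)
  qed
  have i: "integrable lborel (\<lambda>c. w (0 + 2 * c))"
    unfolding e using r by (intro Bochner_Integration.integrable_diff Phi_integrable) auto
  then have wi: "integrable lborel w" by (subst (asm) lborel_integrable_real_affine_iff) auto
  then show "integrable lborel (\<lambda>a. of_real ((1 - exp (- exp a)) * exp (- r * exp a)) * stage2 a)" by (simp only: w_def)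
  have "(LINT a|lborel. w a) = 2 *\<^sub>R (LINT c|lborel. w (0 + 2 * c))"
    by (subst lborel_integral_real_affine[of 2 _ 0]) auto
  also have "(LINT c|lborel. w (0 + 2 * c)) = \<Phi> r - \<Phi> (r + 1)"
    unfolding e \<Phi>_def using r by (intro Bochner_Integration.integral_diff Phi_integrable) auto
  finally show "(LINT a|lborel. of_real ((1 - exp (- exp a)) * exp (- r * exp a)) * stage2 a) = 2 * (\<Phi> r - \<Phi> (r + 1))"
    by (simp add: w_def scaleR_conv_of_real)
qed

text \<open>Laplace uniqueness for the difference, multiplied by the nowhere vanishing factor \<open>1 - exp(-e^a)\<close>.\<close>

lemma stage2_eq_series2: "stage2 a = 2 / of_real pi * series2 a"
proof -
  define H where "H = (\<lambda>a. of_real (1 - exp (- exp a)) * (stage2 a - 2 / of_real pi * series2 a))"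
  have lp: "integrable lborel (\<lambda>a. of_real (exp (- r * exp (1 * a))) * H a) \<and> (LINT a|lborel. of_real (exp (- r * exp (1 * a))) * H a) = 0"
    if r: "r > 0" for r
  proof -
    have e: "of_real (exp (- r * exp (1 * a))) * H a = of_real ((1 - exp (- exp a)) * exp (- r * exp a)) * stage2 a - 2 / of_real pi * (of_real ((1 - exp (- exp a)) * exp (- r * exp a)) * series2 a)" for a
    proof -
      have "of_real E * (of_real M * (q - k * p)) = of_real (M * E) * q - k * (of_real (M * E) * p)" for E M :: real and q k p :: complex
        by (simp only: of_real_mult algebra_simps)
      then show ?thesis by (simp only: H_def mult_1_left)
    qed
    show ?thesis unfolding e
    proof
      show "integrable lborel (\<lambda>a. of_real ((1 - exp (- exp a)) * exp (- r * exp a)) * stage2 a - 2 / of_real pi * (of_real ((1 - exp (- exp a)) * exp (- r * exp a)) * series2 a))"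
        by (intro Bochner_Integration.integrable_diff integrable_mult_right stage2_laplace series2_laplace r)
      have "(LINT a|lborel. of_real ((1 - exp (- exp a)) * exp (- r * exp a)) * stage2 a - 2 / of_real pi * (of_real ((1 - exp (- exp a)) * exp (- r * exp a)) * series2 a))
        = (LINT a|lborel. of_real ((1 - exp (- exp a)) * exp (- r * exp a)) * stage2 a) - (LINT a|lborel. 2 / of_real pi * (of_real ((1 - exp (- exp a)) * exp (- r * exp a)) * series2 a))"
        by (rule Bochner_Integration.integral_diff[OF stage2_laplace(1)[OF r] integrable_mult_right[OF series2_laplace(1)[OF r]]])
      also have "\<dots> = 0" unfolding integral_mult_right_zero stage2_laplace(2)[OF r] series2_laplace(2)[OF r] by simp
      finally show "(LINT a|lborel. of_real ((1 - exp (- exp a)) * exp (- r * exp a)) * stage2 a - 2 / of_real pi * (of_real ((1 - exp (- exp a)) * exp (- r * exp a)) * series2 a)) = 0" .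
    qed
  qed
  have Qc: "isCont stage2 a" for a
    unfolding stage2_def by (intro continuous_intros isCont_o2[where f="\<lambda>a. a / 2" and g=\<phi>] cont) auto
  have "H a = 0"
  proof (rule laplace_unique[where k=1 and ?p0.0=1])
    show "isCont H a" for a unfolding H_def by (intro continuous_intros Qc series2_cont) simp
    show "integrable lborel (\<lambda>a. of_real (exp (- 1 * exp (1 * a))) * H a)" using lp[of 1] by simp
    show "(LINT a|lborel. of_real (exp (- (1 + real n) * exp (1 * a))) * H a) = 0" for n using lp[of "1 + real n"] by simp
  qed simp
  moreover have "complex_of_real (1 - exp (- exp a)) \<noteq> 0"
    by (simp only: of_real_eq_0_iff) simp
  ultimately show ?thesis by (simp add: H_def del: of_real_diff)
qed

text \<open>Term by term, the doubly inverted series is the product of the prefactor of the kernel and the hypergeometric series: the powers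
of 4 in the coefficients cancel against the powers of 2 collected in the two inversions.\<close>

lemma kernel_series:
  assumes x: "x > 0"
  shows "2 * of_real (exp (- (1 - \<alpha>) * ln x)) * (coeff2 \<tau> n * exp (exponent2 \<tau> n * of_real (2 * ln x)))
    = F \<tau> * (complex_of_real (x / 2) powr (\<i> * of_real \<tau> - 1) * (rGamma ((\<i> * of_real \<tau> - of_real \<alpha>) / 2) * rGamma ((of_real \<alpha> + \<i> * of_real \<tau>) / 2)))
      * (fps_nth (fps_hypergeo [\<i> * of_real \<tau> / 2, (1 + \<i> * of_real \<tau>) / 2] [1 + \<i> * of_real \<tau>, (\<i> * of_real \<tau> - of_real \<alpha>) / 2, (of_real \<alpha> + \<i> * of_real \<tau>) / 2] 1) n * of_real (x\<^sup>2) ^ n)"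
proof -
  define s where "s = \<i> * complex_of_real \<tau>"
  define L where "L = ln x"
  define s0 where "s0 = (of_real \<alpha> + s) / 2"
  define g0 where "g0 = (s - of_real \<alpha>) / 2"
  have exponent: "exponent \<tau> n = s0 + of_nat n" and exponent2: "exponent2 \<tau> n = g0 + of_nat n"
    by (simp_all add: exponent2_def exponent_def s0_def g0_def s_def field_simps)
  have p1: "pochhammer s0 n \<noteq> 0"
  proof
    assume "pochhammer s0 n = 0"
    then obtain k where k: "s0 = - of_nat k" by (auto simp: pochhammer_eq_0_iff)
    have "Re s0 = \<alpha> / 2" by (simp add: s0_def s_def)
    with k al show False by simp
  qed
  have p2: "pochhammer g0 n \<noteq> 0"
  proof
    assume "pochhammer g0 n = 0"
    then obtain k :: nat where k: "g0 = - of_nat k" by (auto simp: pochhammer_eq_0_iff)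
    have "Re g0 = - \<alpha> / 2" by (simp add: g0_def s_def)
    with k have "real k = \<alpha> / 2" by simp
    with al show False by (cases k) auto
  qed
  have r1: "rGamma (exponent \<tau> n) = rGamma s0 / pochhammer s0 n" unfolding exponent using pochhammer_rGamma[of s0 n] p1 by (simp add: field_simps)
  have r2: "rGamma (exponent2 \<tau> n) = rGamma g0 / pochhammer g0 n" unfolding exponent2 using pochhammer_rGamma[of g0 n] p2 by (simp add: field_simps)
  have h: "fps_nth (fps_hypergeo [s / 2, (1 + s) / 2] [1 + s, g0, s0] 1) n
      = pochhammer (s / 2) n * pochhammer ((s + 1) / 2) n / (pochhammer (1 + s) n * fact n * pochhammer g0 n * pochhammer s0 n)"
    by (simp add: add.commute)
  have E: "2 * of_real (exp (- (1 - \<alpha>) * L)) * (exp (- exponent \<tau> n * of_real (ln 2)) * exp (- exponent2 \<tau> n * of_real (ln 2)) * exp (exponent2 \<tau> n * of_real (2 * L))) * 4 ^ n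
      = complex_of_real (x / 2) powr (s - 1) * of_real (x\<^sup>2) ^ n"
  proof -
    have xL: "x = exp L" using x by (simp add: L_def)
    have four: "(4::complex) ^ n = exp (of_nat n * of_real (2 * ln 2))"
    proof -
      have "exp (complex_of_real (2 * ln 2)) = 4" unfolding exp_of_real by (simp add: exp_double)
      then show ?thesis by (simp only: exp_of_nat_mult)
    qed
    have two: "(2::complex) = exp (of_real (ln 2))" by (simp add: exp_of_real)
    have xx: "complex_of_real (x\<^sup>2) ^ n = exp (of_nat n * of_real (2 * L))"
      unfolding exp_of_nat_mult exp_of_real xL by (simp add: exp_double)
    have pw: "complex_of_real (x / 2) powr (s - 1) = exp ((s - 1) * of_real (L - ln 2))"
    proof -
      have nz: "complex_of_real (x / 2) \<noteq> 0" using x by simp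
      have "Ln (complex_of_real (x / 2)) = of_real (ln (x / 2))" using x by (intro Ln_of_real) simp
      also have "ln (x / 2) = L - ln 2" using x by (simp add: ln_div L_def)
      finally show ?thesis using nz by (simp only: powr_def if_False)
    qed
    have "2 * of_real (exp (- (1 - \<alpha>) * L)) * (exp (- exponent \<tau> n * of_real (ln 2)) * exp (- exponent2 \<tau> n * of_real (ln 2)) * exp (exponent2 \<tau> n * of_real (2 * L))) * 4 ^ n
      = exp (of_real (ln 2)) * exp (of_real (- (1 - \<alpha>) * L)) * (exp (- exponent \<tau> n * of_real (ln 2)) * exp (- exponent2 \<tau> n * of_real (ln 2)) * exp (exponent2 \<tau> n * of_real (2 * L))) * exp (of_nat n * of_real (2 * ln 2))"
      unfolding four exp_of_real[symmetric] by (simp only: two[symmetric])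
    also have "\<dots> = exp (of_real (ln 2) + of_real (- (1 - \<alpha>) * L) + (- exponent \<tau> n * of_real (ln 2) + - exponent2 \<tau> n * of_real (ln 2) + exponent2 \<tau> n * of_real (2 * L)) + of_nat n * of_real (2 * ln 2))"
      by (simp only: exp_add)
    also have "of_real (ln 2) + of_real (- (1 - \<alpha>) * L) + (- exponent \<tau> n * of_real (ln 2) + - exponent2 \<tau> n * of_real (ln 2) + exponent2 \<tau> n * of_real (2 * L)) + of_nat n * of_real (2 * ln 2)
       = (s - 1) * of_real (L - ln 2) + of_nat n * of_real (2 * L)"
      unfolding exponent exponent2 s0_def g0_def by (simp add: field_simps)
    finally show ?thesis unfolding pw xx exp_add .
  qed
  define C where "C = pochhammer (s / 2) n * pochhammer ((s + 1) / 2) n / (pochhammer (1 + s) n * fact n)"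
  have c: "catalan_coeff s n = C * 4 ^ n" by (simp add: catalan_coeff_def C_def)
  have "2 * of_real (exp (- (1 - \<alpha>) * L)) * (coeff2 \<tau> n * exp (exponent2 \<tau> n * of_real (2 * L)))
     = F \<tau> * (2 * of_real (exp (- (1 - \<alpha>) * L)) * (exp (- exponent \<tau> n * of_real (ln 2)) * exp (- exponent2 \<tau> n * of_real (ln 2)) * exp (exponent2 \<tau> n * of_real (2 * L))) * 4 ^ n) * C * (rGamma s0 / pochhammer s0 n * (rGamma g0 / pochhammer g0 n))"
    unfolding coeff2_def coeff1_def s_def[symmetric] c r1 r2 by (simp only: mult_ac)
  also have "\<dots> = F \<tau> * (complex_of_real (x / 2) powr (s - 1) * (rGamma g0 * rGamma s0)) * (fps_nth (fps_hypergeo [s / 2, (1 + s) / 2] [1 + s, g0, s0] 1) n * of_real (x\<^sup>2) ^ n)"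
    unfolding E h C_def by (simp add: mult_ac)
  finally show ?thesis by (simp only: L_def s0_def g0_def s_def)
qed

text \<open>The subtracted hyperbolic cosine integrates to zero against \<open>F\<close>, and the remaining part of the kernel is the integrated
series.\<close>

lemma inversion_formula:
  assumes x: "x > 0"
  shows "integrable lborel (\<lambda>\<tau>. inversion_kernel \<alpha> x \<tau> * F \<tau>)"
    and "\<phi> (ln x) = 1 / of_real pi * (LINT \<tau>|lborel. inversion_kernel \<alpha> x \<tau> * F \<tau>)"
proof -
  define u where "u = (\<lambda>\<tau> n. 2 * of_real (exp (- (1 - \<alpha>) * ln x)) * (coeff2 \<tau> n * exp (exponent2 \<tau> n * of_real (2 * ln x))))"
  define C where "C = 2 * exp (- (1 - \<alpha>) * ln x) * exp (- (\<alpha> / 2 * (2 * ln x)))"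
  define v where "v = (\<lambda>n. C * (coeff2_weight n * exp (2 * ln x) ^ n))"
  have v: "summable v" unfolding v_def by (intro summable_mult summable_coeff2_weight) simp
  have v0: "0 \<le> v n" for n unfolding v_def C_def by (intro mult_nonneg_nonneg coeff2_weight_nonneg) auto
  have um: "(\<lambda>\<tau>. u \<tau> n) \<in> borel_measurable borel" for n unfolding u_def by measurable
  have ule: "norm (u \<tau> n) \<le> (coeff2_const * ((1 + \<bar>\<tau>\<bar>) * weight_F \<tau>)) * v n" for \<tau> n
  proof -
    have "norm (u \<tau> n) = 2 * exp (- (1 - \<alpha>) * ln x) * norm (coeff2 \<tau> n * exp (exponent2 \<tau> n * of_real (2 * ln x)))"
      unfolding u_def norm_mult[of "2 * of_real _"] by (simp add: norm_mult)
    also have "\<dots> \<le> 2 * exp (- (1 - \<alpha>) * ln x) * ((coeff2_const * ((1 + \<bar>\<tau>\<bar>) * weight_F \<tau>)) * (exp (- (\<alpha> / 2 * (2 * ln x))) * (coeff2_weight n * exp (2 * ln x) ^ n)))"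
      by (intro mult_left_mono norm_coeff2_exp_le) auto
    finally show ?thesis by (simp add: v_def C_def mult_ac)
  qed
  note U = nat_line_integral[OF um coeff2_const_weight_F(1) v ule v0]
  have su: "summable (\<lambda>n. u \<tau> n)" for \<tau>
    by (rule summable_norm_cancel, rule summable_comparison_test'[OF summable_mult[OF v, of "coeff2_const * ((1 + \<bar>\<tau>\<bar>) * weight_F \<tau>)"]]) (use ule in simp)
  define Kc where "Kc = 2 / (x * Gamma (\<alpha> / 2) * Gamma (- \<alpha> / 2))"
  have ker: "inversion_kernel \<alpha> x \<tau> * F \<tau> = (\<Sum>n. u \<tau> n) - of_real Kc * (F \<tau> * of_real (cosh (pi * \<tau> / 2)))" for \<tau>
  proof -
    define B where "B = F \<tau> * (complex_of_real (x / 2) powr (\<i> * of_real \<tau> - 1) * (rGamma ((\<i> * of_real \<tau> - of_real \<alpha>) / 2) * rGamma ((of_real \<alpha> + \<i> * of_real \<tau>) / 2)))"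
    define h where "h = (\<lambda>n. fps_nth (fps_hypergeo [\<i> * of_real \<tau> / 2, (1 + \<i> * of_real \<tau>) / 2] [1 + \<i> * of_real \<tau>, (\<i> * of_real \<tau> - of_real \<alpha>) / 2, (of_real \<alpha> + \<i> * of_real \<tau>) / 2] 1) n * of_real (x\<^sup>2) ^ n)"
    have uB: "u \<tau> n = B * h n" for n unfolding u_def B_def h_def by (rule kernel_series[OF x])
    have "(\<Sum>n. u \<tau> n) = B * (\<Sum>n. h n)"
    proof (cases "B = 0")
      case False
      have "summable (\<lambda>n. B * h n)" using su[of \<tau>] by (simp only: uB)
      then have "summable h" using False by (simp add: summable_cmult_iff)
      then show ?thesis unfolding uB by (rule suminf_mult)
    qed (simp add: uB)
    also have "(\<Sum>n. h n) = hyp2F3 (\<i> * of_real \<tau> / 2) ((1 + \<i> * of_real \<tau>) / 2)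
           (1 + \<i> * of_real \<tau>) ((\<i> * of_real \<tau> - of_real \<alpha>) / 2) ((of_real \<alpha> + \<i> * of_real \<tau>) / 2) (of_real (x\<^sup>2))"
      unfolding hyp2F3_def eval_fps_def h_def ..
    finally have S: "(\<Sum>n. u \<tau> n) = B * hyp2F3 (\<i> * of_real \<tau> / 2) ((1 + \<i> * of_real \<tau>) / 2)
           (1 + \<i> * of_real \<tau>) ((\<i> * of_real \<tau> - of_real \<alpha>) / 2) ((of_real \<alpha> + \<i> * of_real \<tau>) / 2) (of_real (x\<^sup>2))" .
    have k: "complex_of_real (2 * cosh (pi * \<tau> / 2) / (x * Gamma (\<alpha> / 2) * Gamma (- \<alpha> / 2))) = of_real Kc * of_real (cosh (pi * \<tau> / 2))"
      by (simp add: Kc_def)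
    have d: "a / (b * c) * e * f = f * (a * (inverse b * inverse c)) * e" for a b c e f :: complex
      by (simp add: field_simps)
    show ?thesis unfolding inversion_kernel_def k S B_def left_diff_distrib d rGamma_inverse_Gamma
      by (simp only: mult_ac)
  qed
  show "integrable lborel (\<lambda>\<tau>. inversion_kernel \<alpha> x \<tau> * F \<tau>)"
    unfolding ker by (intro Bochner_Integration.integrable_diff U(3) integrable_mult_right cosh_moment_zero(1))
  have "(LINT \<tau>|lborel. inversion_kernel \<alpha> x \<tau> * F \<tau>) = (LINT \<tau>|lborel. (\<Sum>n. u \<tau> n)) - (LINT \<tau>|lborel. of_real Kc * (F \<tau> * of_real (cosh (pi * \<tau> / 2))))"
    unfolding ker by (rule Bochner_Integration.integral_diff[OF U(3) integrable_mult_right[OF cosh_moment_zero(1)]])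
  also have "\<dots> = (LINT z|nat_line. u (fst z) (snd z))"
    unfolding U(2) integral_mult_right_zero cosh_moment_zero(2) by simp
  also have "\<dots> = 2 * of_real (exp (- (1 - \<alpha>) * ln x)) * series2 (2 * ln x)"
    unfolding u_def series2_def by (simp only: integral_mult_right_zero)
  finally have I: "(LINT \<tau>|lborel. inversion_kernel \<alpha> x \<tau> * F \<tau>) = 2 * of_real (exp (- (1 - \<alpha>) * ln x)) * series2 (2 * ln x)" .
  have "of_real (exp ((1 - \<alpha>) * ln x)) * \<phi> (ln x) = 2 / of_real pi * series2 (2 * ln x)"
    using stage2_eq_series2[of "2 * ln x"] by (simp add: stage2_def)
  then have "of_real (exp (- (1 - \<alpha>) * ln x)) * (of_real (exp ((1 - \<alpha>) * ln x)) * \<phi> (ln x)) = of_real (exp (- (1 - \<alpha>) * ln x)) * (2 / of_real pi * series2 (2 * ln x))"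
    by (simp only:)
  moreover have "of_real (exp (- (1 - \<alpha>) * ln x)) * (of_real (exp ((1 - \<alpha>) * ln x)) * \<phi> (ln x)) = \<phi> (ln x)"
  proof -
    have "exp (- (1 - \<alpha>) * ln x) * exp ((1 - \<alpha>) * ln x) = 1" by (simp add: algebra_simps flip: exp_add)
    then show ?thesis by (simp only: mult.assoc[symmetric] of_real_mult[symmetric] of_real_1 mult_1_left)
  qed
  ultimately show "\<phi> (ln x) = 1 / of_real pi * (LINT \<tau>|lborel. inversion_kernel \<alpha> x \<tau> * F \<tau>)"
    unfolding I by (simp add: mult_ac)
qed

end

section \<open>From Mellin data to the inversion formula\<close>

lemma integrable_inverse_one_plus_square: "integrable lborel (\<lambda>t::real. inverse (1 + t\<^sup>2))"
  using integrable_inverse_1_plus_square by (simp add: set_integrable_def)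

text \<open>For \<open>|t| \<le> 1\<close> use \<open>|g| \<le> 1 + |g|^p\<close>. For \<open>|t| > 1\<close> let \<open>a = |t g|\<close>: if \<open>a \<le> 1/|t|\<close> then \<open>|g| \<le> 1/t^2\<close>; otherwise
\<open>1/|t| \<le> (1/|t|)^{p-1} \<le> a^{p-1}\<close>, since \<open>p \<le> 2\<close>, and \<open>|g| = a/|t| \<le> a^p\<close>. This elementary substitute for Hoelder's inequality
makes all three majorants visibly integrable.\<close>

lemma Lp_line_integrable:
  assumes p: "1 < p" "p \<le> 2" and g: "Lp_line p \<nu> g" and sg: "Lp_line p \<nu> (\<lambda>s. s * g s)"
  shows "integrable lborel (\<lambda>t. g (Complex \<nu> t))"
proof (rule Bochner_Integration.integrable_bound)
  define G where "G = (\<lambda>t. g (Complex \<nu> t))"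
  define w where "w = (\<lambda>t. norm (G t) powr p + norm (Complex \<nu> t * G t) powr p + 2 * inverse (1 + t\<^sup>2))"
  show "integrable lborel w" unfolding w_def G_def
    using g sg by (intro Bochner_Integration.integrable_add integrable_mult_right integrable_inverse_one_plus_square) (auto simp: Lp_line_def)
  show "(\<lambda>t. g (Complex \<nu> t)) \<in> borel_measurable lborel" using g by (simp add: Lp_line_def)
  have "norm (G t) \<le> w t" for t
  proof (cases "\<bar>t\<bar> \<le> 1")
    case True
    have "norm (G t) \<le> norm (G t) powr p + 1"
    proof (cases "norm (G t) \<le> 1")
      case False
      then have "norm (G t) powr 1 \<le> norm (G t) powr p" using p by (intro powr_mono) auto
      with False show ?thesis by simp
    qed (simp add: add_increasing)
    moreover have "1 \<le> 2 * inverse (1 + t\<^sup>2)"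
    proof -
      have "t\<^sup>2 \<le> 1" using True by (simp add: abs_square_le_1)
      then show ?thesis by (simp add: field_simps add_pos_nonneg)
    qed
    ultimately show ?thesis unfolding w_def using powr_ge_zero[of "norm (Complex \<nu> t * G t)" p] by linarith
  next
    case False
    define a where "a = \<bar>t\<bar> * norm (G t)"
    have t: "\<bar>t\<bar> > 1" using False by simp
    have Ga: "norm (G t) = a / \<bar>t\<bar>" using t by (simp add: a_def)
    have a0: "a \<ge> 0" by (simp add: a_def)
    have "norm (Complex \<nu> t) \<ge> \<bar>t\<bar>" using abs_Im_le_cmod[of "Complex \<nu> t"] by simp
    then have "a \<le> norm (Complex \<nu> t * G t)" unfolding a_def norm_mult by (intro mult_right_mono) auto
    then have ap: "a powr p \<le> norm (Complex \<nu> t * G t) powr p" using p a0 by (intro powr_mono2) auto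
    have "a / \<bar>t\<bar> \<le> a powr p + 2 * inverse (1 + t\<^sup>2)"
    proof (cases "a \<le> 1 / \<bar>t\<bar>")
      case True
      have "a / \<bar>t\<bar> \<le> (1 / \<bar>t\<bar>) / \<bar>t\<bar>" using True t by (intro divide_right_mono) auto
      also have "\<dots> = 1 / t\<^sup>2" by (simp add: power2_eq_square flip: abs_mult)
      also have "\<dots> \<le> 2 * inverse (1 + t\<^sup>2)"
      proof -
        have t1: "1 \<le> t\<^sup>2" using power_mono[of 1 "\<bar>t\<bar>" 2] t by simp
        then have "0 < t\<^sup>2" by linarith
        then show ?thesis using t1 by (simp add: field_simps add_pos_pos)
      qed
      finally show ?thesis using powr_ge_zero[of a p] by linarith
    next
      case False
      then have a1: "1 / \<bar>t\<bar> < a" by simp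
      have "0 < 1 / \<bar>t\<bar>" using t by simp
      then have apos: "a > 0" using a1 by linarith
      have "1 / \<bar>t\<bar> = (1 / \<bar>t\<bar>) powr 1" using t by simp
      also have "\<dots> \<le> (1 / \<bar>t\<bar>) powr (p - 1)" using t p by (intro powr_mono') auto
      also have "\<dots> \<le> a powr (p - 1)" using t p a1 by (intro powr_mono2) auto
      finally have "a * (1 / \<bar>t\<bar>) \<le> a * a powr (p - 1)" using apos by (intro mult_left_mono) auto
      also have "\<dots> = a powr p" using apos by (simp add: powr_diff)
      finally show ?thesis by (simp add: add_increasing2)
    qed
    then show ?thesis unfolding w_def Ga using ap powr_ge_zero[of "a / \<bar>t\<bar>" p] by linarith
  qed
  then have "norm (g (Complex \<nu> t)) \<le> norm (w t)" for t
    unfolding G_def real_norm_def by (rule order_trans[OF _ abs_ge_self])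
  then show "AE t in lborel. norm (g (Complex \<nu> t)) \<le> norm (w t)" by simp
qed

lemma mellin_inverse_exp:
  assumes "integrable lborel (\<lambda>t. g (Complex \<nu> t))"
  shows "\<And>c. isCont (\<lambda>c. mellin_inverse \<nu> g (exp c)) c"
    and "\<And>c. norm (mellin_inverse \<nu> g (exp c)) \<le> (LINT t|lborel. norm (g (Complex \<nu> t))) * exp (- \<nu> * c)"
proof -
  define G where "G = (\<lambda>t. g (Complex \<nu> t))"
  have G: "integrable lborel G" using assms by (simp add: G_def)
  have [measurable]: "G \<in> borel_measurable borel" using G by simp
  have pw: "complex_of_real (exp c) powr z = exp (z * of_real c)" for c z
    by (simp add: powr_def Ln_of_real)
  have e: "mellin_inverse \<nu> g (exp c) = 1 / (2 * of_real pi) * (LINT t|lborel. G t * exp (- Complex \<nu> t * of_real c))" for c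
    unfolding mellin_inverse_def pw G_def ..
  have Cm: "(\<lambda>t. Complex \<nu> t) = (\<lambda>t. of_real \<nu> + \<i> * of_real t)" by (auto simp: complex_eq_iff)
  have [measurable]: "(\<lambda>t. Complex \<nu> t) \<in> borel_measurable borel" unfolding Cm by measurable
  show "isCont (\<lambda>c. mellin_inverse \<nu> g (exp c)) c" for c
    unfolding e
  proof (intro continuous_intros isCont_integral_dominated[where r=1 and w="\<lambda>t. norm (G t) * exp (\<bar>\<nu>\<bar> * (\<bar>c\<bar> + 1))"])
    show "(\<lambda>t. G t * exp (- Complex \<nu> t * of_real u)) \<in> borel_measurable lborel" for u by measurable
    show "norm (G t * exp (- Complex \<nu> t * of_real u)) \<le> norm (G t) * exp (\<bar>\<nu>\<bar> * (\<bar>c\<bar> + 1))" if "dist u c < 1" for u t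
    proof -
      have "- \<nu> * u \<le> \<bar>\<nu>\<bar> * \<bar>u\<bar>" by (metis abs_ge_self abs_minus_cancel abs_mult)
      also have "\<dots> \<le> \<bar>\<nu>\<bar> * (\<bar>c\<bar> + 1)" using that unfolding dist_real_def by (intro mult_left_mono) linarith+
      finally show ?thesis by (simp add: norm_mult mult_left_mono)
    qed
    show "integrable lborel (\<lambda>t. norm (G t) * exp (\<bar>\<nu>\<bar> * (\<bar>c\<bar> + 1)))" using G by simp
  qed auto
  show "norm (mellin_inverse \<nu> g (exp c)) \<le> (LINT t|lborel. norm (g (Complex \<nu> t))) * exp (- \<nu> * c)" for c
  proof -
    have "norm (LINT t|lborel. G t * exp (- Complex \<nu> t * of_real c)) \<le> (LINT t|lborel. norm (G t * exp (- Complex \<nu> t * of_real c)))"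
      by (rule integral_norm_bound)
    also have "\<dots> = (LINT t|lborel. norm (G t)) * exp (- \<nu> * c)" by (simp add: norm_mult)
    finally have 1: "norm (LINT t|lborel. G t * exp (- Complex \<nu> t * of_real c)) \<le> (LINT t|lborel. norm (G t)) * exp (- \<nu> * c)" .
    have "norm (mellin_inverse \<nu> g (exp c)) = 1 / (2 * pi) * norm (LINT t|lborel. G t * exp (- Complex \<nu> t * of_real c))"
      unfolding e by (simp add: norm_mult norm_divide)
    also have "\<dots> \<le> 1 * norm (LINT t|lborel. G t * exp (- Complex \<nu> t * of_real c))"
      using pi_gt3 by (intro mult_right_mono) (auto simp: field_simps)
    finally show ?thesis using 1 by (simp add: G_def)
  qed
qed

theorem theorem6:
  fixes \<alpha> \<nu> p q :: real
    and f :: "real \<Rightarrow> complex" and fstar :: "complex \<Rightarrow> complex"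
  assumes "0 < \<alpha>" and "\<alpha> < 1" and "\<nu> < 1 - \<alpha>"
    and "1 < p" and "p \<le> 2" and "q = p / (p - 1)"
    and "mellin_transform_Lp p q \<nu> f fstar"
    and "Lp_line p \<nu> (\<lambda>s. s * fstar s)"
    and "\<And>x. 0 < x \<Longrightarrow> f x = mellin_inverse \<nu> fstar x"
    and "set_integrable lborel {1<..} (\<lambda>t. of_real (t powr \<alpha>) * f t)"
    and "integrable lborel (\<lambda>\<tau>. of_real (\<tau> * exp (pi * \<bar>\<tau>\<bar>)) * F_transform \<alpha> f \<tau>)"
    and "mellin f (of_real (1 - \<alpha>)) = 0"
  shows "\<forall>x>0.
    integrable lborel (\<lambda>\<tau>. inversion_kernel \<alpha> x \<tau> * F_transform \<alpha> f \<tau>) \<and>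
    f x = 1 / of_real pi * (LINT \<tau>|lborel. inversion_kernel \<alpha> x \<tau> * F_transform \<alpha> f \<tau>)"
proof -
  define \<phi> where "\<phi> = (\<lambda>c. f (exp c))"
  have fphi: "f x = \<phi> (ln x)" if "x > 0" for x using that by (simp add: \<phi>_def)
  have Gi: "integrable lborel (\<lambda>t. fstar (Complex \<nu> t))"
    using assms(4,5,7,8) by (intro Lp_line_integrable) (auto simp: mellin_transform_Lp_def)
  have phim: "\<phi> = (\<lambda>c. mellin_inverse \<nu> fstar (exp c))" using assms(9) by (auto simp: \<phi>_def)
  have cont: "isCont \<phi> c" for c unfolding phim by (rule mellin_inverse_exp(1)[OF Gi])
  define M where "M = (LINT t|lborel. norm (fstar (Complex \<nu> t)))"
  have phib: "norm (\<phi> c) \<le> M * exp (- \<nu> * c)" for c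
    unfolding phim M_def by (rule mellin_inverse_exp(2)[OF Gi])
  have M: "M \<ge> 0" by (simp add: M_def)
  have [measurable]: "\<phi> \<in> borel_measurable borel"
    using cont by (intro borel_measurable_continuous_onI) (simp add: continuous_at_imp_continuous_on)
  have fm: "set_borel_measurable borel {0<..} (\<lambda>x. h x * f x)" if [measurable]: "h \<in> borel_measurable borel" for h :: "real \<Rightarrow> complex"
  proof -
    have "(\<lambda>x. indicator {0<..} x *\<^sub>R (h x * f x)) = (\<lambda>x. indicator {0<..} x *\<^sub>R (h x * \<phi> (ln x)))"
      using fphi by (auto simp: indicator_def fun_eq_iff)
    also have "\<dots> \<in> borel_measurable borel" by measurable
    finally show ?thesis by (simp add: set_borel_measurable_def)
  qed
  define W where "W = (\<lambda>c. indicator {0<..} c * (exp ((1 + \<alpha>) * c) * norm (\<phi> c)))"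
  have W: "integrable lborel W"
  proof -
    define h where "h = (\<lambda>t. indicator {1<..} t *\<^sub>R complex_of_real (t powr \<alpha>))"
    have [measurable]: "h \<in> borel_measurable borel" unfolding h_def by measurable
    have "set_integrable lborel {0<..} (\<lambda>x. h x * f x)"
    proof -
      have "(\<lambda>x. indicator {0<..} x *\<^sub>R (h x * f x)) = (\<lambda>x. indicator {1<..} x *\<^sub>R (of_real (x powr \<alpha>) * f x))"
        by (auto simp: h_def indicator_def fun_eq_iff)
      then show ?thesis using assms(10) unfolding set_integrable_def by simp
    qed
    then have "integrable lborel (\<lambda>a. of_real (exp a) * (h (exp a) * \<phi> a))"
      unfolding set_integrable_exp_substitution(1)[OF fm[OF \<open>h \<in> borel_measurable borel\<close>]] \<phi>_def .
    then have "integrable lborel (\<lambda>a. norm (of_real (exp a) * (h (exp a) * \<phi> a)))" by (rule integrable_norm)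
    moreover have "norm (of_real (exp a) * (h (exp a) * \<phi> a)) = W a" for a
    proof -
      have "exp a * exp (\<alpha> * a) = exp ((1 + \<alpha>) * a)" unfolding exp_add[symmetric] by (simp add: algebra_simps)
      then show ?thesis by (simp add: h_def W_def norm_mult indicator_def powr_def)
    qed
    ultimately show ?thesis by simp
  qed
  (* Near the origin f = O(x^{-\<nu>}) and \<nu> < 1 - \<alpha>, near infinity the integrability hypothesis applies; the majorant serves
     both weights x^\<alpha> and x^{-\<alpha>}. *)
  define \<delta> where "\<delta> = 1 - \<alpha> - \<nu>"
  have del: "\<delta> > 0" using assms(3) by (simp add: \<delta>_def)
  have Wb: "integrable lborel (\<lambda>c. W c + M * exp (- \<delta> * \<bar>c\<bar>))"
    by (intro Bochner_Integration.integrable_add W integrable_mult_right integrable_exp_abs del)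
  have W0: "W c \<ge> 0" for c by (simp add: W_def)
  have bnd: "exp ((1 + s * \<alpha>) * c) * norm (\<phi> c) \<le> W c + M * exp (- \<delta> * \<bar>c\<bar>)" if s: "s = 1 \<or> s = (-1)" for s c
  proof (cases "c > 0")
    case True
    have "s * \<alpha> \<le> \<alpha>" using s assms(1) by auto
    then have "(1 + s * \<alpha>) * c \<le> (1 + \<alpha>) * c" using True by (intro mult_right_mono) auto
    then have "exp ((1 + s * \<alpha>) * c) * norm (\<phi> c) \<le> W c" using True by (simp add: W_def mult_right_mono)
    then show ?thesis using M by (simp add: add_increasing2)
  next
    case False
    have "- \<alpha> \<le> s * \<alpha>" using s assms(1) by auto
    then have "(1 + s * \<alpha>) * c \<le> (1 - \<alpha>) * c" using False by (intro mult_right_mono_neg) auto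
    then have "exp ((1 + s * \<alpha>) * c) * norm (\<phi> c) \<le> exp ((1 - \<alpha>) * c) * (M * exp (- \<nu> * c))"
      by (intro mult_mono phib) auto
    also have "\<dots> = M * exp (- \<delta> * \<bar>c\<bar>)" using False by (simp add: \<delta>_def algebra_simps flip: exp_add)
    finally show ?thesis using W0[of c] by simp
  qed
  have phii: "integrable lborel (\<lambda>c. of_real (exp ((1 + s * \<alpha>) * c)) * \<phi> c)" if s: "s = 1 \<or> s = (-1)" for s :: real
  proof (rule Bochner_Integration.integrable_bound[OF Wb])
    have "norm (of_real (exp ((1 + s * \<alpha>) * c)) * \<phi> c) \<le> norm (W c + M * exp (- \<delta> * \<bar>c\<bar>))" for c
      using bnd[OF s, of c] by (simp add: norm_mult)
    then show "AE c in lborel. norm (of_real (exp ((1 + s * \<alpha>) * c)) * \<phi> c) \<le> norm (W c + M * exp (- \<delta> * \<bar>c\<bar>))" by simp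
  qed simp
  have mom: "(LINT c|lborel. of_real (exp ((1 - \<alpha>) * c)) * \<phi> c) = 0"
  proof -
    define h where "h = (\<lambda>x. complex_of_real x powr (of_real (1 - \<alpha>) - 1))"
    have he: "of_real (exp a) * (h (exp a) * f (exp a)) = of_real (exp ((1 - \<alpha>) * a)) * \<phi> a" for a
    proof -
      have "h (exp a) = exp (of_real (- \<alpha> * a))" by (simp add: h_def powr_def Ln_of_real)
      also have "\<dots> = of_real (exp (- \<alpha> * a))" by (rule exp_of_real)
      finally have "of_real (exp a) * (h (exp a) * f (exp a)) = of_real (exp a * exp (- \<alpha> * a)) * \<phi> a"
        by (simp add: \<phi>_def)
      also have "exp a * exp (- \<alpha> * a) = exp ((1 - \<alpha>) * a)" unfolding exp_add[symmetric] by (simp add: algebra_simps)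
      finally show ?thesis .
    qed
    have "h \<in> borel_measurable borel" unfolding h_def powr_def by measurable
    from set_integrable_exp_substitution(2)[OF fm[OF this]]
    have "(LINT x:{0<..}|lborel. h x * f x) = (LINT a|lborel. of_real (exp ((1 - \<alpha>) * a)) * \<phi> a)"
      unfolding he .
    moreover have "(LINT x:{0<..}|lborel. h x * f x) = mellin f (of_real (1 - \<alpha>))"
      unfolding mellin_def h_def by (simp only: mult.commute)
    ultimately show ?thesis using assms(12) by simp
  qed
  interpret macdonald_source \<alpha> \<phi>
    using assms(1,2) cont phii[of 1] phii[of "-1"] mom by unfold_locales simp_all
  interpret macdonald_inversion \<alpha> \<phi> "F_transform \<alpha> f"
  proof
    fix \<tau> :: real
    define K where "K = (\<lambda>x. complex_of_real ((norm (Macdonald_K ((\<i> * of_real \<tau> + of_real \<alpha>) / 2) (of_real x)))\<^sup>2))"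
    have [measurable]: "K \<in> borel_measurable borel"
      unfolding K_def Macdonald_K_def set_lebesgue_integral_def cosh_field_def by measurable
    have "F_transform \<alpha> f \<tau> = (LINT x:{0<..}|lborel. K x * f x)" by (simp only: F_transform_def K_def)
    also have "\<dots> = (LINT a|lborel. of_real (exp a) * (K (exp a) * \<phi> a))"
      unfolding set_integrable_exp_substitution(2)[OF fm[OF \<open>K \<in> borel_measurable borel\<close>]] \<phi>_def ..
    also have "\<dots> = (LINT b|lborel. exp (\<i> * of_real (\<tau> * b)) * macdonald_transform \<alpha> \<phi> (2 * cosh b))"
      unfolding K_def by (rule F_transform_eq)
    finally show "F_transform \<alpha> f \<tau> = (LINT b|lborel. exp (\<i> * of_real (\<tau> * b)) * macdonald_transform \<alpha> \<phi> (2 * cosh b))" .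
  qed (rule assms(11))
  show ?thesis
  proof (intro allI impI)
    fix x :: real assume x: "x > 0"
    show "integrable lborel (\<lambda>\<tau>. inversion_kernel \<alpha> x \<tau> * F_transform \<alpha> f \<tau>) \<and>
      f x = 1 / of_real pi * (LINT \<tau>|lborel. inversion_kernel \<alpha> x \<tau> * F_transform \<alpha> f \<tau>)"
      unfolding fphi[OF x] using inversion_formula[OF x] by (rule conjI)
  qed
qed

end
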